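(* The assignment $\mathsf{M}\mapsto Y_{\mathsf{M}}(t)\in\mathbb{R}[t]$ (regarded as a map on matroid base polytopes, $\mathscr{P}(\mathsf{M})\mapsto Y_{\mathsf{M}}(t)$) is a valuative invariant.
   Context: For a matroid $\mathsf{M}$ on $E$ with rank function $\mathrm{rk}$, $\mathcal{L}(\mathsf{M})$ is its lattice of flats, $\mathsf{M}|_F$ the restriction, $\mathsf{M}/F$ the contraction; $\mathrm{rk}(\mathsf{M}/F)=\mathrm{rk}(\mathsf{M})-\mathrm{rk}(F)$. For loopless $\mathsf{M}$, $\mu_{\mathsf{M}}=\mu(\emptyset,E)$ in $\mathcal{L}(\mathsf{M})$ ($=1$ in rank $0$), $\chi_{\mathsf{M}}(t)=\sum_{F\in\mathcal{L}(\mathsf{M})}\mu_{\mathsf{M}|_F}t^{\mathrm{rk}(\mathsf{M}/F)}$. The inverse Kazhdan–Lusztig polynomial $Q_{\mathsf{M}}(t)$ of a loopless matroid is the unique assignment with $Q_{\mathsf{M}}=1$ in rank $0$, $\deg Q_{\mathsf{M}}<\mathrm{rk}(\mathsf{M})/2$ in positive rank, and $(-t)^{\mathrm{rk}(\mathsf{M})}Q_{\mathsf{M}}(t^{-1})=\sum_{F\in\mathcal{L}(\mathsf{M})}(-1)^{\mathrm{rk}(F)}Q_{\mathsf{M}|_F}(t)t^{\mathrm{rk}(\mathsf{M}/F)}\chi_{\mathsf{M}/F}(t^{-1})$. For loopless $\mathsf{M}$, $Y_{\mathsf{M}}(t)=(-1)^{\mathrm{rk}(\mathsf{M})}\sum_{F\in\mathcal{L}(\mathsf{M})}(-1)^{\mathrm{rk}(F)}Q_{\mathsf{M}|_F}(t)t^{\mathrm{rk}(\mathsf{M}/F)}\mu_{\mathsf{M}/F}$;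 if $\mathsf{M}$ has loops, $Y_{\mathsf{M}}:=Y_{\mathsf{M}'}$ with $\mathsf{M}'$ the deletion of all loops. Matroids have finite ground sets $E\subseteq\mathbb{Z}_{\ge1}$. The base polytope of $\mathsf{M}=(E,\mathscr{B})$ is $\mathscr{P}(\mathsf{M})=\mathrm{conv}\{e_B:B\in\mathscr{B}\}\subseteq\mathbb{R}^E$, $e_B=\sum_{i\in B}e_i$. A subdivision of $\mathscr{P}=\mathscr{P}(\mathsf{M})$ is a finite collection $\mathcal{S}=\{\mathscr{P}_1,\dots,\mathscr{P}_s\}$ of matroid base polytopes in $\mathbb{R}^E$ with $\mathscr{P}=\bigcup\mathscr{P}_i$, every face of each $\mathscr{P}_i$ lies in $\mathcal{S}$, and $\mathscr{P}_i\cap\mathscr{P}_j$ is a common (possibly empty) face for $i\neq j$; $\mathcal{S}^{\mathrm{int}}=\{\mathscr{P}_i\in\mathcal{S}:\mathscr{P}_i\not\subseteq\partial\mathscr{P}\}$. A map $f$ from the set of all matroid base polytopes to an abelian group is an invariant if $f(\mathscr{P}(\mathsf{M}))=f(\mathscr{P}(\mathsf{N}))$ whenever $\mathsf{M}\cong\mathsf{N}$, and a valuation if $f(\mathscr{P})=\sum_{\mathscr{P}_i\in\mathcal{S}^{\mathrm{int}}}(-1)^{\dim\mathscr{P}-\dim\mathscr{P}_i}f(\mathscr{P}_i)$ for every matroid base polytope $\mathscr{P}$ and every subdivision $\mathcal{S}$ of it; a valuative invariant is both. *)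

theory Defs
  imports
    "HOL-Analysis.Analysis"
    "HOL-Analysis.Finite_Function_Topology"
    "HOL-Computational_Algebra.Polynomial"
begin

section \<open>Matroids\<close>

datatype matroid = Matroid (ground: "nat set") (bases: "nat set set")

definition is_matroid :: "matroid \<Rightarrow> bool" where
  "is_matroid M \<longleftrightarrow>
     finite (ground M) \<and> ground M \<subseteq> {1..} \<and>
     bases M \<noteq> {} \<and> (\<forall>B\<in>bases M. B \<subseteq> ground M) \<and>
     (\<forall>A\<in>bases M. \<forall>B\<in>bases M. \<forall>a\<in>A - B. \<exists>b\<in>B - A. insert b (A - {a}) \<in> bases M)"

definition rank_of :: "matroid \<Rightarrow> nat set \<Rightarrow> nat" where
  "rank_of M X = Max ((\<lambda>B. card (X \<inter> B)) ` bases M)"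

abbreviation rk :: "matroid \<Rightarrow> nat" where
  "rk M \<equiv> rank_of M (ground M)"

definition flats :: "matroid \<Rightarrow> nat set set" where
  "flats M = {F. F \<subseteq> ground M \<and> (\<forall>e\<in>ground M - F. rank_of M (insert e F) > rank_of M F)}"

definition loops :: "matroid \<Rightarrow> nat set" where
  "loops M = {e \<in> ground M. \<forall>B\<in>bases M. e \<notin> B}"

definition loopless :: "matroid \<Rightarrow> bool" where
  "loopless M \<longleftrightarrow> loops M = {}"

definition restriction :: "matroid \<Rightarrow> nat set \<Rightarrow> matroid" where
  "restriction M X = Matroid X {X \<inter> B |B. B \<in> bases M \<and> card (X \<inter> B) = rank_of M X}"

definition deletion :: "matroid \<Rightarrow> nat set \<Rightarrow> matroid" where
  "deletion M X = restriction M (ground M - X)"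

definition contraction :: "matroid \<Rightarrow> nat set \<Rightarrow> matroid" where
  "contraction M X = Matroid (ground M - X) {B - X |B. B \<in> bases M \<and> card (X \<inter> B) = rank_of M X}"

definition matroid_iso :: "matroid \<Rightarrow> matroid \<Rightarrow> bool" where
  "matroid_iso M N \<longleftrightarrow>
     (\<exists>\<phi>. bij_betw \<phi> (ground M) (ground N) \<and> bases N = (\<lambda>B. \<phi> ` B) ` bases M)"


section \<open>The polynomials\<close>

text \<open>The Moebius function of a family \<open>L\<close> of finite sets ordered by inclusion.\<close>

function moebius :: "nat set set \<Rightarrow> nat set \<Rightarrow> nat set \<Rightarrow> int" where
  "moebius L X Y =
     (if X = Y then 1
      else if X \<subset> Y \<and> finite Y then - (\<Sum>Z\<in>{Z \<in> L. X \<subseteq> Z \<and> Z \<subset> Y}. moebius L X Z)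
      else 0)"
  by pat_completeness auto
termination
  by (relation "Wellfounded.measure (\<lambda>(L, X, Y). card Y)") (auto intro: psubset_card_mono)

declare moebius.simps [simp del]

definition mu :: "matroid \<Rightarrow> int" where
  "mu M = moebius (flats M) {} (ground M)"

definition char_poly :: "matroid \<Rightarrow> real poly" where
  "char_poly M =
     (\<Sum>F\<in>flats M. monom (of_int (mu (restriction M F))) (rk (contraction M F)))"

text \<open>The defining identity is one of Laurent polynomials in \<open>t\<close>; over the reals it holds iff it
  holds at all \<open>t \<noteq> 0\<close>. An assignment is set to \<open>0\<close> outside the loopless matroids,
  so that it can be unique as a function.\<close>

definition inverse_KL_assignment :: "(matroid \<Rightarrow> real poly) \<Rightarrow> bool" where
  "inverse_KL_assignment Q \<longleftrightarrow>
     (\<forall>M. is_matroid M \<and> loopless M \<longrightarrow>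
        (rk M = 0 \<longrightarrow> Q M = 1) \<and>
        (rk M > 0 \<longrightarrow> real (degree (Q M)) < real (rk M) / 2) \<and>
        (\<forall>t::real. t \<noteq> 0 \<longrightarrow>
           (- t) ^ rk M * poly (Q M) (1 / t) =
           (\<Sum>F\<in>flats M. (-1) ^ rank_of M F * poly (Q (restriction M F)) t *
              t ^ rk (contraction M F) * poly (char_poly (contraction M F)) (1 / t)))) \<and>
     (\<forall>M. \<not> (is_matroid M \<and> loopless M) \<longrightarrow> Q M = 0)"

definition inverse_KL :: "matroid \<Rightarrow> real poly" where
  "inverse_KL = (THE Q. inverse_KL_assignment Q)"

definition Y_loopless :: "matroid \<Rightarrow> real poly" where
  "Y_loopless M = (-1) ^ rk M *
     (\<Sum>F\<in>flats M. (-1) ^ rank_of M F * inverse_KL (restriction M F) *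
        monom (of_int (mu (contraction M F))) (rk (contraction M F)))"

definition Y_poly :: "matroid \<Rightarrow> real poly" where
  "Y_poly M = (if loopless M then Y_loopless M else Y_loopless (deletion M (loops M)))"


section \<open>Base polytopes, subdivisions, valuative invariants\<close>

text \<open>The space of real vectors indexed by a finite set \<open>E\<close> is modelled as the finitely supported
  functions with support in \<open>E\<close>. As these spaces are nested here, a polytope is paired with
  the index set of its ambient space; otherwise adding a loop to a matroid would not
  change its base polytope.\<close>

type_synonym vec = "nat \<Rightarrow>\<^sub>0 real"
type_synonym polytope = "nat set \<times> vec set"

definition indicator_vec :: "nat set \<Rightarrow> vec" where
  "indicator_vec B = (\<Sum>i\<in>B. Poly_Mapping.single i 1)"

definition base_polytope :: "matroid \<Rightarrow> polytope" where
  "base_polytope M = (ground M, convex hull (indicator_vec ` bases M))"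

definition is_base_polytope :: "polytope \<Rightarrow> bool" where
  "is_base_polytope p \<longleftrightarrow> (\<exists>M. is_matroid M \<and> p = base_polytope M)"

text \<open>Dimension of the affine hull, as that of its direction space (\<^const>\<open>aff_dim\<close> is
  confined to Euclidean types).\<close>

definition polytope_dim :: "vec set \<Rightarrow> nat" where
  "polytope_dim P = dim {x - y |x y. x \<in> P \<and> y \<in> P}"

text \<open>The empty set is a face in the sense of \<^const>\<open>face_of\<close> but is not a base polytope,
  so closure under faces concerns the nonempty ones.\<close>

definition subdivision :: "nat set \<Rightarrow> vec set \<Rightarrow> vec set set \<Rightarrow> bool" where
  "subdivision E P S \<longleftrightarrow>
     finite S \<and>
     (\<forall>R\<in>S. is_base_polytope (E, R)) \<and>
     P = \<Union>S \<and>
     (\<forall>R\<in>S. \<forall>G. G face_of R \<and> G \<noteq> {} \<longrightarrow> G \<in> S) \<and>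
     (\<forall>R\<in>S. \<forall>R'\<in>S. R \<noteq> R' \<longrightarrow> (R \<inter> R') face_of R \<and> (R \<inter> R') face_of R')"

definition interior_cells :: "vec set \<Rightarrow> vec set set \<Rightarrow> vec set set" where
  "interior_cells P S = {R \<in> S. \<not> R \<subseteq> rel_frontier P}"

definition polytope_invariant :: "(polytope \<Rightarrow> 'g) \<Rightarrow> bool" where
  "polytope_invariant f \<longleftrightarrow>
     (\<forall>M N. is_matroid M \<and> is_matroid N \<and> matroid_iso M N \<longrightarrow>
        f (base_polytope M) = f (base_polytope N))"

definition valuation :: "(polytope \<Rightarrow> 'g::ab_group_add) \<Rightarrow> bool" where
  "valuation f \<longleftrightarrow>
     (\<forall>E P S. is_base_polytope (E, P) \<and> subdivision E P S \<longrightarrow>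
        f (E, P) = (\<Sum>R\<in>interior_cells P S.
          if even (int (polytope_dim P) - int (polytope_dim R)) then f (E, R) else - f (E, R)))"

definition valuative_invariant :: "(polytope \<Rightarrow> 'g::ab_group_add) \<Rightarrow> bool" where
  "valuative_invariant f \<longleftrightarrow> polytope_invariant f \<and> valuation f"

text \<open>A matroid is determined by its base polytope, so a map on matroids induces one on
  base polytopes.\<close>

lemma lookup_indicator_vec:
  assumes "finite B"
  shows "Poly_Mapping.lookup (indicator_vec B) i = (if i \<in> B then 1 else 0)"
  using assms unfolding indicator_vec_def
  by (induction B) (auto simp: Poly_Mapping.lookup_add Poly_Mapping.lookup_single when_def)

lemma lookup_scaleR_vec: "Poly_Mapping.lookup (r *\<^sub>R (x::vec)) i = r * Poly_Mapping.lookup x i"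
proof -
  have "finite {j. r *\<^sub>R Poly_Mapping.lookup x j \<noteq> 0}"
    by (rule finite_subset[OF _ finite_keys[of x]]) (auto simp: in_keys_iff)
  then show ?thesis
    by (simp add: scaleR_poly_mapping_def Abs_poly_mapping_inverse)
qed

lemma indicator_vec_in_hull:
  assumes fin: "finite E" and sub: "\<And>A. A \<in> \<A> \<Longrightarrow> A \<subseteq> E" and B: "B \<subseteq> E"
    and mem: "indicator_vec B \<in> convex hull (indicator_vec ` \<A>)"
  shows "B \<in> \<A>"
proof (rule ccontr)
  assume nB: "B \<notin> \<A>"
  define l :: "vec \<Rightarrow> real" where
    "l x = (\<Sum>i\<in>E. (if i \<in> B then 1 - Poly_Mapping.lookup x i else Poly_Mapping.lookup x i))" for x
  have l_comb: "l (u *\<^sub>R x + v *\<^sub>R y) = u * l x + v * l y" if uv: "u + v = 1" for u v x y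
  proof -
    have *: "1 - (u * a + v * b) = u * (1 - a) + v * (1 - b)" for a b
      using uv by (simp add: algebra_simps)
    show ?thesis
      unfolding l_def sum_distrib_left sum.distrib[symmetric]
      by (rule sum.cong) (auto simp: Poly_Mapping.lookup_add lookup_scaleR_vec *)
  qed
  have conv: "convex {x. l x \<ge> 1}"
  proof (rule convexI)
    fix x y u v
    assume h: "x \<in> {x. l x \<ge> 1}" "y \<in> {x. l x \<ge> 1}" "0 \<le> u" "0 \<le> v" "u + v = (1::real)"
    have "u * 1 + v * 1 \<le> u * l x + v * l y"
      using h by (intro add_mono mult_left_mono) auto
    then show "u *\<^sub>R x + v *\<^sub>R y \<in> {x. l x \<ge> 1}"
      using h l_comb by auto
  qed
  have "indicator_vec A \<in> {x. l x \<ge> 1}" if A: "A \<in> \<A>" for A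
  proof -
    have finA: "finite A" and AE: "A \<subseteq> E" using sub[OF A] fin finite_subset by auto
    have "A \<noteq> B" using A nB by auto
    then obtain e where e: "e \<in> E" "(e \<in> A) \<noteq> (e \<in> B)" using AE B by blast
    have "(if e \<in> B then 1 - Poly_Mapping.lookup (indicator_vec A) e else Poly_Mapping.lookup (indicator_vec A) e)
        \<le> l (indicator_vec A)"
      unfolding l_def
      by (rule member_le_sum) (use e fin in \<open>auto simp: lookup_indicator_vec[OF finA]\<close>)
    then show ?thesis using e by (auto simp: lookup_indicator_vec[OF finA])
  qed
  then have "convex hull (indicator_vec ` \<A>) \<subseteq> {x. l x \<ge> 1}"
    by (intro hull_minimal conv) auto
  moreover have "l (indicator_vec B) = 0"
    unfolding l_def using finite_subset[OF B fin] by (intro sum.neutral) (simp add: lookup_indicator_vec)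
  ultimately show False using mem by auto
qed

lemma inj_on_base_polytope: "inj_on base_polytope {M. is_matroid M}"
proof (rule inj_onI)
  fix M N assume M: "M \<in> {M. is_matroid M}" and N: "N \<in> {M. is_matroid M}"
    and eq: "base_polytope M = base_polytope N"
  have sub: "bases M' \<subseteq> bases N'"
    if "is_matroid M'" "is_matroid N'" "base_polytope M' = base_polytope N'" for M' N'
  proof
    fix B assume B: "B \<in> bases M'"
    have "indicator_vec B \<in> convex hull (indicator_vec ` bases N')"
      using that(3) B hull_inc[of "indicator_vec B" "indicator_vec ` bases M'" convex]
      by (auto simp: base_polytope_def)
    moreover have "B \<subseteq> ground N'"
      using that B by (auto simp: is_matroid_def base_polytope_def)
    ultimately show "B \<in> bases N'"
      using that(2) by (intro indicator_vec_in_hull[of "ground N'"]) (auto simp: is_matroid_def)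
  qed
  have "ground M = ground N" using eq by (simp add: base_polytope_def)
  moreover have "bases M = bases N" using sub M N eq by (simp add: subset_antisym)
  ultimately show "M = N" by (simp add: matroid.expand)
qed

definition on_base_polytopes :: "(matroid \<Rightarrow> 'g) \<Rightarrow> polytope \<Rightarrow> 'g" where
  "on_base_polytopes g p = g (the_inv_into {M. is_matroid M} base_polytope p)"

lemma on_base_polytopes_base_polytope:
  "is_matroid M \<Longrightarrow> on_base_polytopes g (base_polytope M) = g M"
  by (simp add: on_base_polytopes_def the_inv_into_f_f[OF inj_on_base_polytope])

end

theory Submission
  imports Defs
begin

text \<open>
  \<open>Y\<^sub>M\<close> is built by convolutions, and unfolding them writes it as a sum over chains of subsets of the
  ground set, each term depending only on the ranks along its chain. Whitney's formula makes this
  uniform: replacing Moebius functions by alternating sums over spanning sets turns every sum over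
  flats into a sum over a Boolean interval (nonflats contribute zero), and the identity that gives
  existence of the inverse Kazhdan-Lusztig polynomials becomes inclusion-exclusion.

  Hence it suffices that, for a chain \<open>C\<close> and integers \<open>r\<close>, the indicator of
  \<open>rk A \<ge> r A\<close> for all \<open>A \<in> C\<close> is a valuation. By the greedy algorithm this condition says that the
  base polytope meets the open convex set of all \<open>x\<close> with \<open>x(A) > r A - 1/2\<close>. The relative interiors
  of the interior cells partition the relative interior of the polytope, and so do their traces on an
  open convex set, so the claim is an Euler relation: if a linear combination of indicators of
  relatively open convex sets vanishes, then so does that combination of the signs \<open>(-1)\<^bsup>dim\<^esup>\<close>.
  This follows by slicing with hyperplanes and induction on the dimension.
\<close>

section \<open>Relatively open convex sets and the Euler relation\<close>

text \<open>The vectors live in an infinite-dimensional space, so relative openness is phrased by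
  prolonging segments rather than by a topology; the two notions are matched once, where
  \<open>rel_frontier\<close> enters through \<open>interior_cells\<close>. Chains are forced: for
  sets that are not nested, no single vertex need maximize all coordinate sums at once, and the
  polytope may miss the open set although every rank bound holds. The bounds are inequalities
  because only these are open conditions; exact ranks come back as differences of two such
  indicators. Two features of Y obstruct a direct expansion into chains. The inverse polynomial is
  only characterized, by a degree bound and a reversal identity. Both are met by recursively
  negating the low half of an antipalindromic polynomial; such a truncation is additive, with a
  cutoff that depends on one rank only, so it can be pushed through the sums. And Y deletes loops,
  so different cells might be evaluated on different sets; a cell meeting the relative interior has
  exactly the loops of the whole polytope, which gives all of them a common set of nonloops.\<close>

definition rel_core :: "'a::real_vector set \<Rightarrow> 'a set" where
  "rel_core P = {x \<in> P. \<forall>y\<in>P. \<exists>e>0. x + e *\<^sub>R (x - y) \<in> P}"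

text \<open>The span is taken so that a subspace results; \<open>dim\<close> does not see the
  difference (\<open>polytope_dim_eq\<close>).\<close>

definition dirs :: "'a::real_vector set \<Rightarrow> 'a set" where
  "dirs P = span {x - y |x y. x \<in> P \<and> y \<in> P}"

definition lin_open :: "'a::real_vector set \<Rightarrow> bool" where
  "lin_open D \<longleftrightarrow> convex D \<and> rel_core D = D"

lemma rel_core_subset: "rel_core P \<subseteq> P"
  by (auto simp: rel_core_def)

lemma lin_open_convex: "lin_open D \<Longrightarrow> convex D"
  by (simp add: lin_open_def)

lemma lin_open_extend:
  assumes "lin_open D" "x \<in> D" "y \<in> D"
  obtains e where "e > 0" "x + e *\<^sub>R (x - y) \<in> D"
  using assms unfolding lin_open_def rel_core_def by blast

lemma lin_openI:
  assumes "convex D" "\<And>x y. x \<in> D \<Longrightarrow> y \<in> D \<Longrightarrow> \<exists>e>0. x + e *\<^sub>R (x - y) \<in> D"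
  shows "lin_open D"
  using assms unfolding lin_open_def rel_core_def by auto

lemma convex_stepD:
  assumes "convex D" "x \<in> D" "x + e *\<^sub>R v \<in> D" "0 \<le> d" "d \<le> e"
  shows "x + d *\<^sub>R v \<in> D"
proof (cases "e = 0")
  case True
  then show ?thesis using assms by auto
next
  case False
  have "(1 - d/e) *\<^sub>R x + (d/e) *\<^sub>R (x + e *\<^sub>R v) \<in> D"
    using assms False by (intro convexD_alt) auto
  moreover have "(1 - d/e) *\<^sub>R x + (d/e) *\<^sub>R (x + e *\<^sub>R v) = x + d *\<^sub>R v"
    using False by (simp add: algebra_simps)
  ultimately show ?thesis by simp
qed

text \<open>Prolonging from \<open>y\<close> through \<open>x\<close> by the factor \<open>e\<close>
  and writing \<open>x\<close> as a mixture with weight \<open>s\<close> are the same under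
  \<open>s = 1 / (1 + e)\<close>. Mixtures are easier to combine.\<close>

lemma rel_core_iff:
  assumes "x \<in> P"
  shows "x \<in> rel_core P \<longleftrightarrow> (\<forall>y\<in>P. \<exists>w\<in>P. \<exists>s. 0 < s \<and> s < 1 \<and> x = (1 - s) *\<^sub>R y + s *\<^sub>R w)"
proof -
  have "(\<exists>e>0. x + e *\<^sub>R (x - y) \<in> P) \<longleftrightarrow> (\<exists>w\<in>P. \<exists>s. 0 < s \<and> s < 1 \<and> x = (1 - s) *\<^sub>R y + s *\<^sub>R w)"
    for y
  proof
    assume "\<exists>e>0. x + e *\<^sub>R (x - y) \<in> P"
    then obtain e where e: "e > 0" "x + e *\<^sub>R (x - y) \<in> P" by blast
    define s where "s = 1 / (1 + e)"
    have s: "0 < s" "s < 1" "s + s * e = 1" using e by (auto simp: s_def field_simps)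
    have "(1 - s) *\<^sub>R y + s *\<^sub>R (x + e *\<^sub>R (x - y)) = (s + s * e) *\<^sub>R x + (1 - (s + s * e)) *\<^sub>R y"
      by (simp add: algebra_simps)
    then have "x = (1 - s) *\<^sub>R y + s *\<^sub>R (x + e *\<^sub>R (x - y))" using s(3) by simp
    then show "\<exists>w\<in>P. \<exists>s. 0 < s \<and> s < 1 \<and> x = (1 - s) *\<^sub>R y + s *\<^sub>R w" using e s by blast
  next
    assume "\<exists>w\<in>P. \<exists>s. 0 < s \<and> s < 1 \<and> x = (1 - s) *\<^sub>R y + s *\<^sub>R w"
    then obtain w s where s: "w \<in> P" "0 < s" "s < 1" "x = (1 - s) *\<^sub>R y + s *\<^sub>R w" by blast
    define e where "e = (1 - s) / s"
    have e: "e > 0" "e * s = 1 - s" using s by (auto simp: e_def)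
    have "x + e *\<^sub>R (x - y) = (1 - s - e * s) *\<^sub>R y + (s + e * s) *\<^sub>R w"
      unfolding s(4) by (simp add: algebra_simps)
    then have "x + e *\<^sub>R (x - y) = w" using e(2) by simp
    then show "\<exists>e>0. x + e *\<^sub>R (x - y) \<in> P" using e s by auto
  qed
  then show ?thesis using assms unfolding rel_core_def by auto
qed

text \<open>If \<open>x\<close> is a mixture of \<open>y\<close> and \<open>w\<close>, then mixing
  with \<open>z\<close> leaves \<open>y\<close> a weight strictly between 0 and 1. The rest, a
  mixture of \<open>w\<close> and \<open>z\<close>, is the end point beyond the new point.\<close>

lemma rel_core_segment:
  assumes P: "convex P" and x: "x \<in> rel_core P" and z: "z \<in> P" and u: "0 \<le> u" "u < 1"
  shows "(1 - u) *\<^sub>R x + u *\<^sub>R z \<in> rel_core P"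
proof -
  have xP: "x \<in> P" using x rel_core_subset by blast
  have pP: "(1 - u) *\<^sub>R x + u *\<^sub>R z \<in> P" using P xP z u by (intro convexD_alt) auto
  show ?thesis
  proof (subst rel_core_iff[OF pP], intro ballI)
    fix y assume y: "y \<in> P"
    obtain w s where s: "w \<in> P" "0 < s" "s < 1" "x = (1 - s) *\<^sub>R y + s *\<^sub>R w"
      using x y rel_core_iff[OF xP] by blast
    define s' where "s' = (1 - u) * s + u"
    have s': "1 - s' = (1 - u) * (1 - s)" by (simp add: s'_def algebra_simps)
    have "0 < (1 - u) * (1 - s)" "0 < (1 - u) * s" using s u by auto
    then have b: "0 < s'" "s' < 1" using s' u by (auto simp: s'_def)
    define w' where "w' = ((1 - u) * s / s') *\<^sub>R w + (u / s') *\<^sub>R z"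
    have "w' \<in> P" unfolding w'_def
      using P s u b z by (intro convexD) (auto simp: s'_def add_divide_distrib[symmetric])
    moreover have "s' *\<^sub>R w' = ((1 - u) * s) *\<^sub>R w + u *\<^sub>R z"
      using b by (simp add: w'_def scaleR_add_right)
    then have "(1 - u) *\<^sub>R x + u *\<^sub>R z = (1 - s') *\<^sub>R y + s' *\<^sub>R w'"
      unfolding s(4) s' by (simp add: algebra_simps)
    ultimately show "\<exists>w\<in>P. \<exists>r. 0 < r \<and> r < 1 \<and> (1 - u) *\<^sub>R x + u *\<^sub>R z = (1 - r) *\<^sub>R y + r *\<^sub>R w"
      using b by blast
  qed
qed

lemma convex_rel_core: "convex P \<Longrightarrow> convex (rel_core P)"
  unfolding convex_alt
proof (intro ballI allI impI)
  fix x y u assume P: "\<forall>x\<in>P. \<forall>y\<in>P. \<forall>u. 0 \<le> u \<and> u \<le> 1 \<longrightarrow> (1 - u) *\<^sub>R x + u *\<^sub>R y \<in> P"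
    and xy: "x \<in> rel_core P" "y \<in> rel_core P" and u: "0 \<le> u \<and> u \<le> (1::real)"
  show "(1 - u) *\<^sub>R x + u *\<^sub>R y \<in> rel_core P"
  proof (cases "u = 1")
    case False
    then show ?thesis
      using rel_core_segment[of P x y u] P xy u rel_core_subset[of P] by (auto simp: convex_alt)
  qed (use xy in auto)
qed

lemma lin_open_rel_core:
  assumes P: "convex P"
  shows "lin_open (rel_core P)"
proof (rule lin_openI[OF convex_rel_core[OF P]])
  fix x y assume x: "x \<in> rel_core P" and y: "y \<in> rel_core P"
  obtain e where e: "e > 0" "x + e *\<^sub>R (x - y) \<in> P"
    using x y unfolding rel_core_def by blast
  \<comment> \<open>Half of the available step ends at the midpoint of a core point and a point of
    \<open>P\<close>, hence in the core again.\<close>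
  have "(1 - 1/2) *\<^sub>R x + (1/2) *\<^sub>R (x + e *\<^sub>R (x - y)) \<in> rel_core P"
    using e by (intro rel_core_segment[OF P x]) auto
  moreover have "(1 - 1/2) *\<^sub>R x + (1/2) *\<^sub>R (x + e *\<^sub>R (x - y)) = x + (e/2) *\<^sub>R (x - y)"
  proof -
    have "(1 - 1/2) *\<^sub>R x + (1/2) *\<^sub>R x = x" using scaleR_half_double[of x] by (simp add: scaleR_add_right del: scaleR_half_double)
    then show ?thesis by (simp add: scaleR_add_right add.assoc[symmetric])
  qed
  ultimately show "\<exists>e>0. x + e *\<^sub>R (x - y) \<in> rel_core P" using e by (intro exI[of _ "e/2"]) auto
qed

section \<open>Direction spaces\<close>

lemma dirs_diff: "x \<in> P \<Longrightarrow> y \<in> P \<Longrightarrow> x - y \<in> dirs P"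
  unfolding dirs_def by (intro span_base) blast

lemma dirs_subsetI:
  assumes "\<And>y. y \<in> P \<Longrightarrow> y - x \<in> V" "subspace V"
  shows "dirs P \<subseteq> V"
  unfolding dirs_def
proof (rule span_minimal)
  show "{x - y |x y. x \<in> P \<and> y \<in> P} \<subseteq> V"
  proof clarify
    fix a b assume "a \<in> P" "b \<in> P"
    then have "(a - x) - (b - x) \<in> V" by (intro subspace_diff[OF assms(2)] assms(1))
    then show "a - b \<in> V" by simp
  qed
qed fact

lemma subspace_dirs [simp]: "subspace (dirs P)"
  by (simp add: dirs_def)

lemma dirs_mono: "P \<subseteq> R \<Longrightarrow> dirs P \<subseteq> dirs R"
  unfolding dirs_def by (intro span_mono) auto

lemma dirs_subset_span: "P \<subseteq> span W \<Longrightarrow> dirs P \<subseteq> span W"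
  unfolding dirs_def by (intro span_minimal) (auto intro: span_diff)

lemma dirs_rel_core:
  assumes P: "convex P" and ne: "rel_core P \<noteq> {}"
  shows "dirs (rel_core P) = dirs P"
proof
  obtain x where x: "x \<in> rel_core P" using ne by blast
  show "dirs P \<subseteq> dirs (rel_core P)"
  proof (rule dirs_subsetI[of _ x])
    fix y assume y: "y \<in> P"
    have "(1 - 1/2) *\<^sub>R x + (1/2) *\<^sub>R y \<in> rel_core P" by (rule rel_core_segment[OF P x y]) auto
    then have "(1 - 1/2) *\<^sub>R x + (1/2) *\<^sub>R y - x \<in> dirs (rel_core P)" using x dirs_diff by blast
    moreover have "(1 - 1/2) *\<^sub>R x + (1/2) *\<^sub>R y - x = (1/2) *\<^sub>R (y - x)"
      using scaleR_half_double[of x] by (simp add: algebra_simps del: scaleR_half_double)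
    ultimately have "2 *\<^sub>R ((1/2) *\<^sub>R (y - x)) \<in> dirs (rel_core P)" using subspace_scale subspace_dirs by metis
    then show "y - x \<in> dirs (rel_core P)" by simp
  qed simp
qed (rule dirs_mono[OF rel_core_subset])

text \<open>The directions that can be followed from \<open>x\<close> for a positive time form a
  subspace: prolonging segments gives negatives, convexity gives sums. It contains
  \<open>y - x\<close> for all \<open>y\<close> in \<open>D\<close>, hence all of
  \<open>dirs D\<close>.\<close>

lemma lin_open_direction:
  assumes D: "lin_open D" and x: "x \<in> D" and v: "v \<in> dirs D"
  shows "\<exists>e>0. x + e *\<^sub>R v \<in> D"
proof -
  define V where "V = {v. \<exists>e>0. x + e *\<^sub>R v \<in> D}"
  have V0: "0 \<in> V" unfolding V_def using x by (auto intro: exI[of _ 1])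
  have Vneg: "- v \<in> V" if v: "v \<in> V" for v
  proof -
    obtain e where e: "e > 0" "x + e *\<^sub>R v \<in> D" using v V_def by auto
    obtain d where d: "d > 0" "x + d *\<^sub>R (x - (x + e *\<^sub>R v)) \<in> D" using lin_open_extend[OF D x e(2)] by blast
    have "x + (d * e) *\<^sub>R (- v) \<in> D" using d(2) by simp
    then show ?thesis unfolding V_def using d(1) e(1) by (intro CollectI exI[of _ "d * e"]) auto
  qed
  have Vpos: "c *\<^sub>R v \<in> V" if v: "v \<in> V" and c: "c > 0" for c v
  proof -
    obtain e where e: "e > 0" "x + e *\<^sub>R v \<in> D" using v V_def by auto
    have "x + (e / c) *\<^sub>R (c *\<^sub>R v) \<in> D" using e c by simp
    then show ?thesis unfolding V_def using e c by (intro CollectI exI[of _ "e / c"]) auto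
  qed
  have Vsc: "c *\<^sub>R v \<in> V" if v: "v \<in> V" for c v
  proof -
    consider "c = 0" | "c > 0" | "c < 0" by linarith
    then show ?thesis
    proof cases
      case 3
      then show ?thesis using Vpos[OF Vneg[OF v], of "- c"] by simp
    qed (use V0 Vpos[OF v] in auto)
  qed
  have Vadd: "v + w \<in> V" if v: "v \<in> V" and w: "w \<in> V" for v w
  proof -
    obtain e where e: "e > 0" "x + e *\<^sub>R v \<in> D" using v V_def by auto
    obtain d where d: "d > 0" "x + d *\<^sub>R w \<in> D" using w V_def by auto
    define m where "m = min e d"
    have m: "m > 0" "x + m *\<^sub>R v \<in> D" "x + m *\<^sub>R w \<in> D"
      using e d convex_stepD[OF lin_open_convex[OF D] x] by (auto simp: m_def)
    have "(1 - 1/2) *\<^sub>R (x + m *\<^sub>R v) + (1/2) *\<^sub>R (x + m *\<^sub>R w) \<in> D"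
      using m lin_open_convex[OF D] by (intro convexD_alt) auto
    moreover have "(1 - 1/2) *\<^sub>R (x + m *\<^sub>R v) + (1/2) *\<^sub>R (x + m *\<^sub>R w) = x + (m/2) *\<^sub>R (v + w)"
    proof -
      have "(1 - 1/2) *\<^sub>R x + (1/2) *\<^sub>R x = x" using scaleR_half_double[of x] by (simp add: scaleR_add_right del: scaleR_half_double)
      then show ?thesis by (simp add: scaleR_add_right algebra_simps)
    qed
    ultimately have "x + (m/2) *\<^sub>R (v + w) \<in> D" by simp
    then show ?thesis unfolding V_def using m(1) by (intro CollectI exI[of _ "m/2"]) auto
  qed
  have "subspace V" unfolding subspace_def using V0 Vadd Vsc by blast
  then have "dirs D \<subseteq> V"
  proof (rule dirs_subsetI[of _ x, rotated])
    fix y assume "y \<in> D"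
    then show "y - x \<in> V" unfolding V_def by (auto intro!: exI[of _ 1])
  qed
  then show ?thesis using v V_def by blast
qed

section \<open>Hyperplane slices and images on the line\<close>

lemma dim_hyperplane_slice:
  fixes l :: "'a::real_vector \<Rightarrow> real"
  assumes V: "subspace V" and W: "finite W" "V \<subseteq> span W" and l: "linear l" and v: "v \<in> V" "l v \<noteq> 0"
  shows "dim V = Suc (dim (V \<inter> {x. l x = 0}))"
proof -
  let ?H = "V \<inter> {x. l x = 0}"
  interpret l: linear l by fact
  have sH: "subspace ?H" using V by (auto simp: subspace_def l.add l.scaleR)
  obtain B where B: "B \<subseteq> ?H" "independent B" "?H \<subseteq> span B" "card B = dim ?H" by (rule basis_exists)
  have spB: "span B = ?H" using B sH by (meson span_minimal subset_antisym)
  have vB: "v \<notin> span B" using v spB by auto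
  have ind: "independent (insert v B)" using B vB by (simp add: independent_insert)
  have "V \<subseteq> span (insert v B)"
  proof
    fix x assume x: "x \<in> V"
    have "x - (l x / l v) *\<^sub>R v \<in> ?H"
      using x v V by (auto simp: l.diff l.scaleR intro!: subspace_diff subspace_scale)
    then have "x - (l x / l v) *\<^sub>R v \<in> span (insert v B)" using spB span_mono[of B "insert v B"] by blast
    moreover have "(l x / l v) *\<^sub>R v \<in> span (insert v B)" by (intro span_scale span_base) simp
    ultimately have "x - (l x / l v) *\<^sub>R v + (l x / l v) *\<^sub>R v \<in> span (insert v B)" by (rule span_add)
    then show "x \<in> span (insert v B)" by simp
  qed
  moreover have "insert v B \<subseteq> V" using B v by auto
  ultimately have "span (insert v B) = span V" using V by (metis span_minimal span_eq_iff subset_antisym)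
  then have "dim V = card (insert v B)" by (rule dim_eq_card[OF _ ind])
  \<comment> \<open>\<open>card\<close> is zero on infinite sets, so counting one extra basis vector
    rests on the finite spanning set \<open>W\<close>.\<close>
  moreover have "finite B" using independent_span_bound[OF W(1) B(2)] B(1) W(2) by blast
  moreover have "v \<notin> B" using B(1) v by auto
  ultimately show ?thesis using B(4) by simp
qed

text \<open>By relative openness, a direction tangent to the hyperplane can be followed a little
  from \<open>x\<close> inside \<open>D\<close> without leaving the slice.\<close>

lemma dirs_slice:
  fixes l :: "'a::real_vector \<Rightarrow> real"
  assumes D: "lin_open D" and l: "linear l" and x: "x \<in> D" "l x = t"
  shows "dirs (D \<inter> {y. l y = t}) = dirs D \<inter> {y. l y = 0}"
proof
  interpret l: linear l by fact
  show "dirs (D \<inter> {y. l y = t}) \<subseteq> dirs D \<inter> {y. l y = 0}"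
  proof (rule dirs_subsetI[of _ x])
    show "subspace (dirs D \<inter> {y. l y = 0})"
      using subspace_dirs[of D] by (auto simp: subspace_def l.add l.scaleR)
  qed (use x in \<open>auto simp: l.diff intro: dirs_diff\<close>)
  show "dirs D \<inter> {y. l y = 0} \<subseteq> dirs (D \<inter> {y. l y = t})"
  proof
    fix v assume v: "v \<in> dirs D \<inter> {y. l y = 0}"
    then obtain e where e: "e > 0" "x + e *\<^sub>R v \<in> D" using lin_open_direction[OF D x(1)] by blast
    then have "(x + e *\<^sub>R v) - x \<in> dirs (D \<inter> {y. l y = t})"
      using v x by (intro dirs_diff) (auto simp: l.add l.scaleR)
    then have "(1/e) *\<^sub>R ((x + e *\<^sub>R v) - x) \<in> dirs (D \<inter> {y. l y = t})" by (intro subspace_scale) auto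
    then show "v \<in> dirs (D \<inter> {y. l y = t})" using e by simp
  qed
qed

lemma lin_open_slice:
  fixes l :: "'a::real_vector \<Rightarrow> real"
  assumes D: "lin_open D" and l: "linear l"
  shows "lin_open (D \<inter> {y. l y = t})"
proof (rule lin_openI)
  interpret l: linear l by fact
  have "{y. l y = t} = l -` {t}" by auto
  then show "convex (D \<inter> {y. l y = t})"
    using lin_open_convex[OF D] convex_linear_vimage[OF l, of "{t}"] by (auto intro: convex_Int)
  fix x y assume *: "x \<in> D \<inter> {y. l y = t}" "y \<in> D \<inter> {y. l y = t}"
  obtain e where "e > 0" "x + e *\<^sub>R (x - y) \<in> D" using lin_open_extend[OF D] * by blast
  then show "\<exists>e>0. x + e *\<^sub>R (x - y) \<in> D \<inter> {y. l y = t}"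
    using * by (intro exI[of _ e]) (auto simp: l.add l.scaleR l.diff)
qed

lemma lin_open_image:
  assumes D: "lin_open D" and l: "linear l"
  shows "lin_open (l ` D)"
proof (rule lin_openI)
  interpret l: linear l by fact
  show "convex (l ` D)" using convex_linear_image[OF l lin_open_convex[OF D]] .
  fix a b assume "a \<in> l ` D" "b \<in> l ` D"
  then obtain x y where *: "x \<in> D" "a = l x" "y \<in> D" "b = l y" by blast
  obtain e where e: "e > 0" "x + e *\<^sub>R (x - y) \<in> D" using lin_open_extend[OF D *(1,3)] .
  then have "a + e *\<^sub>R (a - b) = l (x + e *\<^sub>R (x - y))" using * by (simp add: l.add l.scaleR l.diff)
  then show "\<exists>e>0. a + e *\<^sub>R (a - b) \<in> l ` D" using e by auto
qed

text \<open>In a set with a second point, every point lies strictly between two others, so neither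
  infimum nor supremum is attained; convexity fills what is between.\<close>

lemma lin_open_real_cases:
  fixes J :: "real set"
  assumes J: "lin_open J" and ne: "J \<noteq> {}" and bd: "bounded J"
  shows "(\<exists>p. J = {p}) \<or> (\<exists>a b. a < b \<and> J = {a<..<b})"
proof (cases "\<exists>p. J = {p}")
  case False
  have bda: "bdd_above J" and bdb: "bdd_below J" using bd bounded_imp_bdd_above bounded_imp_bdd_below by auto
  have in_int: "Inf J < t \<and> t < Sup J" if t: "t \<in> J" for t
  proof -
    obtain y where y: "y \<in> J" "y \<noteq> t" using False t by blast
    obtain e where e: "e > 0" "t + e *\<^sub>R (t - y) \<in> J" using lin_open_extend[OF J t y(1)] .
    have "(t - y) * (e * (t - y)) > 0" using e(1) y(2)
      by (metis mult.left_commute mult_pos_pos not_square_less_zero linorder_neqE_linordered_idom mult_eq_0_iff right_minus_eq)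
    then have "(y < t \<and> t < t + e * (t - y)) \<or> (t < y \<and> t + e * (t - y) < t)"
      by (auto simp: zero_less_mult_iff)
    then show ?thesis using cInf_lower[OF y(1) bdb] cInf_lower[OF e(2) bdb]
        cSup_upper[OF y(1) bda] cSup_upper[OF e(2) bda] by auto
  qed
  have "t \<in> J" if t: "Inf J < t" "t < Sup J" for t
  proof -
    obtain u where u: "u \<in> J" "u < t" using t(1) cInf_less_iff[OF ne bdb] by blast
    obtain v where v: "v \<in> J" "t < v" using t(2) less_cSup_iff[OF ne bda] by blast
    have "is_interval J" using lin_open_convex[OF J] by (simp add: is_interval_convex_1)
    then show ?thesis using u v unfolding is_interval_1 by (meson less_imp_le)
  qed
  then have "J = {Inf J<..<Sup J}" using in_int by auto
  moreover have "Inf J < Sup J" using ne in_int by force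
  ultimately show ?thesis by blast
qed simp

text \<open>The functional \<open>f \<mapsto> \<Sum>t\<in>T. f t - f (t + d)\<close>, for a finite set \<open>T\<close> with gaps larger
  than \<open>d\<close>, takes the value \<open>1\<close> on points of \<open>T\<close> and \<open>-1\<close> on open intervals with ends in \<open>T\<close>.\<close>

lemma euler_relation_line:
  fixes c :: "'i \<Rightarrow> real"
  assumes I: "finite I" and K: "\<And>i. i \<in> I \<Longrightarrow> i \<notin> K \<Longrightarrow> a i < (b i :: real)"
    and rel: "\<And>t. (\<Sum>i\<in>I. c i * (if i \<in> K then of_bool (t = p i) else - of_bool (a i < t \<and> t < b i))) = 0"
  shows "(\<Sum>i\<in>I. c i) = 0"
proof -
  define T where "T = p ` I \<union> a ` I \<union> b ` I"
  have T: "finite T" using I by (simp add: T_def)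
  \<comment> \<open>The element 1 keeps \<open>Min G\<close> meaningful when \<open>T\<close> has no
    two distinct points.\<close>
  define G where "G = insert 1 {y - x |x y. x \<in> T \<and> y \<in> T \<and> x < y}"
  have "{y - x |x y. x \<in> T \<and> y \<in> T \<and> x < y} \<subseteq> (\<lambda>(x, y). y - x) ` (T \<times> T)" by auto
  then have G: "finite G" using finite_subset[OF _ finite_imageI[OF finite_cartesian_product[OF T T]]] unfolding G_def by simp
  have Gpos: "\<And>g. g \<in> G \<Longrightarrow> g > 0" by (auto simp: G_def)
  define d where "d = Min G / 2"
  have Gm: "Min G > 0" using G Gpos by (subst Min_gr_iff) (auto simp: G_def)
  then have d: "d > 0" by (simp add: d_def)
  have gap: "x + d < y" if "x \<in> T" "y \<in> T" "x < y" for x y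
  proof -
    have "Min G \<le> y - x" using that G by (intro Min_le) (auto simp: G_def)
    then show ?thesis using Gm by (simp add: d_def)
  qed
  define f :: "'i \<Rightarrow> real \<Rightarrow> real" where
    "f i t = (if i \<in> K then of_bool (t = p i) else - of_bool (a i < t \<and> t < b i))" for i t
  have one: "(\<Sum>t\<in>T. f i t - f i (t + d)) = (1::real)" if i: "i \<in> I" for i
  proof (cases "i \<in> K")
    case True
    have pT: "p i \<in> T" using i by (simp add: T_def)
    have "f i t - f i (t + d) = (if t = p i then 1 else 0)" if "t \<in> T" for t
      using True gap[OF that pT] d by (cases t "p i" rule: linorder_cases) (auto simp: f_def)
    then show ?thesis using T pT by (simp add: sum.delta)
  next
    case False
    have ab: "a i \<in> T" "b i \<in> T" "a i < b i" using i K[OF i False] by (auto simp: T_def)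
    \<comment> \<open>The shift by \<open>d\<close> enters the interval only from the left end and
      never leaves it, since \<open>d\<close> is below every gap of \<open>T\<close>.\<close>
    have "f i t - f i (t + d) = (if t = a i then 1 else 0)" if t: "t \<in> T" for t
    proof -
      have "a i < t + d \<longleftrightarrow> a i \<le> t" using gap[OF t ab(1)] d by linarith
      moreover have "t + d < b i \<longleftrightarrow> t < b i" using gap[OF t ab(2)] d by linarith
      ultimately show ?thesis using False ab by (auto simp: f_def)
    qed
    then show ?thesis using T ab by (simp add: sum.delta)
  qed
  have "(\<Sum>i\<in>I. c i) = (\<Sum>i\<in>I. c i * (\<Sum>t\<in>T. f i t - f i (t + d)))"
    using one by simp
  also have "\<dots> = (\<Sum>t\<in>T. (\<Sum>i\<in>I. c i * f i t) - (\<Sum>i\<in>I. c i * f i (t + d)))"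
    by (simp add: sum_distrib_left right_diff_distrib sum_subtractf sum.swap[of _ T I])
  also have "\<dots> = 0" using rel by (simp add: f_def)
  finally show ?thesis .
qed

text \<open>Induction on the set of functionals. Cutting by \<open>l j = t\<close> preserves the
  relation; a set on which \<open>l j\<close> is constant keeps its dimension, any other loses one.
  The resulting change of sign is the one in \<open>euler_relation_line\<close>, which is applied
  with the signed coefficients once the sums vanish for all \<open>t\<close>. When no functional is
  left, \<open>sep\<close> makes all sets the same single point.\<close>

theorem euler_relation:
  fixes l :: "'j \<Rightarrow> 'a::real_vector \<Rightarrow> real" and c :: "'i \<Rightarrow> real"
  assumes J: "finite J" and W: "finite W" and lin: "\<And>j. j \<in> J \<Longrightarrow> linear (l j)"
    and I: "finite I"
    and D: "\<And>i. i \<in> I \<Longrightarrow> lin_open (D i)" "\<And>i. i \<in> I \<Longrightarrow> D i \<noteq> {}" "\<And>i. i \<in> I \<Longrightarrow> D i \<subseteq> span W"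
    and bd: "\<And>i j. i \<in> I \<Longrightarrow> j \<in> J \<Longrightarrow> bounded (l j ` D i)"
    and sep: "\<And>i k x y. i \<in> I \<Longrightarrow> k \<in> I \<Longrightarrow> x \<in> D i \<Longrightarrow> y \<in> D k \<Longrightarrow> (\<And>j. j \<in> J \<Longrightarrow> l j x = l j y) \<Longrightarrow> x = y"
    and rel: "\<And>x. (\<Sum>i\<in>I. c i * of_bool (x \<in> D i)) = 0"
  shows "(\<Sum>i\<in>I. c i * (-1) ^ dim (dirs (D i))) = 0"
  using J lin I D bd sep rel
proof (induction J arbitrary: I D rule: finite_induct)
  case empty
  show ?case
  proof (cases "I = {}")
    case False
    then obtain k z where k: "k \<in> I" "z \<in> D k" using empty.prems(4) by blast
    have Dz: "D i = {z}" if i: "i \<in> I" for i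
      using empty.prems(7)[OF i k(1) _ k(2)] empty.prems(4)[OF i] by blast
    have "dirs {z} = span {0}" by (simp add: dirs_def)
    then have "dirs {z} = span {}" by simp
    then have "dim (dirs {z}) = 0" by (simp only: dim_span_eq_card_independent[OF independent_empty] card.empty)
    then have "dim (dirs (D i)) = 0" if "i \<in> I" for i using Dz[OF that] by simp
    then have "(\<Sum>i\<in>I. c i * (-1) ^ dim (dirs (D i))) = (\<Sum>i\<in>I. c i * of_bool (z \<in> D i))"
      using Dz by (intro sum.cong) auto
    then show ?thesis using empty.prems(8) by simp
  qed simp
next
  case (insert j J)
  note D = insert.prems(3-5)
  have lj: "linear (l j)" using insert.prems(1) by simp
  define e where "e i = c i * (-1) ^ dim (dirs (D i))" for i
  define K where "K = {i. \<exists>p. l j ` D i = {p}}"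
  have "\<forall>i\<in>I. \<exists>p a b. (i \<in> K \<longrightarrow> l j ` D i = {p}) \<and> (i \<notin> K \<longrightarrow> a < b \<and> l j ` D i = {a<..<b})"
  proof
    fix i assume i: "i \<in> I"
    have "(\<exists>p. l j ` D i = {p}) \<or> (\<exists>a b. a < b \<and> l j ` D i = {a<..<b})"
      using lin_open_image[OF D(1)[OF i] lj] D(2)[OF i] insert.prems(6)[OF i, of j]
      by (intro lin_open_real_cases) auto
    then show "\<exists>p a b. (i \<in> K \<longrightarrow> l j ` D i = {p}) \<and> (i \<notin> K \<longrightarrow> a < b \<and> l j ` D i = {a<..<b})"
    proof (cases "i \<in> K")
      case True
      then show ?thesis by (simp add: K_def)
    next
      case False
      then show ?thesis using \<open>_ \<or> _\<close> by (simp add: K_def)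
    qed
  qed
  then obtain p a b where pab: "\<And>i. i \<in> I \<Longrightarrow> i \<in> K \<Longrightarrow> l j ` D i = {p i}"
    "\<And>i. i \<in> I \<Longrightarrow> i \<notin> K \<Longrightarrow> a i < b i \<and> l j ` D i = {a i<..<b i}" by metis
  have "(\<Sum>i\<in>I. e i) = 0"
  proof (rule euler_relation_line[OF insert.prems(2)])
    show "a i < b i" if "i \<in> I" "i \<notin> K" for i using pab that by blast
    fix t
    define H where "H = {y. l j y = t}"
    \<comment> \<open>Sets missed by the hyperplane are dropped, as the induction hypothesis asks
      for nonempty ones.\<close>
    define It where "It = {i \<in> I. D i \<inter> H \<noteq> {}}"
    have "(\<Sum>i\<in>It. c i * (-1) ^ dim (dirs (D i \<inter> H))) = 0"
    proof (rule insert.IH)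
      show "finite It" using insert.prems(2) by (simp add: It_def)
      show "linear (l k)" if "k \<in> J" for k using insert.prems(1) that by simp
      fix i assume i: "i \<in> It"
      then have iI: "i \<in> I" by (simp add: It_def)
      show "lin_open (D i \<inter> H)" unfolding H_def by (rule lin_open_slice[OF D(1)[OF iI] lj])
      show "D i \<inter> H \<noteq> {}" using i by (simp add: It_def)
      show "D i \<inter> H \<subseteq> span W" using D(3)[OF iI] by blast
      show "bounded (l k ` (D i \<inter> H))" if "k \<in> J" for k
        using insert.prems(6)[OF iI, of k] that by (auto intro: bounded_subset)
      show "x = y" if "k \<in> It" "x \<in> D i \<inter> H" "y \<in> D k \<inter> H" "\<And>j. j \<in> J \<Longrightarrow> l j x = l j y" for k x y
        by (rule insert.prems(7)[OF iI, of k]) (use that in \<open>auto simp: It_def H_def\<close>)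
    next
      fix x
      show "(\<Sum>i\<in>It. c i * of_bool (x \<in> D i \<inter> H)) = 0"
      proof (cases "x \<in> H")
        case True
        have "(\<Sum>i\<in>It. c i * of_bool (x \<in> D i \<inter> H)) = (\<Sum>i\<in>I. c i * of_bool (x \<in> D i))"
          using True insert.prems(2) by (intro sum.mono_neutral_cong_left) (auto simp: It_def)
        then show ?thesis using insert.prems(8) by simp
      qed simp
    qed
    moreover have "(\<Sum>i\<in>It. c i * (-1) ^ dim (dirs (D i \<inter> H)))
      = (\<Sum>i\<in>I. e i * (if i \<in> K then of_bool (t = p i) else - of_bool (a i < t \<and> t < b i)))"
    proof (rule sum.mono_neutral_cong_left[OF insert.prems(2)])
      show "It \<subseteq> I" by (auto simp: It_def)
      have hit: "D i \<inter> H \<noteq> {} \<longleftrightarrow> t \<in> l j ` D i" for i by (auto simp: H_def)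
      show "\<forall>i\<in>I - It. e i * (if i \<in> K then of_bool (t = p i) else - of_bool (a i < t \<and> t < b i)) = 0"
      proof
        fix i assume "i \<in> I - It"
        then have i: "i \<in> I" "t \<notin> l j ` D i" using hit by (auto simp: It_def)
        then show "e i * (if i \<in> K then of_bool (t = p i) else - of_bool (a i < t \<and> t < b i)) = 0"
          using pab[OF i(1)] by auto
      qed
      fix i assume "i \<in> It"
      then have i: "i \<in> I" "t \<in> l j ` D i" using hit by (auto simp: It_def)
      then obtain x where x: "x \<in> D i" "l j x = t" by blast
      have sl: "dirs (D i \<inter> H) = dirs (D i) \<inter> {y. l j y = 0}"
        unfolding H_def by (rule dirs_slice[OF D(1)[OF i(1)] lj x])
      show "c i * (-1) ^ dim (dirs (D i \<inter> H)) = e i * (if i \<in> K then of_bool (t = p i) else - of_bool (a i < t \<and> t < b i))"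
      proof (cases "i \<in> K")
        case True
        then have "l j ` D i = {t}" using i(2) pab(1)[OF i(1)] by auto
        then have "D i \<inter> H = D i" "t = p i" using pab(1)[OF i(1) True] by (auto simp: H_def)
        then show ?thesis using True by (simp add: e_def)
      next
        case False
        then have ti: "a i < t" "t < b i" using i pab(2)[OF i(1) False] by auto
        \<comment> \<open>A point of \<open>D i\<close> off the hyperplane is wanted, so that
          \<open>l j\<close> is nonzero on a direction of \<open>D i\<close>; any value of the
          interval other than \<open>t\<close> would do.\<close>
        have "(t + b i) / 2 \<in> {a i<..<b i}" using ti by auto
        then obtain y where y: "y \<in> D i" "l j y \<noteq> t"
          using pab(2)[OF i(1) False] ti by (metis field_sum_of_halves add_left_cancel imageE less_irrefl add_divide_distrib)
        interpret lj: linear "l j" by fact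
        have "dim (dirs (D i)) = Suc (dim (dirs (D i) \<inter> {y. l j y = 0}))"
        proof (rule dim_hyperplane_slice[OF _ W _ lj])
          show "dirs (D i) \<subseteq> span W" using D(3)[OF i(1)] by (rule dirs_subset_span)
          show "y - x \<in> dirs (D i)" using x y by (intro dirs_diff)
          show "l j (y - x) \<noteq> 0" using x y by (simp add: lj.diff)
        qed simp
        then show ?thesis using False ti by (simp add: e_def sl)
      qed
    qed
    ultimately show "(\<Sum>i\<in>I. e i * (if i \<in> K then of_bool (t = p i) else - of_bool (a i < t \<and> t < b i))) = 0"
      by simp
  qed
  then show ?case by (simp add: e_def)
qed

text \<open>Openness along every ray, with a step that may depend on the direction. It suffices
  because \<open>U\<close> is only ever tested along segments.\<close>

definition alg_open :: "'a::real_vector set \<Rightarrow> bool" where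
  "alg_open U \<longleftrightarrow> (\<forall>x\<in>U. \<forall>v. \<exists>e>0. \<forall>d. 0 \<le> d \<and> d \<le> e \<longrightarrow> x + d *\<^sub>R v \<in> U)"

lemma alg_openD:
  assumes "alg_open U" "x \<in> U"
  obtains e where "e > 0" "\<And>d. 0 \<le> d \<Longrightarrow> d \<le> e \<Longrightarrow> x + d *\<^sub>R v \<in> U"
  using assms unfolding alg_open_def by metis

lemma alg_open_UNIV: "alg_open UNIV"
  by (auto simp: alg_open_def intro: exI[of _ 1])

lemma alg_open_Int:
  assumes "alg_open U" "alg_open V"
  shows "alg_open (U \<inter> V)"
  unfolding alg_open_def
proof (intro ballI allI)
  fix x v assume x: "x \<in> U \<inter> V"
  obtain e where e: "e > 0" "\<And>d. 0 \<le> d \<Longrightarrow> d \<le> e \<Longrightarrow> x + d *\<^sub>R v \<in> U"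
    using alg_openD[OF assms(1)] x by blast
  obtain f where f: "f > 0" "\<And>d. 0 \<le> d \<Longrightarrow> d \<le> f \<Longrightarrow> x + d *\<^sub>R v \<in> V"
    using alg_openD[OF assms(2)] x by blast
  show "\<exists>e>0. \<forall>d. 0 \<le> d \<and> d \<le> e \<longrightarrow> x + d *\<^sub>R v \<in> U \<inter> V"
    using e f by (intro exI[of _ "min e f"]) auto
qed

lemma alg_open_halfspace:
  assumes "linear l"
  shows "alg_open {x. (r::real) < l x}"
  unfolding alg_open_def
proof (intro ballI allI)
  interpret l: linear l by fact
  fix x v assume x: "x \<in> {x. r < l x}"
  \<comment> \<open>The summand 1 avoids division by zero and makes the final estimate
    strict.\<close>
  define e where "e = (l x - r) / (1 + \<bar>l v\<bar>)"
  have e: "e > 0" using x by (simp add: e_def)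
  have "r < l (x + d *\<^sub>R v)" if d: "0 \<le> d" "d \<le> e" for d
  proof -
    have "d * \<bar>l v\<bar> \<le> e * \<bar>l v\<bar>" using d by (intro mult_right_mono) auto
    also have "\<dots> < e * (1 + \<bar>l v\<bar>)" using e by (simp add: distrib_left)
    also have "\<dots> = l x - r" by (simp add: e_def add_nonneg_eq_0_iff)
    finally have "d * \<bar>l v\<bar> < l x - r" .
    moreover have "- (d * \<bar>l v\<bar>) \<le> d * l v" using d(1) by (metis abs_ge_minus_self abs_mult abs_of_nonneg minus_le_iff)
    ultimately show ?thesis by (simp add: l.add l.scaleR)
  qed
  then show "\<exists>e>0. \<forall>d. 0 \<le> d \<and> d \<le> e \<longrightarrow> x + d *\<^sub>R v \<in> {x. r < l x}" using e by auto
qed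

lemma alg_open_INT:
  "finite C \<Longrightarrow> (\<And>A. A \<in> C \<Longrightarrow> alg_open (U A)) \<Longrightarrow> alg_open (\<Inter>A\<in>C. U A)"
  by (induction C rule: finite_induct) (auto intro: alg_open_UNIV alg_open_Int)

lemma lin_open_Int_alg_open:
  assumes D: "lin_open D" and U: "alg_open U" "convex U"
  shows "lin_open (D \<inter> U)"
proof (rule lin_openI)
  show "convex (D \<inter> U)" using lin_open_convex[OF D] U(2) by (rule convex_Int)
  fix x y assume *: "x \<in> D \<inter> U" "y \<in> D \<inter> U"
  obtain e where e: "e > 0" "x + e *\<^sub>R (x - y) \<in> D" using lin_open_extend[OF D] * by blast
  obtain f where f: "f > 0" "\<And>d. 0 \<le> d \<Longrightarrow> d \<le> f \<Longrightarrow> x + d *\<^sub>R (x - y) \<in> U"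
    using alg_openD[OF U(1)] * by blast
  have "x + min e f *\<^sub>R (x - y) \<in> D"
    using e f * by (intro convex_stepD[OF lin_open_convex[OF D] _ e(2)]) auto
  then show "\<exists>e>0. x + e *\<^sub>R (x - y) \<in> D \<inter> U" using e f by (intro exI[of _ "min e f"]) auto
qed

text \<open>From a common point, every direction towards a point of \<open>D\<close> can be followed
  briefly inside \<open>U\<close>. Hence cutting a cell by \<open>U\<close> does not touch its
  sign.\<close>

lemma dirs_Int_alg_open:
  assumes D: "convex D" and U: "alg_open U" and ne: "D \<inter> U \<noteq> {}"
  shows "dirs (D \<inter> U) = dirs D"
proof
  obtain x where x: "x \<in> D" "x \<in> U" using ne by blast
  show "dirs D \<subseteq> dirs (D \<inter> U)"
  proof (rule dirs_subsetI[of _ x])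
    fix y assume y: "y \<in> D"
    obtain f where f: "f > 0" "\<And>d. 0 \<le> d \<Longrightarrow> d \<le> f \<Longrightarrow> x + d *\<^sub>R (y - x) \<in> U"
      using alg_openD[OF U x(2)] by blast
    define d where "d = min 1 f"
    have d: "d > 0" "d \<le> 1" "d \<le> f" using f by (auto simp: d_def)
    have "x + d *\<^sub>R (y - x) \<in> D" using d y by - (rule convex_stepD[OF D x(1), where e = 1], auto)
    then have "(x + d *\<^sub>R (y - x)) - x \<in> dirs (D \<inter> U)" using f d x by (intro dirs_diff) auto
    then have "(1/d) *\<^sub>R ((x + d *\<^sub>R (y - x)) - x) \<in> dirs (D \<inter> U)" by (intro subspace_scale) auto
    then show "y - x \<in> dirs (D \<inter> U)" using d by simp
  qed simp
qed (intro dirs_mono, blast)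

text \<open>A point of \<open>R\<close> in \<open>U\<close> is moved a little towards a core point:
  openness keeps it in \<open>U\<close>, and any positive step enters the core.\<close>

lemma rel_core_meets_iff:
  assumes R: "convex R" "rel_core R \<noteq> {}" and U: "alg_open U"
  shows "rel_core R \<inter> U \<noteq> {} \<longleftrightarrow> R \<inter> U \<noteq> {}"
proof
  assume "R \<inter> U \<noteq> {}"
  then obtain x where x: "x \<in> R" "x \<in> U" by blast
  obtain c where c: "c \<in> rel_core R" using R by blast
  obtain f where f: "f > 0" "\<And>d. 0 \<le> d \<Longrightarrow> d \<le> f \<Longrightarrow> x + d *\<^sub>R (c - x) \<in> U"
    using alg_openD[OF U x(2)] by blast
  define d where "d = min 1 f"
  have d: "d > 0" "d \<le> 1" "d \<le> f" using f by (auto simp: d_def)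
  have "(1 - (1 - d)) *\<^sub>R c + (1 - d) *\<^sub>R x \<in> rel_core R"
    using d by (intro rel_core_segment[OF R(1) c x(1)]) auto
  moreover have "(1 - (1 - d)) *\<^sub>R c + (1 - d) *\<^sub>R x = x + d *\<^sub>R (c - x)" by (simp add: algebra_simps)
  ultimately show "rel_core R \<inter> U \<noteq> {}" using f d by (metis IntI emptyE less_imp_le)
qed (use rel_core_subset[of R] in blast)

section \<open>Faces and core points\<close>

lemma rel_core_face_full:
  assumes F: "F face_of R" and x: "x \<in> F" "x \<in> rel_core R"
  shows "F = R"
proof
  show "F \<subseteq> R" using F by (rule face_of_imp_subset)
  show "R \<subseteq> F"
  proof
    fix y assume y: "y \<in> R"
    have xR: "x \<in> R" using x(2) rel_core_subset by blast
    obtain w s where s: "w \<in> R" "0 < s" "s < 1" "x = (1 - s) *\<^sub>R y + s *\<^sub>R w"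
      using x(2) y rel_core_iff[OF xR] by blast
    show "y \<in> F"
    proof (cases "y = w")
      case True
      then have "x = y" using s(4) by (simp add: algebra_simps)
      then show ?thesis using x by simp
    next
      case False
      then have "x \<in> open_segment y w" using s by (auto simp: in_segment)
      then show ?thesis using F x(1) y s(1) unfolding face_of_def by blast
    qed
  qed
qed

text \<open>What remains of \<open>x\<close> after taking out the weight \<open>p\<close> of
  \<open>a\<close> and normalizing is a point of \<open>P\<close> on the far side of
  \<open>x\<close> from \<open>a\<close>.\<close>

lemma convex_comb_extend:
  assumes P: "convex P" and w: "w \<in> P" "b \<in> P"
    and x: "x = p *\<^sub>R a + q *\<^sub>R b + r *\<^sub>R w" "p > 0" "q \<ge> 0" "r > 0" "p + q + r = 1"
  shows "\<exists>e>0. x + e *\<^sub>R (x - a) \<in> P"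
proof -
  define s where "s = q + r"
  have s: "s > 0" "p = 1 - s" using x by (auto simp: s_def)
  have "(q / s) *\<^sub>R b + (r / s) *\<^sub>R w \<in> P"
    using P w x s by (intro convexD) (auto simp: s_def add_divide_distrib[symmetric])
  moreover have "x + (p / s) *\<^sub>R (x - a) = (q / s) *\<^sub>R b + (r / s) *\<^sub>R w"
  proof -
    have eq: "s *\<^sub>R (x + (p / s) *\<^sub>R (x - a)) = q *\<^sub>R b + r *\<^sub>R w"
    proof -
      have "s *\<^sub>R (x + (p / s) *\<^sub>R (x - a)) = (s + p) *\<^sub>R x - p *\<^sub>R a"
        using s(1) by (simp add: algebra_simps)
      also have "\<dots> = x - p *\<^sub>R a" using s by simp
      also have "\<dots> = q *\<^sub>R b + r *\<^sub>R w" using x(1) by simp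
      finally show ?thesis .
    qed
    have "x + (p / s) *\<^sub>R (x - a) = (1 / s) *\<^sub>R (s *\<^sub>R (x + (p / s) *\<^sub>R (x - a)))" using s by simp
    also have "\<dots> = (q / s) *\<^sub>R b + (r / s) *\<^sub>R w" unfolding eq by (simp add: scaleR_add_right)
    finally show ?thesis .
  qed
  ultimately show ?thesis using s x by (intro exI[of _ "p / s"]) auto
qed

text \<open>\<open>F\<close> is the smallest face through \<open>x\<close>: it collects the points
  \<open>z\<close> for which the segment from \<open>z\<close> to \<open>x\<close> can be prolonged
  inside \<open>R\<close>.\<close>

lemma minimal_face:
  assumes R: "convex R" and x: "x \<in> R"
  defines "F \<equiv> {z \<in> R. \<exists>e>0. x + e *\<^sub>R (x - z) \<in> R}"
  shows "F face_of R" and "x \<in> F" and "x \<in> rel_core R \<longleftrightarrow> F = R"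
proof -
  show "x \<in> F" unfolding F_def using x by (auto intro: exI[of _ 1])
  show "x \<in> rel_core R \<longleftrightarrow> F = R" unfolding F_def rel_core_def using x by blast
  show "F face_of R"
    unfolding face_of_def
  proof (intro conjI ballI impI)
    show "F \<subseteq> R" by (auto simp: F_def)
    show "convex F"
      unfolding convex_alt
    proof (intro ballI allI impI)
      fix a b u assume a: "a \<in> F" and b: "b \<in> F" and u: "0 \<le> u \<and> u \<le> (1::real)"
      obtain e where e: "e > 0" "x + e *\<^sub>R (x - a) \<in> R" using a F_def by blast
      obtain f where f: "f > 0" "x + f *\<^sub>R (x - b) \<in> R" using b F_def by blast
      define m where "m = min e f"
      have m: "m > 0" "x + m *\<^sub>R (x - a) \<in> R" "x + m *\<^sub>R (x - b) \<in> R"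
        using e f convex_stepD[OF R x] by (auto simp: m_def)
      have "(1 - u) *\<^sub>R (x + m *\<^sub>R (x - a)) + u *\<^sub>R (x + m *\<^sub>R (x - b)) \<in> R"
        using m u by (intro convexD_alt[OF R]) auto
      moreover have "(1 - u) *\<^sub>R (x + m *\<^sub>R (x - a)) + u *\<^sub>R (x + m *\<^sub>R (x - b))
        = x + m *\<^sub>R (x - ((1 - u) *\<^sub>R a + u *\<^sub>R b))" by (simp add: algebra_simps)
      moreover have "(1 - u) *\<^sub>R a + u *\<^sub>R b \<in> R" using a b u by (intro convexD_alt[OF R]) (auto simp: F_def)
      ultimately show "(1 - u) *\<^sub>R a + u *\<^sub>R b \<in> F" using m(1) unfolding F_def by auto
    qed
    fix a b z assume ab: "a \<in> R" "b \<in> R" and z: "z \<in> F" "z \<in> open_segment a b"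
    obtain u where u: "0 < u" "u < 1" "z = (1 - u) *\<^sub>R a + u *\<^sub>R b" using z(2) by (auto simp: in_segment)
    obtain e where e: "e > 0" "x + e *\<^sub>R (x - z) \<in> R" using z(1) F_def by blast
    define w where "w = x + e *\<^sub>R (x - z)"
    define s where "s = 1 / (1 + e)"
    have s: "0 < s" "s < 1" "s + s * e = 1" using e by (auto simp: s_def field_simps)
    have "(1 - s) *\<^sub>R z + s *\<^sub>R w = (s + s * e) *\<^sub>R x + (1 - (s + s * e)) *\<^sub>R z"
      by (simp add: w_def algebra_simps)
    then have xz: "x = (1 - s) *\<^sub>R z + s *\<^sub>R w" using s(3) by simp
    \<comment> \<open>Substituting for \<open>z\<close> exhibits \<open>x\<close> as a mixture of
      \<open>a\<close>, \<open>b\<close> and \<open>w\<close> with positive weights, so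
      \<open>convex_comb_extend\<close> applies to \<open>a\<close> and to \<open>b\<close>
      alike.\<close>
    have xa: "x = ((1 - s) * (1 - u)) *\<^sub>R a + ((1 - s) * u) *\<^sub>R b + s *\<^sub>R w"
      unfolding xz u(3) by (simp add: scaleR_add_right)
    then have xb: "x = ((1 - s) * u) *\<^sub>R b + ((1 - s) * (1 - u)) *\<^sub>R a + s *\<^sub>R w"
      by (simp add: add.commute)
    have w: "w \<in> R" using e w_def by simp
    have pos: "0 < (1 - s) * (1 - u)" "0 < (1 - s) * u" using s u by auto
    have sum: "(1 - s) * (1 - u) + (1 - s) * u + s = 1" by (simp add: algebra_simps)
    have "\<exists>e>0. x + e *\<^sub>R (x - a) \<in> R" "\<exists>e>0. x + e *\<^sub>R (x - b) \<in> R"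
      using convex_comb_extend[OF R w ab(2) xa] convex_comb_extend[OF R w ab(1) xb] pos s sum
      by auto
    then show "a \<in> F" "b \<in> F" using ab by (auto simp: F_def)
  qed
qed

text \<open>A core point of \<open>R\<close> lies strictly between \<open>z\<close> and a point of
  \<open>P\<close>, and the core of \<open>P\<close> swallows such segments. So a cell that meets
  \<open>rel_core P\<close> has its whole core there.\<close>

lemma rel_core_absorb:
  assumes P: "convex P" and RP: "R \<subseteq> P" and z: "z \<in> R" "z \<in> rel_core P"
  shows "rel_core R \<subseteq> rel_core P"
proof
  fix x assume x: "x \<in> rel_core R"
  then have xR: "x \<in> R" using rel_core_subset by blast
  obtain w s where s: "w \<in> R" "0 < s" "s < 1" "x = (1 - s) *\<^sub>R z + s *\<^sub>R w"
    using x z(1) rel_core_iff[OF xR] by blast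
  show "x \<in> rel_core P" unfolding s(4) using s RP by (intro rel_core_segment[OF P z(2)]) auto
qed

section \<open>Subdivisions of convex sets\<close>

locale convex_subdivision =
  fixes P :: "'a::real_vector set" and S :: "'a set set"
  assumes fin: "finite S" and P: "convex P"
    and conv: "R \<in> S \<Longrightarrow> convex R"
    and Un: "P = \<Union>S"
    and faces: "R \<in> S \<Longrightarrow> G face_of R \<Longrightarrow> G \<noteq> {} \<Longrightarrow> G \<in> S"
    and meet: "R \<in> S \<Longrightarrow> R' \<in> S \<Longrightarrow> R \<noteq> R' \<Longrightarrow> (R \<inter> R') face_of R"
begin

text \<open>A minimal cell containing \<open>x\<close> works: its smallest face through
  \<open>x\<close> is again a cell, so by minimality it is the whole cell and \<open>x\<close> is a
  core point.\<close>

lemma ex_core_cell: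
  assumes x: "x \<in> P"
  shows "\<exists>R\<in>S. x \<in> rel_core R"
proof -
  have "finite {R \<in> S. x \<in> R}" "{R \<in> S. x \<in> R} \<noteq> {}" using fin x Un by auto
  then obtain R where R: "R \<in> {R \<in> S. x \<in> R}" and min: "\<And>R'. R' \<in> {R \<in> S. x \<in> R} \<Longrightarrow> R' \<subseteq> R \<Longrightarrow> R = R'"
    using finite_has_minimal[of "{R \<in> S. x \<in> R}"] by blast
  have RS: "R \<in> S" "x \<in> R" using R by auto
  define F where "F = {z \<in> R. \<exists>e>0. x + e *\<^sub>R (x - z) \<in> R}"
  note face = minimal_face[OF conv[OF RS(1)] RS(2), folded F_def]
  have "F \<in> S" using faces[OF RS(1) face(1)] face(2) by blast
  then have "R = F" using min[of F] face(2) F_def by auto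
  then show ?thesis using face(3) RS(1) by auto
qed

text \<open>The intersection of the cells is a face of both through a core point of each, hence
  equal to both.\<close>

lemma core_cell_unique:
  assumes "R \<in> S" "R' \<in> S" "x \<in> rel_core R" "x \<in> rel_core R'"
  shows "R = R'"
proof (rule ccontr)
  assume ne: "R \<noteq> R'"
  have x: "x \<in> R \<inter> R'" using assms(3,4) rel_core_subset[of R] rel_core_subset[of R'] by blast
  have "R \<inter> R' = R" using rel_core_face_full[OF meet[OF assms(1,2) ne] x assms(3)] .
  moreover have "R' \<inter> R = R'"
    using rel_core_face_full[OF meet[OF assms(2,1) ne[symmetric]] _ assms(4)] x by blast
  ultimately show False using ne by blast
qed

lemma core_indicator:
  "(\<Sum>R | R \<in> S \<and> R \<inter> rel_core P \<noteq> {}. of_bool (x \<in> rel_core R)) = (of_bool (x \<in> rel_core P) :: real)"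
proof (cases "x \<in> rel_core P")
  case True
  then have xP: "x \<in> P" using rel_core_subset by blast
  obtain R where R: "R \<in> S" "x \<in> rel_core R" using ex_core_cell[OF xP] by blast
  have "R \<inter> rel_core P \<noteq> {}" using R True rel_core_subset[of R] by blast
  then have "(\<Sum>R | R \<in> S \<and> R \<inter> rel_core P \<noteq> {}. of_bool (x \<in> rel_core R)) = (\<Sum>R\<in>{R}. of_bool (x \<in> rel_core R) :: real)"
    using R core_cell_unique fin by (intro sum.mono_neutral_right) auto
  then show ?thesis using R True by simp
next
  case False
  have "x \<notin> rel_core R" if "R \<in> S" "R \<inter> rel_core P \<noteq> {}" for R
    using False rel_core_absorb[OF P, of R] that Un by blast
  then show ?thesis using False by (auto intro!: sum.neutral)
qed

text \<open>\<open>None\<close> stands for \<open>P\<close> with coefficient -1, which turns the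
  partition of its core into cell cores into a linear relation. Cutting all cores by
  \<open>U\<close> gives the sets \<open>D i\<close>, which have the dimension of their cells
  whenever they are nonempty.\<close>

theorem euler_relation_cells:
  fixes l :: "'j \<Rightarrow> 'a \<Rightarrow> real"
  assumes J: "finite J" and W: "finite W" and lin: "\<And>j. j \<in> J \<Longrightarrow> linear (l j)"
    and PW: "P \<subseteq> span W"
    and ne: "rel_core P \<noteq> {}" "\<And>R. R \<in> S \<Longrightarrow> rel_core R \<noteq> {}"
    and bd: "\<And>j. j \<in> J \<Longrightarrow> bounded (l j ` P)"
    and sep: "\<And>x y. x \<in> P \<Longrightarrow> y \<in> P \<Longrightarrow> (\<And>j. j \<in> J \<Longrightarrow> l j x = l j y) \<Longrightarrow> x = y"
    and U: "alg_open U" "convex U"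
  shows "(\<Sum>R | R \<in> S \<and> R \<inter> rel_core P \<noteq> {}. (-1) ^ dim (dirs R) * of_bool (R \<inter> U \<noteq> {}))
    = ((-1) ^ dim (dirs P) * of_bool (P \<inter> U \<noteq> {}) :: real)"
proof -
  define K where "K = {R \<in> S. R \<inter> rel_core P \<noteq> {}}"
  define I where "I = {i \<in> insert None (Some ` K). (case i of None \<Rightarrow> P | Some R \<Rightarrow> R) \<inter> U \<noteq> {}}"
  define D where "D i = rel_core (case i of None \<Rightarrow> P | Some R \<Rightarrow> R) \<inter> U" for i
  define c :: "'a set option \<Rightarrow> real" where "c i = (case i of None \<Rightarrow> - 1 | Some R \<Rightarrow> 1)" for i
  have finK: "finite K" using fin by (simp add: K_def)
  have finI: "finite I" using finK by (simp add: I_def)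
  have expand: "(\<Sum>i\<in>insert None (Some ` K). g i) = g None + (\<Sum>R\<in>K. g (Some R))" for g :: "'a set option \<Rightarrow> real"
    using finK by (subst sum.insert) (auto simp: sum.reindex)
  have cell: "convex (case i of None \<Rightarrow> P | Some R \<Rightarrow> R) \<and> rel_core (case i of None \<Rightarrow> P | Some R \<Rightarrow> R) \<noteq> {}
      \<and> (case i of None \<Rightarrow> P | Some R \<Rightarrow> R) \<subseteq> P"
    if "i \<in> insert None (Some ` K)" for i
    using that P conv ne Un by (auto simp: K_def)
  have DP: "D i \<subseteq> P" if "i \<in> I" for i
    using that cell[of i] rel_core_subset unfolding I_def D_def by blast
  have "(\<Sum>i\<in>I. c i * (-1) ^ dim (dirs (D i))) = 0"
  proof (rule euler_relation[OF J W lin finI])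
    fix i assume i: "i \<in> I"
    then have i': "i \<in> insert None (Some ` K)" by (simp add: I_def)
    show "lin_open (D i)" unfolding D_def
      by (intro lin_open_Int_alg_open lin_open_rel_core U) (use cell[OF i'] in blast)
    show "D i \<noteq> {}" unfolding D_def
      using rel_core_meets_iff[OF _ _ U(1)] cell[OF i'] i by (auto simp: I_def)
    show "D i \<subseteq> span W" using DP[OF i] PW by blast
    show "bounded (l j ` D i)" if "j \<in> J" for j
      using bd[OF that] DP[OF i] by (meson bounded_subset image_mono)
    show "x = y" if "k \<in> I" "x \<in> D i" "y \<in> D k" "\<And>j. j \<in> J \<Longrightarrow> l j x = l j y" for k x y
      using sep[of x y] that DP[OF i] DP[of k] by blast
  next
    fix x
    have "(\<Sum>i\<in>I. c i * of_bool (x \<in> D i)) = (\<Sum>i\<in>insert None (Some ` K). c i * of_bool (x \<in> D i))"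
      using finK rel_core_subset by (intro sum.mono_neutral_left) (auto simp: I_def D_def)
    also have "\<dots> = of_bool (x \<in> U) * ((\<Sum>R\<in>K. of_bool (x \<in> rel_core R)) - of_bool (x \<in> rel_core P))"
      unfolding expand by (simp add: c_def D_def sum_distrib_left)
    also have "\<dots> = 0" using core_indicator[of x] by (simp add: K_def)
    finally show "(\<Sum>i\<in>I. c i * of_bool (x \<in> D i)) = 0" .
  qed auto
  \<comment> \<open>The indices discarded for missing \<open>U\<close> return with the factor
    \<open>of_bool\<close> equal to zero.\<close>
  moreover have "(\<Sum>i\<in>I. c i * (-1) ^ dim (dirs (D i)))
    = (\<Sum>i\<in>insert None (Some ` K). c i * ((-1) ^ dim (dirs (case i of None \<Rightarrow> P | Some R \<Rightarrow> R))
        * of_bool ((case i of None \<Rightarrow> P | Some R \<Rightarrow> R) \<inter> U \<noteq> {})))"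
  proof (rule sum.mono_neutral_cong_left)
    show "finite (insert None (Some ` K))" using finK by simp
    show "I \<subseteq> insert None (Some ` K)" by (auto simp: I_def)
    fix i assume i: "i \<in> I"
    then have i': "i \<in> insert None (Some ` K)" by (simp add: I_def)
    let ?R = "case i of None \<Rightarrow> P | Some R \<Rightarrow> R"
    have m: "?R \<inter> U \<noteq> {}" using i by (simp add: I_def)
    then have "rel_core ?R \<inter> U \<noteq> {}" using rel_core_meets_iff[OF _ _ U(1)] cell[OF i'] by blast
    then have "dirs (D i) = dirs (rel_core ?R)"
      unfolding D_def using dirs_Int_alg_open[OF convex_rel_core U(1)] cell[OF i'] by blast
    also have "\<dots> = dirs ?R" using cell[OF i'] by (intro dirs_rel_core) auto
    finally show "c i * (-1) ^ dim (dirs (D i)) = c i * ((-1) ^ dim (dirs ?R) * of_bool (?R \<inter> U \<noteq> {}))"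
      using m by simp
  qed (auto simp: I_def)
  ultimately show ?thesis unfolding expand by (simp add: c_def K_def)
qed

end

section \<open>Relative interiors of polytopes\<close>

text \<open>The barycentre has all weights \<open>1 / n\<close>. Moving away from \<open>y\<close>
  by the factor \<open>1 / n\<close> lowers no weight below zero, because the weights of
  \<open>y\<close> are at most one.\<close>

lemma rel_core_hull_finite:
  fixes V :: "'a::real_vector set"
  assumes V: "finite V" "V \<noteq> {}"
  shows "rel_core (convex hull V) \<noteq> {}"
proof -
  define n where "n = real (card V)"
  have n: "n > 0" using V by (simp add: n_def card_gt_0_iff)
  define x where "x = (\<Sum>v\<in>V. (1 / n) *\<^sub>R v)"
  have xV: "x \<in> convex hull V"
    unfolding convex_hull_finite[OF V(1)] x_def using n
    by (intro CollectI exI[of _ "\<lambda>_. 1 / n"]) (auto simp: n_def)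
  have "\<exists>e>0. x + e *\<^sub>R (x - y) \<in> convex hull V" if y: "y \<in> convex hull V" for y
  proof -
    obtain u where u: "\<forall>v\<in>V. 0 \<le> u v" "sum u V = 1" "(\<Sum>v\<in>V. u v *\<^sub>R v) = y"
      using y unfolding convex_hull_finite[OF V(1)] by blast
    define e where "e = 1 / n"
    have e: "e > 0" using n by (simp add: e_def)
    have "x + e *\<^sub>R (x - y) = (\<Sum>v\<in>V. ((1 + e) / n - e * u v) *\<^sub>R v)"
    proof -
      have "x + e *\<^sub>R (x - y) = (1 + e) *\<^sub>R x - e *\<^sub>R y" by (simp add: algebra_simps)
      then show ?thesis
        unfolding x_def u(3)[symmetric] by (simp add: scaleR_sum_right scaleR_diff_left sum_subtractf)
    qed
    moreover have "(1 + e) / n - e * u v \<ge> 0" if "v \<in> V" for v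
    proof -
      have "u v \<le> 1" using member_le_sum[OF that, of u] u(1,2) V(1) by auto
      then have "e * u v \<le> e * 1" using e by (intro mult_left_mono) auto
      moreover have "(1 + e) / n \<ge> 1 / n" using e n by (intro divide_right_mono) auto
      ultimately show ?thesis by (simp add: e_def)
    qed
    moreover have "(\<Sum>v\<in>V. (1 + e) / n - e * u v) = 1"
      using n u(2) by (simp add: sum_subtractf sum_distrib_left[symmetric] n_def[symmetric])
    ultimately have "x + e *\<^sub>R (x - y) \<in> convex hull V"
      unfolding convex_hull_finite[OF V(1)] by (intro CollectI exI[of _ "\<lambda>v. (1 + e) / n - e * u v"]) auto
    then show ?thesis using e by blast
  qed
  then show ?thesis using xV unfolding rel_core_def by blast
qed

section \<open>Coordinates of finitely supported vectors\<close>

lemma dist_lookup_le: "\<bar>Poly_Mapping.lookup (x::vec) i - Poly_Mapping.lookup y i\<bar> \<le> dist x y"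
proof (cases "i \<in> Poly_Mapping.keys x \<union> Poly_Mapping.keys y")
  case True
  have "dist (Poly_Mapping.lookup x i) (Poly_Mapping.lookup y i) \<le> dist x y"
    unfolding dist_poly_mapping_def by (rule member_le_sum[OF True]) auto
  then show ?thesis by (simp add: dist_real_def)
next
  case False
  then show ?thesis by (simp add: in_keys_iff)
qed

lemma linear_lookup: "linear (\<lambda>x::vec. Poly_Mapping.lookup x i)"
  by (intro linearI) (auto simp: Poly_Mapping.lookup_add lookup_scaleR_vec)

lemma vec_expansion:
  assumes "finite E" "Poly_Mapping.keys x \<subseteq> E"
  shows "x = (\<Sum>i\<in>E. Poly_Mapping.lookup x i *\<^sub>R (Poly_Mapping.single i 1 :: vec))"
proof (rule poly_mapping_eqI)
  fix k
  have "Poly_Mapping.lookup (\<Sum>i\<in>E. Poly_Mapping.lookup x i *\<^sub>R (Poly_Mapping.single i 1 :: vec)) k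
    = (\<Sum>i\<in>E. Poly_Mapping.lookup x i * (if i = k then 1 else 0))"
    by (simp add: lookup_sum lookup_scaleR_vec Poly_Mapping.lookup_single when_def)
  also have "\<dots> = (if k \<in> E then Poly_Mapping.lookup x k else 0)"
    using assms(1) by (simp add: if_distrib sum.delta cong: if_cong)
  also have "\<dots> = Poly_Mapping.lookup x k" using assms(2) by (auto simp: in_keys_iff)
  finally show "Poly_Mapping.lookup x k = Poly_Mapping.lookup (\<Sum>i\<in>E. Poly_Mapping.lookup x i *\<^sub>R (Poly_Mapping.single i 1 :: vec)) k"
    by simp
qed

lemma keys_subset_span:
  assumes "finite E" "Poly_Mapping.keys x \<subseteq> E"
  shows "x \<in> span ((\<lambda>i. Poly_Mapping.single i 1 :: vec) ` E)"
proof -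
  have "(\<Sum>i\<in>E. Poly_Mapping.lookup x i *\<^sub>R (Poly_Mapping.single i 1 :: vec))
      \<in> span ((\<lambda>i. Poly_Mapping.single i 1 :: vec) ` E)"
    by (rule span_sum) (rule span_scale[OF span_base], simp)
  then show ?thesis by (simp only: vec_expansion[OF assms, symmetric])
qed

lemma subspace_keys: "subspace {x::vec. Poly_Mapping.keys x \<subseteq> E}"
proof -
  have "{x::vec. Poly_Mapping.keys x \<subseteq> E} = {x. \<forall>i. i \<notin> E \<longrightarrow> Poly_Mapping.lookup x i = 0}"
    by (auto simp: in_keys_iff)
  then show ?thesis by (auto simp: subspace_def Poly_Mapping.lookup_add lookup_scaleR_vec)
qed

text \<open>The inclusion of the core rests on finite dimension. For \<open>y\<close> near
  \<open>x\<close> in the affine hull, the coordinates of \<open>w = y - x\<close> in a basis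
  \<open>B\<close> of the direction space are small, and \<open>x + w\<close> is the average of the
  points reached from \<open>x\<close> along one basis vector by \<open>n\<close> times its
  coordinate. Each of these lies in \<open>P\<close> by the core property.\<close>

lemma rel_interior_eq_rel_core:
  fixes P :: "vec set"
  assumes P: "convex P" and E: "finite E" "\<And>x. x \<in> P \<Longrightarrow> Poly_Mapping.keys x \<subseteq> E"
    and ne: "rel_core P \<noteq> {}"
  shows "rel_interior P = rel_core P"
proof
  show "rel_interior P \<subseteq> rel_core P"
  proof
    fix x assume "x \<in> rel_interior P"
    then obtain T where T: "open T" "x \<in> T" "x \<in> P" "T \<inter> affine hull P \<subseteq> P"
      unfolding rel_interior_def openin_open by (auto dest: hull_inc)
    have "\<exists>e>0. x + e *\<^sub>R (x - y) \<in> P" if y: "y \<in> P" for y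
    proof -
      obtain r where r: "r > 0" "ball x r \<subseteq> T" using T(1,2) open_contains_ball by blast
      define e where "e = r / (2 * (1 + norm (x - y)))"
      have pos: "1 + norm (x - y) > 0" by (simp add: add_pos_nonneg)
      have e: "e > 0" using r(1) pos by (simp add: e_def)
      have "e * norm (x - y) < r"
      proof -
        have "e * norm (x - y) \<le> e * (1 + norm (x - y))" using e by simp
        also have "\<dots> = r / 2" using pos by (simp add: e_def del: distrib_left_numeral)
        finally show ?thesis using r(1) by simp
      qed
      then have "x + e *\<^sub>R (x - y) \<in> ball x r" using e by (simp add: dist_norm)
      moreover have "(1 + e) *\<^sub>R x + (- e) *\<^sub>R y \<in> affine hull P"
        using affine_affine_hull[of P] T(3) y by (intro mem_affine) (auto dest: hull_inc)
      then have "x + e *\<^sub>R (x - y) \<in> affine hull P" by (simp add: algebra_simps)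
      ultimately show ?thesis using e r(2) T(4) by blast
    qed
    then show "x \<in> rel_core P" using T(3) unfolding rel_core_def by blast
  qed
next
  show "rel_core P \<subseteq> rel_interior P"
  proof
    fix x assume x: "x \<in> rel_core P"
    then have xP: "x \<in> P" using rel_core_subset by blast
    let ?W = "(\<lambda>i. Poly_Mapping.single i 1 :: vec) ` E"
    obtain B where B: "B \<subseteq> dirs P" "independent B" "dirs P \<subseteq> span B" "card B = dim (dirs P)"
      by (rule basis_exists)
    have PW: "P \<subseteq> span ?W" using keys_subset_span[OF E(1)] E(2) by blast
    have finB: "finite B" using independent_span_bound[OF _ B(2), of ?W] dirs_subset_span[OF PW] B(1) E(1) by blast
    \<comment> \<open>Unit vectors need not lie in the span of \<open>B\<close>. Extending to a
      basis of the whole space makes the coordinate functionals linear everywhere, so they can be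
      expanded in the entries of a vector.\<close>
    define C where "C = extend_basis B"
    have C: "independent C" "span C = UNIV" "B \<subseteq> C"
      unfolding C_def by (rule independent_extend_basis[OF B(2)] span_extend_basis[OF B(2)] extend_basis_superset[OF B(2)])+
    define beta where "beta b w = representation C w b" for b w
    have beta_lin: "beta b w = (\<Sum>i\<in>E. Poly_Mapping.lookup w i * beta b (Poly_Mapping.single i 1))"
      if "Poly_Mapping.keys w \<subseteq> E" for b w
      unfolding beta_def
      by (subst vec_expansion[OF E(1) that])
         (simp add: representation_sum[OF C(1)] representation_scale[OF C(1)] C(2))
    have beta_exp: "w = (\<Sum>b\<in>B. beta b w *\<^sub>R b)" if w: "w \<in> dirs P" for w
    proof -
      have wB: "w \<in> span B" using w B(3) by blast
      have "beta b w = representation B w b" for b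
        unfolding beta_def using representation_extend[OF C(1) wB C(3)] by simp
      then show ?thesis
        using sum_representation_eq[OF B(2) wB finB order_refl] by simp
    qed
    show "x \<in> rel_interior P"
    \<comment> \<open>No basis vector means a single point; otherwise averages over \<open>B\<close>
      may divide by \<open>card B\<close>.\<close>
    proof (cases "B = {}")
      case True
      then have d0: "dirs P \<subseteq> {0}" using B(3) by simp
      have "y = x" if "y \<in> P" for y using dirs_diff[OF that xP] d0 by auto
      then have "P = {x}" using xP by blast
      moreover have "openin (top_of_set (affine hull {x})) {x}"
        by (simp only: hull_same[where S = affine and s = "{x}", OF affine_sing] openin_subtopology_self)
      ultimately show ?thesis unfolding rel_interior_def by (auto intro!: exI[of _ "{x}"])
    next
      case False
      have core: "\<exists>e>0. x + e *\<^sub>R v \<in> P" if v: "v \<in> dirs P" for v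
      proof -
        have "v \<in> dirs (rel_core P)" using v dirs_rel_core[OF P ne] by simp
        then show ?thesis
          using lin_open_direction[OF lin_open_rel_core[OF P] x] rel_core_subset by blast
      qed
      have "\<exists>e>0. x + e *\<^sub>R b \<in> P \<and> x + e *\<^sub>R (- b) \<in> P" if b: "b \<in> B" for b
      proof -
        obtain e where e: "e > 0" "x + e *\<^sub>R b \<in> P" using core[of b] B(1) b by blast
        obtain f where f: "f > 0" "x + f *\<^sub>R (- b) \<in> P"
          using core[of "- b"] B(1) b subspace_neg[OF subspace_dirs, of b P] by blast
        show ?thesis
          using e f convex_stepD[OF P xP, of e b "min e f"] convex_stepD[OF P xP, of f "- b" "min e f"]
          by (intro exI[of _ "min e f"]) auto
      qed
      then obtain ep where ep: "\<And>b. b \<in> B \<Longrightarrow> ep b > 0"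
        "\<And>b. b \<in> B \<Longrightarrow> x + ep b *\<^sub>R b \<in> P" "\<And>b. b \<in> B \<Longrightarrow> x + ep b *\<^sub>R (- b) \<in> P" by metis
      define n where "n = real (card B)"
      have n: "n > 0" using finB False by (simp add: n_def card_gt_0_iff)
      \<comment> \<open>Division by \<open>n\<close> anticipates the factor \<open>n\<close> of the
        averaged moves.\<close>
      define e where "e = Min (ep ` B) / n"
      have "Min (ep ` B) > 0" using finB False ep(1) by (subst Min_gr_iff) auto
      then have e: "e > 0" using n by (simp add: e_def)
      have e_le: "n * e \<le> ep b" if "b \<in> B" for b using finB that n by (simp add: e_def)
      \<comment> \<open>\<open>M\<close> times a bound for the entries of \<open>w\<close> bounds
        all its coordinates; the summand 1 makes it positive.\<close>
      define M where "M = 1 + (\<Sum>b\<in>B. \<Sum>i\<in>E. \<bar>beta b (Poly_Mapping.single i 1)\<bar>)"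
      have M: "M > 0" unfolding M_def by (intro add_pos_nonneg sum_nonneg) auto
      have mem: "y \<in> P" if y: "y \<in> affine hull P" "y \<in> ball x (e / M)" for y
      proof -
        have "affine hull P = {x + v |v. v \<in> span {z - x |z. z \<in> P - {x}}}" by (rule affine_hull_span[OF xP])
        moreover have "span {z - x |z. z \<in> P - {x}} \<subseteq> dirs P"
          using dirs_diff[OF _ xP] by (intro span_minimal) auto
        ultimately have w: "y - x \<in> dirs P" using y(1) by auto
        define w where "w = y - x"
        have kw: "Poly_Mapping.keys w \<subseteq> E"
        proof -
          have "dirs P \<subseteq> {x::vec. Poly_Mapping.keys x \<subseteq> E}"
          proof (rule dirs_subsetI[of _ x])
            fix z assume "z \<in> P"
            then show "z - x \<in> {x::vec. Poly_Mapping.keys x \<subseteq> E}"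
              using E(2)[of z] E(2)[OF xP] subspace_diff[OF subspace_keys[of E], of z x] by auto
          qed (rule subspace_keys)
          then show ?thesis using w w_def by auto
        qed
        have bd: "\<bar>beta b w\<bar> \<le> e" if b: "b \<in> B" for b
        proof -
          have "\<bar>beta b w\<bar> \<le> (\<Sum>i\<in>E. \<bar>Poly_Mapping.lookup w i\<bar> * \<bar>beta b (Poly_Mapping.single i 1)\<bar>)"
            by (subst beta_lin[OF kw]) (simp add: abs_mult[symmetric] sum_abs)
          also have "\<dots> \<le> (\<Sum>i\<in>E. (e / M) * \<bar>beta b (Poly_Mapping.single i 1)\<bar>)"
          proof (intro sum_mono mult_right_mono)
            fix i
            have "\<bar>Poly_Mapping.lookup w i\<bar> \<le> dist x y"
              using dist_lookup_le[of y i x] by (simp add: w_def lookup_minus dist_commute)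
            then show "\<bar>Poly_Mapping.lookup w i\<bar> \<le> e / M" using y(2) by simp
          qed simp
          also have "\<dots> = (e / M) * (\<Sum>i\<in>E. \<bar>beta b (Poly_Mapping.single i 1)\<bar>)" by (simp add: sum_distrib_left)
          also have "\<dots> \<le> (e / M) * M"
          proof (intro mult_left_mono)
            have "(\<Sum>i\<in>E. \<bar>beta b (Poly_Mapping.single i 1)\<bar>) \<le> (\<Sum>b\<in>B. \<Sum>i\<in>E. \<bar>beta b (Poly_Mapping.single i 1)\<bar>)"
              using finB b by (intro member_le_sum) (auto intro: sum_nonneg)
            then show "(\<Sum>i\<in>E. \<bar>beta b (Poly_Mapping.single i 1)\<bar>) \<le> M" by (simp add: M_def)
          qed (use e M in auto)
          also have "\<dots> = e" using M by simp
          finally show ?thesis .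
        qed
        have step: "x + (n * beta b w) *\<^sub>R b \<in> P" if b: "b \<in> B" for b
        proof (cases "beta b w \<ge> 0")
          case True
          have "n * beta b w \<le> n * e" using bd[OF b] n by (intro mult_left_mono) auto
          then have "n * beta b w \<le> ep b" using e_le[OF b] by linarith
          then show ?thesis using True n by (intro convex_stepD[OF P xP ep(2)[OF b]]) auto
        next
          case False
          have "n * (- beta b w) \<le> n * e" using bd[OF b] n by (intro mult_left_mono) auto
          then have "n * (- beta b w) \<le> ep b" using e_le[OF b] by linarith
          moreover have "0 \<le> n * (- beta b w)" using False n by (intro mult_nonneg_nonneg) auto
          ultimately have "x + (n * (- beta b w)) *\<^sub>R (- b) \<in> P"
            by (intro convex_stepD[OF P xP ep(3)[OF b]])
          then show ?thesis by simp
        qed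
        have "(\<Sum>b\<in>B. (1 / n) *\<^sub>R (x + (n * beta b w) *\<^sub>R b)) \<in> P"
          using n step by (intro convex_sum[OF finB P]) (auto simp: n_def)
        also have "(\<Sum>b\<in>B. (1 / n) *\<^sub>R (x + (n * beta b w) *\<^sub>R b)) = x + w"
          using n beta_exp[of w] w
          by (simp add: scaleR_add_right sum.distrib sum_constant_scaleR n_def[symmetric] w_def[symmetric] del: sum_constant)
        finally show ?thesis by (simp add: w_def)
      qed
      have "openin (top_of_set (affine hull P)) (affine hull P \<inter> ball x (e / M))"
        by (rule openin_open_Int) simp
      moreover have "x \<in> affine hull P \<inter> ball x (e / M)" using xP e M by (auto dest: hull_inc)
      moreover have "affine hull P \<inter> ball x (e / M) \<subseteq> P" using mem by blast
      ultimately show ?thesis unfolding rel_interior_def by blast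
    qed
  qed
qed

section \<open>Matroids\<close>

definition indep :: "matroid \<Rightarrow> nat set \<Rightarrow> bool" where
  "indep M X \<longleftrightarrow> (\<exists>B\<in>bases M. X \<subseteq> B)"

locale valid_matroid =
  fixes M assumes M: "is_matroid M"
begin

lemma finite_ground: "finite (ground M)"
  using M by (simp add: is_matroid_def)

lemma base_subset: "B \<in> bases M \<Longrightarrow> B \<subseteq> ground M"
  using M by (auto simp: is_matroid_def)

lemma finite_base: "B \<in> bases M \<Longrightarrow> finite B"
  using base_subset finite_ground finite_subset by blast

lemma finite_bases: "finite (bases M)"
  using base_subset finite_ground by (intro finite_subset[of "bases M" "Pow (ground M)"]) auto

lemma bases_nonempty: "bases M \<noteq> {}"
  using M by (simp add: is_matroid_def)

lemma exchange:
  assumes "A \<in> bases M" "B \<in> bases M" "a \<in> A - B"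
  obtains b where "b \<in> B - A" "insert b (A - {a}) \<in> bases M"
  using M assms unfolding is_matroid_def by blast

text \<open>Exchanging an element of \<open>A - B\<close> for one of \<open>B\<close> keeps the
  cardinality and shrinks the difference.\<close>

lemma card_bases_le:
  assumes "A \<in> bases M" "B \<in> bases M"
  shows "card A \<le> card B"
  using assms(1)
proof (induction "card (A - B)" arbitrary: A rule: less_induct)
  case less
  note A = less.prems and finA = finite_base[OF less.prems] and finB = finite_base[OF assms(2)]
  show ?case
  proof (cases "A \<subseteq> B")
    case True
    then show ?thesis using finB by (rule card_mono[rotated])
  next
    case False
    then obtain a where a: "a \<in> A - B" by blast
    obtain b where b: "b \<in> B - A" "insert b (A - {a}) \<in> bases M" using exchange[OF A assms(2) a] .
    have "insert b (A - {a}) - B = (A - B) - {a}" using b by auto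
    then have "card (insert b (A - {a}) - B) < card (A - B)"
      using a finA by (metis card_Diff1_less finite_Diff)
    then have "card (insert b (A - {a})) \<le> card B" using less.hyps b(2) by blast
    moreover have "card (insert b (A - {a})) = card A"
      using a b finA card_Suc_Diff1[of A a] by (subst card_insert_disjoint) (auto simp del: card_Diff_singleton)
    ultimately show ?thesis by simp
  qed
qed

lemma card_bases_eq: "A \<in> bases M \<Longrightarrow> B \<in> bases M \<Longrightarrow> card A = card B"
  using card_bases_le by (simp add: order_antisym)

lemma indep_base: "B \<in> bases M \<Longrightarrow> indep M B"
  by (auto simp: indep_def)

lemma indep_subset: "indep M X \<Longrightarrow> Y \<subseteq> X \<Longrightarrow> indep M Y"
  by (auto simp: indep_def)

lemma indep_finite: "indep M X \<Longrightarrow> finite X"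
  using finite_base finite_subset by (auto simp: indep_def)

text \<open>Take bases above \<open>I\<close> and \<open>J\<close>, the second with as few elements
  as possible outside \<open>J \<union> B1\<close>. Exchange and minimality push \<open>B2\<close>
  into \<open>J \<union> B1\<close>; if no augmentation exists, exchange pushes \<open>B1\<close>
  into \<open>I \<union> B2\<close>. Equal cardinality of the bases then contradicts
  \<open>card I < card J\<close>.\<close>

lemma augment:
  assumes I: "indep M I" and J: "indep M J" and lt: "card I < card J"
  shows "\<exists>e\<in>J - I. indep M (insert e I)"
proof (rule ccontr)
  assume neg: "\<not> (\<exists>e\<in>J - I. indep M (insert e I))"
  obtain B1 where B1: "B1 \<in> bases M" "I \<subseteq> B1" using I by (auto simp: indep_def)
  have "\<exists>B2. B2 \<in> bases M \<and> J \<subseteq> B2" using J by (auto simp: indep_def)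
  then obtain B2 where B2: "B2 \<in> bases M" "J \<subseteq> B2"
    and min: "\<And>B. B \<in> bases M \<Longrightarrow> J \<subseteq> B \<Longrightarrow> card (B2 - (J \<union> B1)) \<le> card (B - (J \<union> B1))"
    using exists_least_iff[of "\<lambda>n. \<exists>B. B \<in> bases M \<and> J \<subseteq> B \<and> card (B - (J \<union> B1)) = n"]
    by (metis (no_types, lifting) not_less)
  have fin: "finite B1" "finite B2" "finite I" "finite J" using B1 B2 I J finite_base indep_finite by auto
  have sub2: "B2 \<subseteq> J \<union> B1"
  proof
    fix x assume x: "x \<in> B2"
    show "x \<in> J \<union> B1"
    proof (rule ccontr)
      assume nx: "x \<notin> J \<union> B1"
      obtain y where y: "y \<in> B1 - B2" "insert y (B2 - {x}) \<in> bases M"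
        using exchange[OF B2(1) B1(1), of x] x nx by blast
      have "insert y (B2 - {x}) - (J \<union> B1) = (B2 - (J \<union> B1)) - {x}" using y by auto
      moreover have "x \<in> B2 - (J \<union> B1)" using x nx by auto
      ultimately have "card (insert y (B2 - {x}) - (J \<union> B1)) < card (B2 - (J \<union> B1))"
        using fin by (metis card_Diff1_less finite_Diff)
      moreover have "J \<subseteq> insert y (B2 - {x})" using B2 nx by auto
      ultimately show False using min[OF y(2)] by simp
    qed
  qed
  have notB1: "e \<notin> B1" if "e \<in> J - I" for e
    using neg that B1 unfolding indep_def by blast
  have sub1: "B1 \<subseteq> I \<union> B2"
  proof
    fix x assume x: "x \<in> B1"
    show "x \<in> I \<union> B2"
    proof (rule ccontr)
      assume nx: "x \<notin> I \<union> B2"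
      obtain y where y: "y \<in> B2 - B1" "insert y (B1 - {x}) \<in> bases M"
        using exchange[OF B1(1) B2(1), of x] x nx by blast
      have "y \<in> J - I" using y(1) sub2 B1 by auto
      moreover have "indep M (insert y I)" unfolding indep_def using B1(2) nx by (intro bexI[OF _ y(2)]) auto
      ultimately show False using neg by blast
    qed
  qed
  have "B2 - B1 = J - I" using sub2 B2 B1 notB1 by blast
  moreover have "B1 - B2 \<subseteq> I - J" using sub1 B2 by blast
  moreover have "card (B1 - B2) = card (B2 - B1)"
    using card_bases_eq[OF B1(1) B2(1)] fin by (simp add: card_Diff_subset_Int Int_commute)
  ultimately have "card (J - I) \<le> card (I - J)" using fin by (metis card_mono finite_Diff)
  moreover have "card (J - I) = card J - card (J \<inter> I)" "card (I - J) = card I - card (J \<inter> I)"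
    using fin by (simp_all add: card_Diff_subset_Int Int_commute)
  moreover have "card (J \<inter> I) \<le> card I" using fin by (intro card_mono) auto
  ultimately show False using lt by linarith
qed

lemma rank_witness: obtains B where "B \<in> bases M" "card (X \<inter> B) = rank_of M X"
proof -
  have "rank_of M X \<in> (\<lambda>B. card (X \<inter> B)) ` bases M"
    unfolding rank_of_def using finite_bases bases_nonempty by (intro Max_in) auto
  then show ?thesis using that by auto
qed

lemma card_Int_le_rank: "B \<in> bases M \<Longrightarrow> card (X \<inter> B) \<le> rank_of M X"
  unfolding rank_of_def using finite_bases by (intro Max_ge) auto

lemma indep_card_le_rank:
  assumes "indep M I" "I \<subseteq> X"
  shows "card I \<le> rank_of M X"
proof -
  obtain B where B: "B \<in> bases M" "I \<subseteq> B" using assms by (auto simp: indep_def)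
  have "card I \<le> card (X \<inter> B)" using B assms finite_base by (intro card_mono) auto
  then show ?thesis using card_Int_le_rank[OF B(1), of X] by simp
qed

lemma extend_to_rank:
  assumes "indep M I" "I \<subseteq> X"
  obtains J where "indep M J" "I \<subseteq> J" "J \<subseteq> X" "card J = rank_of M X"
proof -
  have "\<exists>J. indep M J \<and> I \<subseteq> J \<and> J \<subseteq> X \<and> card J = rank_of M X"
    using assms
  proof (induction "rank_of M X - card I" arbitrary: I rule: less_induct)
    case less
    note I = less.prems
    show ?case
    proof (cases "card I = rank_of M X")
      case False
      then have lt: "card I < rank_of M X" using indep_card_le_rank[OF I] by simp
      obtain B where B: "B \<in> bases M" "card (X \<inter> B) = rank_of M X" using rank_witness .
      have "indep M (X \<inter> B)" using B by (auto simp: indep_def)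
      then obtain e where e: "e \<in> X \<inter> B - I" "indep M (insert e I)"
        using augment[OF I(1), of "X \<inter> B"] lt B(2) by auto
      have "card (insert e I) = Suc (card I)" using e indep_finite[OF I(1)] by auto
      then have "\<exists>J. indep M J \<and> insert e I \<subseteq> J \<and> J \<subseteq> X \<and> card J = rank_of M X"
        using e I lt by (intro less.hyps) auto
      then show ?thesis by blast
    qed (use I in blast)
  qed
  then show ?thesis using that by blast
qed

text \<open>The greedy algorithm: a set realizing the ranks of the smaller members is extended
  inside the largest one. Earlier counts cannot change, being maximal already.\<close>

lemma chain_basis:
  assumes "finite C" "\<And>X Y. X \<in> C \<Longrightarrow> Y \<in> C \<Longrightarrow> X \<subseteq> Y \<or> Y \<subseteq> X"
  obtains B where "B \<in> bases M" "\<And>X. X \<in> C \<Longrightarrow> card (X \<inter> B) = rank_of M X"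
proof -
  have "\<exists>I. indep M I \<and> I \<subseteq> \<Union>C \<and> (\<forall>X\<in>C. card (X \<inter> I) = rank_of M X)"
    using assms
  proof (induction "card C" arbitrary: C rule: less_induct)
    case less
    show ?case
    proof (cases "C = {}")
      case True
      have "indep M {}" using bases_nonempty by (auto simp: indep_def)
      then show ?thesis using True by auto
    next
      case False
      obtain Z where Z: "Z \<in> C" and max: "\<And>X. X \<in> C \<Longrightarrow> Z \<subseteq> X \<Longrightarrow> Z = X"
        using finite_has_maximal[OF less.prems(1) False] by blast
      have Zmax: "X \<subseteq> Z" if "X \<in> C" for X using less.prems(2)[OF that Z] max[OF that] by blast
      have "\<exists>I. indep M I \<and> I \<subseteq> \<Union>(C - {Z}) \<and> (\<forall>X\<in>C - {Z}. card (X \<inter> I) = rank_of M X)"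
      proof (rule less.hyps)
        show "card (C - {Z}) < card C" using Z less.prems(1) by (intro card_Diff1_less)
      qed (use less.prems in auto)
      then obtain I where I: "indep M I" "I \<subseteq> \<Union>(C - {Z})" "\<And>X. X \<in> C - {Z} \<Longrightarrow> card (X \<inter> I) = rank_of M X"
        by blast
      have "I \<subseteq> Z" using I(2) Zmax by blast
      then obtain J where J: "indep M J" "I \<subseteq> J" "J \<subseteq> Z" "card J = rank_of M Z"
        using extend_to_rank[OF I(1)] by blast
      have "card (X \<inter> J) = rank_of M X" if X: "X \<in> C" for X
      proof (cases "X = Z")
        case True
        then show ?thesis using J by (simp add: Int_absorb1)
      next
        case False
        have "card (X \<inter> I) \<le> card (X \<inter> J)" using J(2) indep_finite[OF J(1)] by (intro card_mono) auto
        moreover have "card (X \<inter> J) \<le> rank_of M X"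
          using indep_subset[OF J(1)] by (intro indep_card_le_rank) auto
        ultimately show ?thesis using I(3) X False by simp
      qed
      then show ?thesis using J Z by blast
    qed
  qed
  then obtain I where I: "indep M I" "\<And>X. X \<in> C \<Longrightarrow> card (X \<inter> I) = rank_of M X" by blast
  obtain B where B: "B \<in> bases M" "I \<subseteq> B" using I(1) by (auto simp: indep_def)
  have "card (X \<inter> B) = rank_of M X" if X: "X \<in> C" for X
  proof -
    have "card (X \<inter> I) \<le> card (X \<inter> B)" using B finite_base by (intro card_mono) auto
    then show ?thesis using I(2)[OF X] card_Int_le_rank[OF B(1), of X] by simp
  qed
  then show ?thesis using that B(1) by blast
qed

lemma chain_basis2:
  assumes "X \<subseteq> Y"
  obtains B where "B \<in> bases M" "card (X \<inter> B) = rank_of M X" "card (Y \<inter> B) = rank_of M Y"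
proof (rule chain_basis[of "{X, Y}"])
  fix B assume "B \<in> bases M" "\<And>Z. Z \<in> {X, Y} \<Longrightarrow> card (Z \<inter> B) = rank_of M Z"
  then show ?thesis using that by simp
qed (use assms in auto)

lemma rank_mono: "X \<subseteq> Y \<Longrightarrow> rank_of M X \<le> rank_of M Y"
proof -
  assume XY: "X \<subseteq> Y"
  obtain B where B: "B \<in> bases M" "card (X \<inter> B) = rank_of M X" using rank_witness .
  have "card (X \<inter> B) \<le> card (Y \<inter> B)" using XY finite_base[OF B(1)] by (intro card_mono) auto
  then show ?thesis using B card_Int_le_rank[OF B(1), of Y] by simp
qed

lemma rank_empty [simp]: "rank_of M {} = 0"
  using rank_witness[of "{}"] by (metis Int_empty_left card.empty)

lemma rank_le_card: "finite X \<Longrightarrow> rank_of M X \<le> card X"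
  using rank_witness[of X] by (metis card_mono inf_le1)

text \<open>Stands in for submodularity. A base realizing the ranks along \<open>X\<close>,
  \<open>Y\<close>, \<open>insert e Y\<close> would contain \<open>e\<close> if the rank of
  \<open>Y\<close> grew, and would then meet \<open>insert e X\<close> in too many elements.\<close>

lemma rank_insert_absorb_mono:
  assumes XY: "X \<subseteq> Y" and e: "rank_of M (insert e X) = rank_of M X"
  shows "rank_of M (insert e Y) = rank_of M Y"
proof (rule ccontr)
  assume ne: "rank_of M (insert e Y) \<noteq> rank_of M Y"
  then have gt: "rank_of M (insert e Y) > rank_of M Y"
    using rank_mono[of Y "insert e Y"] by (auto simp: order_less_le)
  obtain B where B: "B \<in> bases M" and c: "\<And>Z. Z \<in> {X, Y, insert e Y} \<Longrightarrow> card (Z \<inter> B) = rank_of M Z"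
    by (rule chain_basis[of "{X, Y, insert e Y}"]) (use XY in auto)
  have eq: "card (X \<inter> B) = rank_of M X" "card (Y \<inter> B) = rank_of M Y" "card (insert e Y \<inter> B) = rank_of M (insert e Y)"
    using c by auto
  have eB: "e \<in> B" using eq gt by (metis Int_insert_left_if0 less_irrefl)
  have "e \<notin> Y" using gt insert_absorb by fastforce
  then have "card (insert e X \<inter> B) = Suc (card (X \<inter> B))"
    using eB XY finite_base[OF B] by (subst Int_insert_left_if1) (auto simp: card_insert_if)
  then show False using card_Int_le_rank[OF B, of "insert e X"] e eq by simp
qed

lemma rank_Un_absorb:
  assumes "finite Z" "X \<subseteq> Y" "\<And>e. e \<in> Z \<Longrightarrow> rank_of M (insert e X) = rank_of M X"
  shows "rank_of M (Y \<union> Z) = rank_of M Y"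
  using assms(1,3)
proof (induction Z rule: finite_induct)
  case (insert e Z)
  have "rank_of M (insert e (Y \<union> Z)) = rank_of M (Y \<union> Z)"
    using assms(2) insert.prems by - (rule rank_insert_absorb_mono[of X], auto)
  then show ?case using insert by simp
qed simp

lemma card_base: "B \<in> bases M \<Longrightarrow> card B = rk M"
proof -
  assume B: "B \<in> bases M"
  obtain B' where B': "B' \<in> bases M" "card (ground M \<inter> B') = rk M" using rank_witness .
  have "ground M \<inter> B' = B'" using base_subset[OF B'(1)] by blast
  then show ?thesis using B' card_bases_eq[OF B B'(1)] by simp
qed

section \<open>Restriction and contraction\<close>

lemma ground_restriction [simp]: "ground (restriction M F) = F"
  by (simp add: restriction_def)

lemma ground_contraction [simp]: "ground (contraction M F) = ground M - F"
  by (simp add: contraction_def)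

lemma bases_restriction: "bases (restriction M F) = {I. I \<subseteq> F \<and> indep M I \<and> card I = rank_of M F}"
proof
  show "bases (restriction M F) \<subseteq> {I. I \<subseteq> F \<and> indep M I \<and> card I = rank_of M F}"
    by (auto simp: restriction_def indep_def)
  show "{I. I \<subseteq> F \<and> indep M I \<and> card I = rank_of M F} \<subseteq> bases (restriction M F)"
  proof clarify
    fix I assume I: "I \<subseteq> F" "indep M I" "card I = rank_of M F"
    obtain B where B: "B \<in> bases M" "I \<subseteq> B" using I by (auto simp: indep_def)
    have "card (F \<inter> B) \<le> card I" using card_Int_le_rank[OF B(1), of F] I by simp
    moreover have "I \<subseteq> F \<inter> B" using I B by auto
    ultimately have "I = F \<inter> B" using finite_base[OF B(1)] by (metis card_seteq finite_Int)
    then show "I \<in> bases (restriction M F)" using B I by (auto simp: restriction_def)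
  qed
qed

lemma is_matroid_restriction:
  assumes F: "F \<subseteq> ground M"
  shows "is_matroid (restriction M F)"
  unfolding is_matroid_def
proof (intro conjI ballI)
  show "finite (ground (restriction M F))" using F finite_ground finite_subset by auto
  show "ground (restriction M F) \<subseteq> {1..}" using F M by (auto simp: is_matroid_def)
  have "indep M {}" using bases_nonempty by (auto simp: indep_def)
  then obtain J where "indep M J" "J \<subseteq> F" "card J = rank_of M F" using extend_to_rank[of "{}" F] by auto
  then show "bases (restriction M F) \<noteq> {}" unfolding bases_restriction by auto
  fix A assume A: "A \<in> bases (restriction M F)"
  then show "A \<subseteq> ground (restriction M F)" unfolding bases_restriction by simp
  fix B a assume B: "B \<in> bases (restriction M F)" and a: "a \<in> A - B"
  have A': "A \<subseteq> F" "indep M A" "card A = rank_of M F" and B': "B \<subseteq> F" "indep M B" "card B = rank_of M F"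
    using A B unfolding bases_restriction by auto
  have fin: "finite A" using A' indep_finite by blast
  have cA: "Suc (card (A - {a})) = card A" using a fin by (intro card_Suc_Diff1) auto
  obtain e where e: "e \<in> B - (A - {a})" "indep M (insert e (A - {a}))"
    using augment[of "A - {a}" B] indep_subset[OF A'(2)] B' cA A'(3) by auto
  have eA: "e \<in> B - A" using e a by auto
  then have "card (insert e (A - {a})) = rank_of M F" using fin cA A'(3) by (subst card_insert_disjoint) auto
  then have "insert e (A - {a}) \<in> bases (restriction M F)"
    unfolding bases_restriction using e A' B' by auto
  then show "\<exists>b\<in>B - A. insert b (A - {a}) \<in> bases (restriction M F)" using eA by blast
qed

text \<open>Only bases optimal for \<open>F\<close> survive in the restriction, but \<open>X\<close>
  and \<open>F\<close> are nested, so some base is optimal for both.\<close>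

lemma rank_restriction:
  assumes "X \<subseteq> F"
  shows "rank_of (restriction M F) X = rank_of M X"
proof -
  define S where "S = {B \<in> bases M. card (F \<inter> B) = rank_of M F}"
  have "bases (restriction M F) = (\<lambda>B. F \<inter> B) ` S" by (auto simp: restriction_def S_def)
  then have "rank_of (restriction M F) X = Max ((\<lambda>B. card (X \<inter> (F \<inter> B))) ` S)"
    by (simp add: rank_of_def image_image)
  also have "(\<lambda>B. card (X \<inter> (F \<inter> B))) ` S = (\<lambda>B. card (X \<inter> B)) ` S"
    using assms by (intro image_cong) (auto intro: arg_cong[where f = card])
  also have "Max \<dots> = rank_of M X"
  proof (rule Max_eqI)
    show "finite ((\<lambda>B. card (X \<inter> B)) ` S)" using finite_bases by (simp add: S_def)
    show "y \<le> rank_of M X" if "y \<in> (\<lambda>B. card (X \<inter> B)) ` S" for y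
      using that card_Int_le_rank by (auto simp: S_def)
    obtain B where B: "B \<in> bases M" "card (X \<inter> B) = rank_of M X" "card (F \<inter> B) = rank_of M F"
      using chain_basis2[OF assms] .
    then have "B \<in> S" by (simp add: S_def)
    then show "rank_of M X \<in> (\<lambda>B. card (X \<inter> B)) ` S" using B(2) by (metis imageI)
  qed
  finally show ?thesis .
qed

lemma bases_contraction: "bases (contraction M F) = (\<lambda>B. B - F) ` {B \<in> bases M. card (F \<inter> B) = rank_of M F}"
  by (auto simp: contraction_def)

lemma is_matroid_contraction: "is_matroid (contraction M F)"
  unfolding is_matroid_def
proof (intro conjI ballI)
  show "finite (ground (contraction M F))" using finite_ground by simp
  show "ground (contraction M F) \<subseteq> {1..}" using M by (auto simp: is_matroid_def)
  show "bases (contraction M F) \<noteq> {}"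
    unfolding bases_contraction using rank_witness[of F] by blast
  fix A assume A: "A \<in> bases (contraction M F)"
  then show "A \<subseteq> ground (contraction M F)" unfolding bases_contraction using base_subset by auto
  fix B a assume B: "B \<in> bases (contraction M F)" and a: "a \<in> A - B"
  obtain A' where A': "A' \<in> bases M" "card (F \<inter> A') = rank_of M F" "A = A' - F" using A unfolding bases_contraction by auto
  obtain B' where B': "B' \<in> bases M" "card (F \<inter> B') = rank_of M F" "B = B' - F" using B unfolding bases_contraction by auto
  have a': "a \<in> A'" "a \<notin> F" using a A' by auto
  have fin: "finite A'" using finite_base A' by blast
  have cA: "Suc (card (A' - {a})) = card A'" using a' fin by (intro card_Suc_Diff1) auto
  obtain e where e: "e \<in> B' - (A' - {a})" "indep M (insert e (A' - {a}))"
    using augment[of "A' - {a}" B'] indep_subset[OF indep_base[OF A'(1)], of "A' - {a}"] indep_base[OF B'(1)]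
      cA card_bases_eq[OF A'(1) B'(1)] by auto
  have ea: "e \<noteq> a" using e a B' a' by auto
  then have eA: "e \<in> B' - A'" using e by auto
  \<comment> \<open>An element of \<open>F\<close> would enlarge \<open>F \<inter> A'\<close> to an
    independent set above the rank of \<open>F\<close>. So the exchange happens off
    \<open>F\<close>, and the new base is still optimal for \<open>F\<close>.\<close>
  have nF: "e \<notin> F"
  proof
    assume eF: "e \<in> F"
    have "insert e (F \<inter> A') \<subseteq> insert e (A' - {a})" using a' by auto
    then have "indep M (insert e (F \<inter> A'))" using indep_subset[OF e(2)] by blast
    then have "card (insert e (F \<inter> A')) \<le> rank_of M F" using eF by (intro indep_card_le_rank) auto
    then show False using A'(2) eA fin by auto
  qed
  obtain D where D: "D \<in> bases M" "insert e (A' - {a}) \<subseteq> D" using e(2) by (auto simp: indep_def)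
  have "card (insert e (A' - {a})) = card D"
    using eA fin cA card_bases_eq[OF A'(1) D(1)] by (subst card_insert_disjoint) auto
  then have "insert e (A' - {a}) = D" using D finite_base[OF D(1)] by (metis card_subset_eq)
  then have base: "insert e (A' - {a}) \<in> bases M" using D by simp
  have "F \<inter> insert e (A' - {a}) = F \<inter> A'" using nF a' by auto
  then have "insert e (A' - {a}) - F \<in> bases (contraction M F)"
    unfolding bases_contraction using base A'(2) by (intro imageI) simp
  moreover have "insert e (A' - {a}) - F = insert e (A - {a})" using nF A' by auto
  ultimately show "\<exists>b\<in>B - A. insert b (A - {a}) \<in> bases (contraction M F)"
    using eA nF B' A' by (intro bexI[of _ e]) auto
qed

lemma rank_contraction:
  assumes "X \<inter> F = {}"
  shows "rank_of (contraction M F) X = rank_of M (X \<union> F) - rank_of M F"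
proof -
  define S where "S = {B \<in> bases M. card (F \<inter> B) = rank_of M F}"
  have "rank_of (contraction M F) X = Max ((\<lambda>B. card (X \<inter> (B - F))) ` S)"
    by (simp add: rank_of_def bases_contraction image_image S_def)
  also have "\<dots> = rank_of M (X \<union> F) - rank_of M F"
  proof (rule Max_eqI)
    have eq: "card (X \<inter> (B - F)) = card ((X \<union> F) \<inter> B) - rank_of M F" if "B \<in> S" for B
    proof -
      have fin: "finite B" using that finite_base by (simp add: S_def)
      have "(X \<union> F) \<inter> B = X \<inter> (B - F) \<union> F \<inter> B" using assms by auto
      moreover have "card (X \<inter> (B - F) \<union> F \<inter> B) = card (X \<inter> (B - F)) + card (F \<inter> B)"
        using fin by (intro card_Un_disjoint) auto
      ultimately show ?thesis using that by (simp add: S_def)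
    qed
    show "finite ((\<lambda>B. card (X \<inter> (B - F))) ` S)" using finite_bases by (simp add: S_def)
    show "y \<le> rank_of M (X \<union> F) - rank_of M F" if y: "y \<in> (\<lambda>B. card (X \<inter> (B - F))) ` S" for y
    proof -
      obtain B where "B \<in> S" "y = card (X \<inter> (B - F))" using y by blast
      then show ?thesis using eq card_Int_le_rank[of B "X \<union> F"] by (auto simp: S_def intro: diff_le_mono)
    qed
    obtain B where B: "B \<in> bases M" "card (F \<inter> B) = rank_of M F" "card ((X \<union> F) \<inter> B) = rank_of M (X \<union> F)"
      using chain_basis2[of F "X \<union> F"] by auto
    then have "B \<in> S" by (simp add: S_def)
    then show "rank_of M (X \<union> F) - rank_of M F \<in> (\<lambda>B. card (X \<inter> (B - F))) ` S"
      using eq B(3) by (metis imageI)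
  qed
  finally show ?thesis .
qed

lemma rk_contraction: "F \<subseteq> ground M \<Longrightarrow> rank_of (contraction M F) (ground M - F) = rk M - rank_of M F"
  by (subst rank_contraction) (auto simp: Un_absorb2 Diff_partition)

lemma loops_iff: "e \<in> loops M \<longleftrightarrow> e \<in> ground M \<and> rank_of M {e} = 0"
proof -
  have "rank_of M {e} = 0 \<longleftrightarrow> (\<forall>B\<in>bases M. e \<notin> B)"
  proof
    assume 0: "rank_of M {e} = 0"
    show "\<forall>B\<in>bases M. e \<notin> B"
    proof
      fix B assume "B \<in> bases M"
      then have "card ({e} \<inter> B) = 0" using card_Int_le_rank[of B "{e}"] 0 by simp
      then show "e \<notin> B" by auto
    qed
  next
    assume "\<forall>B\<in>bases M. e \<notin> B"
    then show "rank_of M {e} = 0" using rank_witness[of "{e}"] by (metis Int_insert_left_if0 Int_empty_left card.empty)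
  qed
  then show ?thesis by (auto simp: loops_def)
qed

lemma loopless_iff: "loopless M \<longleftrightarrow> (\<forall>e\<in>ground M. rank_of M {e} > 0)"
  unfolding loopless_def using loops_iff by (metis all_not_in_conv gr0I less_irrefl)

lemma loopless_rank_pos: "loopless M \<Longrightarrow> X \<subseteq> ground M \<Longrightarrow> X \<noteq> {} \<Longrightarrow> rank_of M X > 0"
  using loopless_iff rank_mono by (metis all_not_in_conv bot_least insert_subset less_le_trans subsetD)

section \<open>Flats\<close>

definition cl :: "nat set \<Rightarrow> nat set" where
  "cl X = {e \<in> ground M. rank_of M (insert e X) = rank_of M X}"

lemma flats_iff: "F \<in> flats M \<longleftrightarrow> F \<subseteq> ground M \<and> (\<forall>e\<in>ground M. rank_of M (insert e F) = rank_of M F \<longrightarrow> e \<in> F)"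
proof -
  have "rank_of M F < rank_of M (insert e F) \<longleftrightarrow> rank_of M (insert e F) \<noteq> rank_of M F" for e
    using rank_mono[of F "insert e F"] by (auto simp: order_less_le)
  then show ?thesis by (auto simp: flats_def)
qed

lemma finite_flats: "finite (flats M)"
  using finite_ground by (intro finite_subset[of "flats M" "Pow (ground M)"]) (auto simp: flats_def)

lemma flat_subset: "F \<in> flats M \<Longrightarrow> F \<subseteq> ground M"
  by (simp add: flats_def)

lemma ground_flat: "ground M \<in> flats M"
  by (simp add: flats_def)

lemma subset_cl: "X \<subseteq> ground M \<Longrightarrow> X \<subseteq> cl X"
  by (auto simp: cl_def insert_absorb)

lemma rank_cl:
  assumes "X \<subseteq> ground M"
  shows "rank_of M (cl X) = rank_of M X"
proof -
  have "rank_of M (X \<union> cl X) = rank_of M X"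
    using finite_ground by (intro rank_Un_absorb[of _ X]) (auto simp: cl_def)
  then show ?thesis using subset_cl[OF assms] by (simp add: Un_absorb1)
qed

lemma cl_flat:
  assumes X: "X \<subseteq> ground M"
  shows "cl X \<in> flats M"
  unfolding flats_iff
proof (intro conjI ballI impI)
  show "cl X \<subseteq> ground M" by (auto simp: cl_def)
  fix e assume e: "e \<in> ground M" "rank_of M (insert e (cl X)) = rank_of M (cl X)"
  have "rank_of M (insert e X) \<le> rank_of M (insert e (cl X))"
    using subset_cl[OF X] by (intro rank_mono) auto
  then have "rank_of M (insert e X) = rank_of M X"
    using e rank_cl[OF X] rank_mono[OF subset_insertI, of X e] by auto
  then show "e \<in> cl X" using e by (simp add: cl_def)
qed

lemma cl_least:
  assumes X: "X \<subseteq> F" and F: "F \<in> flats M"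
  shows "cl X \<subseteq> F"
proof
  fix e assume "e \<in> cl X"
  then have "e \<in> ground M" "rank_of M (insert e F) = rank_of M F"
    using X by (auto simp: cl_def intro: rank_insert_absorb_mono)
  then show "e \<in> F" using F by (auto simp: flats_iff)
qed

text \<open>The bridge from flats to arbitrary sets: the spanning subsets of a flat are the sets
  with that closure, so each set is counted for exactly one flat.\<close>

lemma flat_eq_cl_iff:
  assumes X: "X \<subseteq> ground M" and F: "F \<in> flats M"
  shows "F = cl X \<longleftrightarrow> X \<subseteq> F \<and> rank_of M X = rank_of M F"
proof
  assume "F = cl X"
  then show "X \<subseteq> F \<and> rank_of M X = rank_of M F" using subset_cl[OF X] rank_cl[OF X] by auto
next
  assume *: "X \<subseteq> F \<and> rank_of M X = rank_of M F"
  have "F \<subseteq> cl X"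
  proof
    fix e assume e: "e \<in> F"
    have "rank_of M (insert e X) \<le> rank_of M F" using * e by (intro rank_mono) auto
    then have "rank_of M (insert e X) = rank_of M X" using * rank_mono[OF subset_insertI, of X e] by auto
    then show "e \<in> cl X" using e flat_subset[OF F] by (auto simp: cl_def)
  qed
  then show "F = cl X" using cl_least[of X F] * F by blast
qed

lemma loopless_restriction:
  assumes "loopless M" "F \<subseteq> ground M"
  shows "loopless (restriction M F)"
proof -
  interpret R: valid_matroid "restriction M F" using is_matroid_restriction[OF assms(2)] by unfold_locales
  show ?thesis using assms rank_restriction by (auto simp: R.loopless_iff loopless_iff)
qed

end

section \<open>Alternating sums over Boolean intervals\<close>

lemma finite_set_interval: "finite B \<Longrightarrow> finite {A..B::'a set}"
  by (rule finite_subset[of _ "Pow B"]) auto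

text \<open>Adding or removing \<open>e\<close> is a sign-reversing involution of the
  interval.\<close>

lemma sum_toggle_zero:
  fixes g :: "'a set \<Rightarrow> 'b::ab_group_add"
  assumes B: "finite B" and e: "e \<in> B - A"
    and g: "\<And>X. A \<subseteq> X \<Longrightarrow> X \<subseteq> B - {e} \<Longrightarrow> g (insert e X) = - g X"
  shows "sum g {A..B} = 0"
proof -
  let ?S = "{A..B - {e}}"
  have split: "{A..B} = ?S \<union> insert e ` ?S"
  proof
    show "{A..B} \<subseteq> ?S \<union> insert e ` ?S"
    proof
      fix X assume X: "X \<in> {A..B}"
      show "X \<in> ?S \<union> insert e ` ?S"
      proof (cases "e \<in> X")
        case True
        then have "X = insert e (X - {e})" "X - {e} \<in> ?S" using X e by auto
        then show ?thesis by blast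
      qed (use X in auto)
    qed
  qed (use e in auto)
  have "inj_on (insert e) ?S" by (intro inj_onI) auto
  then have "sum g (insert e ` ?S) = (\<Sum>X\<in>?S. g (insert e X))" by (simp add: sum.reindex)
  also have "\<dots> = - sum g ?S" unfolding sum_negf[symmetric] by (intro sum.cong) (auto intro: g)
  finally show ?thesis
    unfolding split using B finite_set_interval[of "B - {e}" A] by (subst sum.union_disjoint) auto
qed

lemma alternating_sum_above:
  assumes "finite B" "A \<subseteq> B"
  shows "(\<Sum>X\<in>{A..B}. (-1) ^ card (X - A)) = (of_bool (A = B) :: 'b::comm_ring_1)"
proof (cases "A = B")
  case False
  then obtain e where e: "e \<in> B - A" using assms by blast
  have "(\<Sum>X\<in>{A..B}. (-1) ^ card (X - A)) = (0::'b)"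
  proof (rule sum_toggle_zero[OF assms(1) e])
    fix X assume X: "A \<subseteq> X" "X \<subseteq> B - {e}"
    have "finite X" using X assms(1) finite_subset by blast
    moreover have "insert e X - A = insert e (X - A)" using e by auto
    ultimately show "(-1) ^ card (insert e X - A) = - ((-1) ^ card (X - A) :: 'b)" using X by (simp add: card_insert_if) blast
  qed
  then show ?thesis using False by simp
qed simp

lemma alternating_sum_below:
  assumes "finite B" "A \<subseteq> B"
  shows "(\<Sum>X\<in>{A..B}. (-1) ^ card (B - X)) = (of_bool (A = B) :: 'b::comm_ring_1)"
proof (cases "A = B")
  case False
  then obtain e where e: "e \<in> B - A" using assms by blast
  have "(\<Sum>X\<in>{A..B}. (-1) ^ card (B - X)) = (0::'b)"
  proof (rule sum_toggle_zero[OF assms(1) e])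
    fix X assume X: "A \<subseteq> X" "X \<subseteq> B - {e}"
    have "B - X = insert e (B - insert e X)" using e X by auto
    then have "card (B - X) = Suc (card (B - insert e X))" using assms(1) by (metis Diff_iff card_insert_disjoint finite_Diff insertI1)
    then show "(-1) ^ card (B - insert e X) = - ((-1) ^ card (B - X) :: 'b)" by simp
  qed
  then show ?thesis using False by simp
qed simp

section \<open>Kazhdan-Lusztig-Stanley polynomials of a rank function\<close>

text \<open>All sums run over Boolean intervals instead of intervals of flats. If \<open>\<rho>\<close> is the rank function
  of a loopless matroid, \<open>bkern \<rho> F B\<close> is \<open>t\<^bsup>rk\<^esup> \<chi>(1/t)\<close> of the minor on \<open>B - F\<close> when \<open>F\<close> is a flat
  of the restriction to \<open>B\<close>, and it vanishes otherwise.\<close>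

definition bkern :: "('a set \<Rightarrow> nat) \<Rightarrow> 'a set \<Rightarrow> 'a set \<Rightarrow> real poly" where
  "bkern \<rho> F B = (\<Sum>X\<in>{F..B}. monom ((-1) ^ card (X - F)) (\<rho> X - \<rho> F))"

text \<open>The reversal of \<open>bkern\<close> (see \<open>bkern_reverse\<close>): when
  \<open>F\<close> is a flat of the restriction to \<open>B\<close>, the characteristic polynomial
  of the minor itself.\<close>

definition ckern :: "('a set \<Rightarrow> nat) \<Rightarrow> 'a set \<Rightarrow> 'a set \<Rightarrow> real poly" where
  "ckern \<rho> F B = (\<Sum>X\<in>{F..B}. monom ((-1) ^ card (X - F)) (\<rho> B - \<rho> X))"

text \<open>\<open>qhat \<rho> B\<close> is \<open>(-1)\<^bsup>rk\<^esup> Q\<close> of the restriction to \<open>B\<close>; the cutoff keeps the coefficients of degree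
  less than \<open>\<rho> B / 2\<close>.\<close>

function qhat :: "('a set \<Rightarrow> nat) \<Rightarrow> 'a set \<Rightarrow> real poly" where
  "qhat \<rho> B = (if finite B \<and> B \<noteq> {}
     then - poly_cutoff ((\<rho> B + 1) div 2) (\<Sum>F\<in>{F. F \<subset> B}. qhat \<rho> F * bkern \<rho> F B) else 1)"
  by pat_completeness auto
termination
  by (relation "Wellfounded.measure (\<lambda>(\<rho>, B). card B)") (auto intro: psubset_card_mono)

declare qhat.simps [simp del]

lemma qhat_empty [simp]: "qhat \<rho> {} = 1"
  by (simp add: qhat.simps)

text \<open>The inner sum is Whitney's formula for the Moebius invariant of the contraction by
  \<open>F\<close>, a signed count of the spanning sets above \<open>F\<close>. It vanishes at
  nonflats, so \<open>F\<close> may run over all subsets.\<close>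

definition ypoly :: "('a set \<Rightarrow> nat) \<Rightarrow> 'a set \<Rightarrow> real poly" where
  "ypoly \<rho> B = (-1) ^ \<rho> B * (\<Sum>F\<in>Pow B. qhat \<rho> F *
     monom (\<Sum>X\<in>{F..B}. of_bool (\<rho> X = \<rho> B) * (-1) ^ card (X - F)) (\<rho> B - \<rho> F))"

section \<open>Invariance under relabelling\<close>

lemma bij_betw_image_interval:
  assumes "inj_on f B" "F \<subseteq> B"
  shows "bij_betw (image f) {F..B} {f ` F..f ` B}"
proof (rule bij_betwI')
  fix X Y assume "X \<in> {F..B}" "Y \<in> {F..B}"
  then show "f ` X = f ` Y \<longleftrightarrow> X = Y" using inj_on_image_eq_iff[OF assms(1)] by auto
next
  fix Y assume Y: "Y \<in> {f ` F..f ` B}"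
  then obtain X where X: "X \<subseteq> B" "Y = f ` X" by (auto simp: subset_image_iff)
  have "F \<subseteq> X" using Y X assms(2) inj_on_image_subset_iff[OF assms(1)] by auto
  then show "\<exists>X\<in>{F..B}. Y = f ` X" using X by auto
qed auto

lemma card_image_Diff:
  assumes "inj_on f B" "F \<subseteq> B" "X \<subseteq> B"
  shows "card (f ` X - f ` F) = card (X - F)"
proof -
  have "f ` X - f ` F = f ` (X - F)" using assms by (metis inj_on_image_set_diff Diff_subset inj_on_subset dual_order.trans)
  moreover have "inj_on f (X - F)" using assms by (meson Diff_subset inj_on_subset dual_order.trans)
  ultimately show ?thesis by (simp add: card_image)
qed

lemma bkern_image:
  assumes f: "inj_on f B" and eq: "\<And>X. X \<subseteq> B \<Longrightarrow> \<rho>' (f ` X) = \<rho> X" and F: "F \<subseteq> B"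
  shows "bkern \<rho>' (f ` F) (f ` B) = bkern \<rho> F B"
  unfolding bkern_def sum.reindex_bij_betw[OF bij_betw_image_interval[OF f F], symmetric]
  using F by (intro sum.cong) (auto simp: eq card_image_Diff[OF f])

text \<open>The recursion sees only ranks of subsets of \<open>B\<close>. With \<open>f = id\<close>
  this is locality, used for restrictions; with a general \<open>f\<close> it serves
  isomorphisms.\<close>

lemma qhat_image:
  assumes "inj_on f B" "\<And>X. X \<subseteq> B \<Longrightarrow> \<rho>' (f ` X) = \<rho> X"
  shows "qhat \<rho>' (f ` B) = qhat \<rho> B"
  using assms
proof (induction "card B" arbitrary: B rule: less_induct)
  case less
  note f = less.prems(1) and eq = less.prems(2)
  show ?case
  proof (cases "finite B \<and> B \<noteq> {}")
    case True
    have bij: "bij_betw (image f) {F. F \<subset> B} {F. F \<subset> f ` B}"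
    proof -
      have "bij_betw (image f) (Pow B - {B}) (Pow (f ` B) - {f ` B})"
        using bij_betw_DiffI[OF bij_betw_Pow[OF inj_on_imp_bij_betw[OF f]], of "{B}" "{f ` B}"] by (auto simp: bij_betw_def)
      moreover have "Pow B - {B} = {F. F \<subset> B}" "Pow (f ` B) - {f ` B} = {F. F \<subset> f ` B}" by auto
      ultimately show ?thesis by simp
    qed
    have "(\<Sum>F\<in>{F. F \<subset> f ` B}. qhat \<rho>' F * bkern \<rho>' F (f ` B)) = (\<Sum>F\<in>{F. F \<subset> B}. qhat \<rho>' (f ` F) * bkern \<rho>' (f ` F) (f ` B))"
      by (rule sum.reindex_bij_betw[OF bij, symmetric])
    also have "\<dots> = (\<Sum>F\<in>{F. F \<subset> B}. qhat \<rho> F * bkern \<rho> F B)"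
    proof (rule sum.cong[OF refl])
      fix F assume "F \<in> {F. F \<subset> B}"
      then have F: "F \<subset> B" by simp
      have "qhat \<rho>' (f ` F) = qhat \<rho> F"
      proof (rule less.hyps)
        show "card F < card B" using F True by (simp add: psubset_card_mono)
        show "inj_on f F" using f F by (meson inj_on_subset psubset_imp_subset)
        show "\<rho>' (f ` X) = \<rho> X" if "X \<subseteq> F" for X using eq F that by auto
      qed
      then show "qhat \<rho>' (f ` F) * bkern \<rho>' (f ` F) (f ` B) = qhat \<rho> F * bkern \<rho> F B"
        using bkern_image[of f B \<rho>' \<rho> F] f eq F by auto
    qed
    finally show ?thesis using True eq by (subst (1 2) qhat.simps) simp
  next
    case False
    then have "\<not> (finite (f ` B) \<and> f ` B \<noteq> {})" using f finite_image_iff by blast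
    then show ?thesis using False by (subst (1 2) qhat.simps) auto
  qed
qed

lemma ypoly_image:
  assumes f: "inj_on f B" and eq: "\<And>X. X \<subseteq> B \<Longrightarrow> \<rho>' (f ` X) = \<rho> X"
  shows "ypoly \<rho>' (f ` B) = ypoly \<rho> B"
proof -
  have bij: "bij_betw (image f) (Pow B) (Pow (f ` B))" by (rule bij_betw_Pow[OF inj_on_imp_bij_betw[OF f]])
  have mob: "(\<Sum>X\<in>{f ` F..f ` B}. of_bool (\<rho>' X = \<rho>' (f ` B)) * (-1) ^ card (X - f ` F))
    = (\<Sum>X\<in>{F..B}. of_bool (\<rho> X = \<rho> B) * (-1) ^ card (X - F) :: real)" if F: "F \<subseteq> B" for F
    unfolding sum.reindex_bij_betw[OF bij_betw_image_interval[OF f F], symmetric]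
    using F by (intro sum.cong) (auto simp: eq card_image_Diff[OF f])
  have q: "qhat \<rho>' (f ` F) = qhat \<rho> F" if "F \<subseteq> B" for F
    using that f eq by (intro qhat_image) (auto intro: inj_on_subset)
  show ?thesis
    unfolding ypoly_def sum.reindex_bij_betw[OF bij, symmetric]
    by (intro arg_cong2[where f = "(*)"] sum.cong) (auto simp: eq mob[unfolded eq[OF order_refl]] q)
qed

lemma qhat_cong: "(\<And>X. X \<subseteq> B \<Longrightarrow> \<rho>' X = \<rho> X) \<Longrightarrow> qhat \<rho>' B = qhat \<rho> B"
  using qhat_image[of id B \<rho>' \<rho>] by simp

lemma ypoly_cong: "(\<And>X. X \<subseteq> B \<Longrightarrow> \<rho>' X = \<rho> X) \<Longrightarrow> ypoly \<rho>' B = ypoly \<rho> B"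
  using ypoly_image[of id B \<rho>' \<rho>] by simp

section \<open>Reversal of polynomials\<close>

lemma poly_eq_if_eq_nonzero:
  fixes p q :: "real poly"
  assumes "\<And>t. t \<noteq> 0 \<Longrightarrow> poly p t = poly q t"
  shows "p = q"
proof (rule ccontr)
  assume "p \<noteq> q"
  then have "finite {t. poly (p - q) t = 0}" by (intro poly_roots_finite) simp
  moreover have "UNIV - {0} \<subseteq> {t. poly (p - q) t = 0}" using assms by auto
  ultimately have "finite (UNIV - {0::real})" by (rule finite_subset[rotated])
  then show False using infinite_UNIV_char_0 by auto
qed

definition rev_poly :: "nat \<Rightarrow> real poly \<Rightarrow> real poly" where
  "rev_poly r p = (\<Sum>i\<le>r. monom (coeff p (r - i)) i)"

lemma coeff_rev_poly: "coeff (rev_poly r p) i = (if i \<le> r then coeff p (r - i) else 0)"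
  by (simp add: rev_poly_def coeff_sum if_distrib sum.delta cong: if_cong)

lemma poly_rev_poly:
  assumes "degree p \<le> r" "t \<noteq> 0"
  shows "poly (rev_poly r p) t = t ^ r * poly p (1 / t)"
proof -
  have "poly (rev_poly r p) t = (\<Sum>i\<le>r. coeff p (r - i) * t ^ i)"
    by (simp add: rev_poly_def poly_sum poly_monom)
  also have "\<dots> = (\<Sum>i\<le>r. coeff p i * t ^ (r - i))"
    by (rule sum.reindex_bij_witness[of _ "\<lambda>i. r - i" "\<lambda>i. r - i"]) auto
  also have "\<dots> = (\<Sum>i\<le>r. t ^ r * (coeff p i * (1 / t) ^ i))"
    using assms(2) by (intro sum.cong) (auto simp: power_diff field_simps)
  also have "\<dots> = t ^ r * (\<Sum>i\<le>r. coeff p i * (1 / t) ^ i)" by (simp add: sum_distrib_left)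
  also have "(\<Sum>i\<le>r. coeff p i * (1 / t) ^ i) = poly p (1 / t)"
    unfolding poly_altdef using assms(1) by (intro sum.mono_neutral_right) (auto intro: coeff_eq_0)
  finally show ?thesis .
qed

text \<open>In \<open>A\<close> the coefficients at \<open>i\<close> and \<open>r - i\<close> are
  opposite and a middle one is zero. So negating the low half and reversing it reproduces the high
  half of \<open>A\<close>, which is all that is left in \<open>q + A\<close>.\<close>

lemma antipalindromic_split:
  fixes A :: "real poly"
  assumes deg: "degree A \<le> r" and anti: "\<And>t. t \<noteq> 0 \<Longrightarrow> t ^ r * poly A (1 / t) = - poly A t"
    and t: "t \<noteq> 0"
  defines "q \<equiv> - poly_cutoff ((r + 1) div 2) A"
  shows "t ^ r * poly q (1 / t) = poly q t + poly A t"
proof -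
  have "rev_poly r A = - A"
    by (rule poly_eq_if_eq_nonzero) (simp add: poly_rev_poly[OF deg] anti)
  then have sym: "coeff A (r - i) = - coeff A i" if "i \<le> r" for i
    using that by (metis coeff_rev_poly coeff_minus)
  have "degree q \<le> r"
    unfolding q_def by (intro degree_le) (auto simp: coeff_poly_cutoff)
  moreover have "rev_poly r q = q + A"
  proof (rule poly_eqI)
    fix i
    consider "i > r" | "i \<le> r" "2 * i < r" | "i \<le> r" "2 * i = r" | "i \<le> r" "2 * i > r" by linarith
    then show "coeff (rev_poly r q) i = coeff (q + A) i"
    proof cases
      case 1
      then have "coeff A i = 0" using deg by (intro coeff_eq_0) simp
      then show ?thesis using 1 by (simp add: coeff_rev_poly q_def coeff_poly_cutoff)
    next
      case 3
      then have "r - i = i" by simp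
      then have "coeff A i = 0" using sym[of i] 3 by simp
      then show ?thesis using 3 \<open>r - i = i\<close> by (auto simp: coeff_rev_poly q_def coeff_poly_cutoff)
    qed (auto simp: coeff_rev_poly q_def coeff_poly_cutoff sym)
  qed
  ultimately show ?thesis using poly_rev_poly[of q r t] t by simp
qed

section \<open>The kernel and the reversal identity\<close>

locale rank_function =
  fixes \<rho> :: "'a set \<Rightarrow> nat"
  assumes mono: "X \<subseteq> Y \<Longrightarrow> \<rho> X \<le> \<rho> Y" and empty [simp]: "\<rho> {} = 0"
begin

lemma poly_bkern: "poly (bkern \<rho> F B) t = (\<Sum>X\<in>{F..B}. (-1) ^ card (X - F) * t ^ (\<rho> X - \<rho> F))"
  by (simp add: bkern_def poly_sum poly_monom)

lemma poly_ckern: "poly (ckern \<rho> F B) t = (\<Sum>X\<in>{F..B}. (-1) ^ card (X - F) * t ^ (\<rho> B - \<rho> X))"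
  by (simp add: ckern_def poly_sum poly_monom)

lemma bkern_self [simp]: "bkern \<rho> B B = 1" "ckern \<rho> B B = 1"
  by (simp_all add: bkern_def ckern_def)

lemma degree_bkern: "degree (bkern \<rho> F B) \<le> \<rho> B - \<rho> F"
proof (cases "finite {F..B}")
  case True
  show ?thesis unfolding bkern_def
    by (intro degree_sum_le[OF True] order.trans[OF degree_monom_le] diff_le_mono mono) auto
qed (simp add: bkern_def)

lemma bkern_reverse:
  assumes "t \<noteq> 0"
  shows "t ^ (\<rho> B - \<rho> F) * poly (bkern \<rho> F B) (1 / t) = poly (ckern \<rho> F B) t"
  unfolding poly_bkern poly_ckern sum_distrib_left
proof (rule sum.cong[OF refl])
  fix X assume "X \<in> {F..B}"
  then have "\<rho> F \<le> \<rho> X" "\<rho> X \<le> \<rho> B" using mono by auto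
  \<comment> \<open>Subtraction of ranks is truncated; monotonicity makes the exponents add
    up.\<close>
  then have "t ^ (\<rho> B - \<rho> F) = t ^ (\<rho> B - \<rho> X) * t ^ (\<rho> X - \<rho> F)" by (simp add: power_add[symmetric])
  then show "t ^ (\<rho> B - \<rho> F) * ((-1) ^ card (X - F) * (1 / t) ^ (\<rho> X - \<rho> F)) = (-1) ^ card (X - F) * t ^ (\<rho> B - \<rho> X)"
    using assms by (simp add: power_divide)
qed

text \<open>The kernel is inverse to its reversal, which is what lets an inverse polynomial exist.
  Expanded, the sum runs over nested \<open>X\<close>, \<open>G\<close>, \<open>Z\<close>; summing
  over \<open>G\<close> forces \<open>X = Z\<close>, the exponents combine to one fixed power, and
  an alternating sum over the interval from \<open>F\<close> to \<open>B\<close> remains.\<close>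

lemma kernel_identity:
  assumes B: "finite B" and F: "F \<subseteq> B"
  shows "(\<Sum>G\<in>{F..B}. poly (bkern \<rho> F G) t * poly (ckern \<rho> G B) t) = of_bool (F = B)"
proof -
  let ?I = "{F..B}"
  have fin: "finite ?I" using B by (rule finite_set_interval)
  define u where "u X = (-1) ^ card (X - F) * t ^ (\<rho> X - \<rho> F)" for X
  \<comment> \<open>All intervals are enlarged to the one index set \<open>?I\<close>, with
    indicators, so that summations can be exchanged.\<close>
  have b: "poly (bkern \<rho> F G) t = (\<Sum>X\<in>?I. of_bool (X \<subseteq> G) * u X)" if "G \<in> ?I" for G
    unfolding poly_bkern u_def using that fin by (intro sum.mono_neutral_cong_left) auto
  have c: "poly (ckern \<rho> G B) t = (\<Sum>Z\<in>?I. of_bool (G \<subseteq> Z) * (-1) ^ card (Z - G) * t ^ (\<rho> B - \<rho> Z))"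
    if "G \<in> ?I" for G
    unfolding poly_ckern using that fin by (intro sum.mono_neutral_cong_left) auto
  have inner: "(\<Sum>G\<in>?I. of_bool (X \<subseteq> G) * (of_bool (G \<subseteq> Z) * (-1) ^ card (Z - G))) = (of_bool (X = Z) :: real)"
    if X: "X \<in> ?I" and Z: "Z \<in> ?I" for X Z
  proof (cases "X \<subseteq> Z")
    case True
    have "(\<Sum>G\<in>?I. of_bool (X \<subseteq> G) * (of_bool (G \<subseteq> Z) * (-1) ^ card (Z - G))) = (\<Sum>G\<in>{X..Z}. (-1) ^ card (Z - G) :: real)"
      using X Z fin by (intro sum.mono_neutral_cong_right) auto
    also have "\<dots> = of_bool (X = Z)"
      using True Z B by (intro alternating_sum_below) (auto intro: finite_subset)
    finally show ?thesis .
  next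
    case False
    then have "of_bool (X \<subseteq> G) * (of_bool (G \<subseteq> Z) * (-1) ^ card (Z - G)) = (0::real)" for G by auto
    then have "(\<Sum>G\<in>?I. of_bool (X \<subseteq> G) * (of_bool (G \<subseteq> Z) * (-1) ^ card (Z - G))) = (0::real)"
      by (intro sum.neutral) blast
    moreover have "X \<noteq> Z" using False by blast
    ultimately show ?thesis by simp
  qed
  have "(\<Sum>G\<in>?I. poly (bkern \<rho> F G) t * poly (ckern \<rho> G B) t)
    = (\<Sum>G\<in>?I. (\<Sum>X\<in>?I. of_bool (X \<subseteq> G) * u X) * (\<Sum>Z\<in>?I. of_bool (G \<subseteq> Z) * (-1) ^ card (Z - G) * t ^ (\<rho> B - \<rho> Z)))"
    using b c by (intro sum.cong) auto
  also have "\<dots> = (\<Sum>G\<in>?I. \<Sum>X\<in>?I. \<Sum>Z\<in>?I. u X * t ^ (\<rho> B - \<rho> Z) *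
      (of_bool (X \<subseteq> G) * (of_bool (G \<subseteq> Z) * (-1) ^ card (Z - G))))"
    unfolding sum_product by (intro sum.cong refl) (simp add: mult_ac)
  also have "\<dots> = (\<Sum>X\<in>?I. \<Sum>Z\<in>?I. \<Sum>G\<in>?I. u X * t ^ (\<rho> B - \<rho> Z) *
      (of_bool (X \<subseteq> G) * (of_bool (G \<subseteq> Z) * (-1) ^ card (Z - G))))"
    by (subst sum.swap, rule sum.cong[OF refl], rule sum.swap)
  also have "\<dots> = (\<Sum>X\<in>?I. \<Sum>Z\<in>?I. u X * t ^ (\<rho> B - \<rho> Z) * of_bool (X = Z))"
    by (intro sum.cong refl) (simp add: sum_distrib_left[symmetric] inner)
  also have "\<dots> = (\<Sum>X\<in>?I. u X * t ^ (\<rho> B - \<rho> X))"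
    using fin by (intro sum.cong refl) (simp add: of_bool_def if_distrib sum.delta' cong: if_cong)
  also have "\<dots> = (\<Sum>X\<in>?I. (-1) ^ card (X - F) * t ^ (\<rho> B - \<rho> F))"
  proof (rule sum.cong[OF refl])
    fix X assume "X \<in> ?I"
    then have "\<rho> F \<le> \<rho> X" "\<rho> X \<le> \<rho> B" using mono by auto
    then show "u X * t ^ (\<rho> B - \<rho> X) = (-1) ^ card (X - F) * t ^ (\<rho> B - \<rho> F)"
      by (simp add: u_def power_add[symmetric])
  qed
  also have "\<dots> = of_bool (F = B)"
    by (simp add: sum_distrib_right[symmetric] alternating_sum_above[OF B F])
  finally show ?thesis .
qed

lemma coeff_qhat:
  assumes "finite B" "B \<noteq> {}" "\<not> 2 * i < \<rho> B"
  shows "coeff (qhat \<rho> B) i = 0"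
  using assms by (subst qhat.simps) (auto simp: coeff_poly_cutoff)

lemma degree_qhat: "finite B \<Longrightarrow> degree (qhat \<rho> B) \<le> \<rho> B"
  by (cases "B = {}") (auto intro!: degree_le coeff_qhat)

lemma degree_qhat_less:
  assumes "finite B" "\<rho> B > 0"
  shows "2 * degree (qhat \<rho> B) < \<rho> B"
proof (rule ccontr)
  assume not: "\<not> 2 * degree (qhat \<rho> B) < \<rho> B"
  moreover have "B \<noteq> {}" using assms by auto
  ultimately have "lead_coeff (qhat \<rho> B) = 0" using coeff_qhat[OF assms(1)] by blast
  then show False using not assms by simp
qed

text \<open>Let \<open>A\<close> be the part of the right side with \<open>F \<noteq> B\<close>. By
  induction and \<open>kernel_identity\<close> it is antipalindromic, so its negated low half, which
  is \<open>qhat \<rho> B\<close>, solves the equation by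
  \<open>antipalindromic_split\<close>.\<close>

theorem qhat_identity:
  assumes "finite B" "t \<noteq> 0"
  shows "t ^ \<rho> B * poly (qhat \<rho> B) (1 / t) = (\<Sum>F\<in>Pow B. poly (qhat \<rho> F) t * poly (bkern \<rho> F B) t)"
  using assms
proof (induction "card B" arbitrary: B t rule: less_induct)
  case less
  note B = less.prems(1)
  show ?case
  proof (cases "B = {}")
    case False
    define A where "A = (\<Sum>F\<in>{F. F \<subset> B}. qhat \<rho> F * bkern \<rho> F B)"
    have q: "qhat \<rho> B = - poly_cutoff ((\<rho> B + 1) div 2) A"
      using B False by (subst qhat.simps) (simp add: A_def)
    have fin: "finite {F. F \<subset> B}" by (rule finite_subset[of _ "Pow B"]) (use B in auto)
    have finF: "finite F" if "F \<subset> B" for F using B that finite_subset by blast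
    have deg: "degree A \<le> \<rho> B"
      unfolding A_def
    proof (intro degree_sum_le[OF fin])
      fix F assume "F \<in> {F. F \<subset> B}"
      then have F: "F \<subset> B" by simp
      have "degree (qhat \<rho> F * bkern \<rho> F B) \<le> \<rho> F + (\<rho> B - \<rho> F)"
        by (intro order.trans[OF degree_mult_le] add_mono degree_qhat degree_bkern finF[OF F])
      then show "degree (qhat \<rho> F * bkern \<rho> F B) \<le> \<rho> B" using mono[of F B] F by auto
    qed
    have anti: "t ^ \<rho> B * poly A (1 / t) = - poly A t" if t: "t \<noteq> 0" for t
    proof -
      have "t ^ \<rho> B * poly A (1 / t) = (\<Sum>G\<in>{F. F \<subset> B}. (t ^ \<rho> G * poly (qhat \<rho> G) (1 / t)) * (t ^ (\<rho> B - \<rho> G) * poly (bkern \<rho> G B) (1 / t)))"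
        unfolding A_def poly_sum sum_distrib_left
      proof (rule sum.cong[OF refl])
        fix G assume "G \<in> {F. F \<subset> B}"
        then have "\<rho> G \<le> \<rho> B" using mono by auto
        then have "t ^ \<rho> B = t ^ \<rho> G * t ^ (\<rho> B - \<rho> G)" by (simp add: power_add[symmetric])
        then show "t ^ \<rho> B * poly (qhat \<rho> G * bkern \<rho> G B) (1 / t)
          = (t ^ \<rho> G * poly (qhat \<rho> G) (1 / t)) * (t ^ (\<rho> B - \<rho> G) * poly (bkern \<rho> G B) (1 / t))"
          by (simp add: mult_ac)
      qed
      also have "\<dots> = (\<Sum>G\<in>{F. F \<subset> B}. (\<Sum>F\<in>{F. F \<subset> B}. of_bool (F \<subseteq> G) * (poly (qhat \<rho> F) t * poly (bkern \<rho> F G) t)) * poly (ckern \<rho> G B) t)"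
      proof (rule sum.cong[OF refl])
        fix G assume "G \<in> {F. F \<subset> B}"
        then have G: "G \<subset> B" by simp
        have "t ^ \<rho> G * poly (qhat \<rho> G) (1 / t) = (\<Sum>F\<in>Pow G. poly (qhat \<rho> F) t * poly (bkern \<rho> F G) t)"
          by (rule less.hyps[OF psubset_card_mono[OF B G] finF[OF G] t])
        also have "\<dots> = (\<Sum>F\<in>{F. F \<subset> B}. of_bool (F \<subseteq> G) * (poly (qhat \<rho> F) t * poly (bkern \<rho> F G) t))"
          using fin G by (intro sum.mono_neutral_cong_left) auto
        finally show "t ^ \<rho> G * poly (qhat \<rho> G) (1 / t) * (t ^ (\<rho> B - \<rho> G) * poly (bkern \<rho> G B) (1 / t))
          = (\<Sum>F\<in>{F. F \<subset> B}. of_bool (F \<subseteq> G) * (poly (qhat \<rho> F) t * poly (bkern \<rho> F G) t)) * poly (ckern \<rho> G B) t"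
          using bkern_reverse[OF t] by simp
      qed
      also have "\<dots> = (\<Sum>F\<in>{F. F \<subset> B}. poly (qhat \<rho> F) t * (\<Sum>G\<in>{F. F \<subset> B}. of_bool (F \<subseteq> G) * (poly (bkern \<rho> F G) t * poly (ckern \<rho> G B) t)))"
        unfolding sum_distrib_left sum_distrib_right
        by (subst sum.swap) (intro sum.cong refl, simp add: mult_ac)
      \<comment> \<open>The sum over \<open>G\<close> omits only \<open>B\<close> from
        \<open>kernel_identity\<close>, whose right side is zero as \<open>F \<noteq> B\<close>; the
        missing term is \<open>bkern \<rho> F B\<close>.\<close>
      also have "\<dots> = (\<Sum>F\<in>{F. F \<subset> B}. poly (qhat \<rho> F) t * (- poly (bkern \<rho> F B) t))"
      proof (intro sum.cong refl arg_cong2[where f = "(*)"])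
        fix F assume "F \<in> {F. F \<subset> B}"
        then have F: "F \<subset> B" by simp
        have "(\<Sum>G\<in>{F. F \<subset> B}. of_bool (F \<subseteq> G) * (poly (bkern \<rho> F G) t * poly (ckern \<rho> G B) t))
          = (\<Sum>G\<in>{F..B} - {B}. poly (bkern \<rho> F G) t * poly (ckern \<rho> G B) t)"
          using fin by (intro sum.mono_neutral_cong_right) auto
        also have "\<dots> = (\<Sum>G\<in>{F..B}. poly (bkern \<rho> F G) t * poly (ckern \<rho> G B) t) - poly (bkern \<rho> F B) t"
          using F by (subst sum_diff1) (auto simp: finite_set_interval B)
        also have "\<dots> = - poly (bkern \<rho> F B) t" using kernel_identity[OF B, of F] F by auto
        finally show "(\<Sum>G\<in>{F. F \<subset> B}. of_bool (F \<subseteq> G) * (poly (bkern \<rho> F G) t * poly (ckern \<rho> G B) t)) = - poly (bkern \<rho> F B) t" .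
      qed
      also have "\<dots> = - poly A t" by (simp add: A_def poly_sum sum_negf)
      finally show ?thesis .
    qed
    have "Pow B = insert B {F. F \<subset> B}" by auto
    then have "(\<Sum>F\<in>Pow B. poly (qhat \<rho> F) t * poly (bkern \<rho> F B) t) = poly (qhat \<rho> B) t + poly A t"
      using fin by (simp add: A_def poly_sum)
    then show ?thesis
      using antipalindromic_split[OF deg anti less.prems(2)] unfolding q by simp
  qed simp
qed

end

section \<open>Functions of ranks along chains\<close>

definition depends_on :: "'a set \<Rightarrow> (('a \<Rightarrow> 'b) \<Rightarrow> 'c) \<Rightarrow> bool" where
  "depends_on C g \<longleftrightarrow> (\<forall>\<rho> \<rho>'. (\<forall>X\<in>C. \<rho> X = \<rho>' X) \<longrightarrow> g \<rho> = g \<rho>')"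

lemma poly_cutoff_add: "poly_cutoff k (p + q) = poly_cutoff k p + poly_cutoff k (q :: 'a::comm_monoid_add poly)"
  by (rule poly_eqI) (simp add: coeff_poly_cutoff)

lemma smult_sum_right: "smult a (\<Sum>k\<in>K. h k) = (\<Sum>k\<in>K. smult a (h k))"
  by (induction K rule: infinite_finite_induct) (simp_all add: smult_add_right)

text \<open>A weighted family of rank functions, in the application one for the polytope and one per
  interior cell, that cancels on chain indicators; the aim is the same cancellation for
  \<open>ypoly\<close>. The bound leaves finitely many rank profiles on a chain.\<close>

locale chain_relation =
  fixes I :: "'i set" and c :: "'i \<Rightarrow> real" and \<rho> :: "'i \<Rightarrow> 'a set \<Rightarrow> nat" and E :: "'a set"
  assumes fin_I: "finite I" and fin_E: "finite E"
    and bound: "i \<in> I \<Longrightarrow> X \<subseteq> E \<Longrightarrow> \<rho> i X \<le> card X"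
    and relation: "C \<subseteq> Pow E \<Longrightarrow> (\<And>X Y. X \<in> C \<Longrightarrow> Y \<in> C \<Longrightarrow> X \<subseteq> Y \<or> Y \<subseteq> X)
      \<Longrightarrow> (\<Sum>i\<in>I. c i * of_bool (\<forall>X\<in>C. r X \<le> \<rho> i X)) = 0"
begin

definition null :: "(('a set \<Rightarrow> nat) \<Rightarrow> real poly) \<Rightarrow> bool" where
  "null g \<longleftrightarrow> (\<Sum>i\<in>I. smult (c i) (g (\<rho> i))) = 0"

lemma null_sum:
  assumes "\<And>k. k \<in> K \<Longrightarrow> null (g k)"
  shows "null (\<lambda>\<rho>. \<Sum>k\<in>K. g k \<rho>)"
proof -
  have "(\<Sum>i\<in>I. smult (c i) (\<Sum>k\<in>K. g k (\<rho> i))) = (\<Sum>k\<in>K. \<Sum>i\<in>I. smult (c i) (g k (\<rho> i)))"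
    by (subst sum.swap) (simp add: smult_sum_right)
  then show ?thesis using assms by (simp add: null_def)
qed

text \<open>Rank exactly \<open>r A\<close> is rank at least \<open>r A\<close> without rank at
  least \<open>r A + 1\<close>. This is applied to one member of the chain at a time;
  \<open>D\<close> holds those already made exact.\<close>

lemma relation_eq:
  assumes C: "C \<subseteq> Pow E" "\<And>X Y. X \<in> C \<Longrightarrow> Y \<in> C \<Longrightarrow> X \<subseteq> Y \<or> Y \<subseteq> X"
  shows "(\<Sum>i\<in>I. c i * of_bool (\<forall>X\<in>C. \<rho> i X = r X)) = 0"
proof -
  have finC: "finite C" using C(1) fin_E finite_subset by blast
  have gen: "(\<Sum>i\<in>I. c i * of_bool ((\<forall>X\<in>D. \<rho> i X = r X) \<and> (\<forall>X\<in>C. r X \<le> \<rho> i X))) = 0" if "D \<subseteq> C" for D r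
    using finite_subset[OF that finC] that
  proof (induction D arbitrary: r rule: finite_induct)
    case empty
    then show ?case using relation[OF C, of r] by simp
  next
    case (insert A D)
    let ?P = "\<lambda>r i. (\<forall>X\<in>D. \<rho> i X = r X) \<and> (\<forall>X\<in>C. r X \<le> \<rho> i X)"
    let ?r = "r(A := Suc (r A))"
    have "c i * of_bool ((\<forall>X\<in>insert A D. \<rho> i X = r X) \<and> (\<forall>X\<in>C. r X \<le> \<rho> i X))
      = c i * of_bool (?P r i) - c i * of_bool (?P ?r i)" for i
    proof -
      have AC: "A \<in> C" using insert.prems by simp
      have D: "(\<forall>X\<in>D. \<rho> i X = ?r X) \<longleftrightarrow> (\<forall>X\<in>D. \<rho> i X = r X)" using insert.hyps by auto
      have C: "(\<forall>X\<in>C. ?r X \<le> \<rho> i X) \<longleftrightarrow> (\<forall>X\<in>C. r X \<le> \<rho> i X) \<and> r A \<noteq> \<rho> i A"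
        using AC by (auto simp: Suc_le_eq order_less_le split: if_splits)
      show ?thesis unfolding D C by auto
    qed
    then show ?case using insert.IH[of r] insert.IH[of ?r] insert.prems by (simp add: sum_subtractf)
  qed
  have "(\<forall>X\<in>C. \<rho> i X = r X) \<longleftrightarrow> (\<forall>X\<in>C. \<rho> i X = r X) \<and> (\<forall>X\<in>C. r X \<le> \<rho> i X)" for i by auto
  then show ?thesis using gen[OF order_refl, of r] by presburger
qed

text \<open>\<open>g\<close> is a finite combination of indicators of rank profiles on
  \<open>C\<close>, since the profiles lie in the box \<open>R\<close>.\<close>

lemma null_depends_on:
  assumes C: "C \<subseteq> Pow E" "\<And>X Y. X \<in> C \<Longrightarrow> Y \<in> C \<Longrightarrow> X \<subseteq> Y \<or> Y \<subseteq> X"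
    and g: "depends_on C g"
  shows "null g"
proof -
  have finC: "finite C" using C(1) fin_E finite_subset by blast
  define R where "R = PiE C (\<lambda>X. {..card X})"
  have finR: "finite R" unfolding R_def using finC by (intro finite_PiE) auto
  have expand: "g (\<rho> i) = (\<Sum>r\<in>R. smult (of_bool (\<forall>X\<in>C. \<rho> i X = r X)) (g r))" if i: "i \<in> I" for i
  proof -
    have m: "restrict (\<rho> i) C \<in> R" unfolding R_def using bound[OF i] C(1) by auto
    have "(\<forall>X\<in>C. \<rho> i X = r X) \<longleftrightarrow> r = restrict (\<rho> i) C" if "r \<in> R" for r
      using that by (auto simp: R_def PiE_iff extensional_def restrict_def)
    then have "(\<Sum>r\<in>R. smult (of_bool (\<forall>X\<in>C. \<rho> i X = r X)) (g r)) = (\<Sum>r\<in>R. if r = restrict (\<rho> i) C then g r else 0)"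
      by (intro sum.cong refl) auto
    also have "\<dots> = g (restrict (\<rho> i) C)" using finR m by (simp add: sum.delta)
    also have "\<dots> = g (\<rho> i)" using g unfolding depends_on_def by (metis restrict_apply)
    finally show ?thesis by simp
  qed
  have "(\<Sum>i\<in>I. smult (c i) (g (\<rho> i))) = (\<Sum>i\<in>I. \<Sum>r\<in>R. smult (c i * of_bool (\<forall>X\<in>C. \<rho> i X = r X)) (g r))"
    by (intro sum.cong refl) (simp add: expand smult_sum_right)
  also have "\<dots> = (\<Sum>r\<in>R. smult (\<Sum>i\<in>I. c i * of_bool (\<forall>X\<in>C. \<rho> i X = r X)) (g r))"
    by (subst sum.swap) (simp add: smult_sum)
  also have "\<dots> = 0" using relation_eq[OF C] by simp
  finally show ?thesis by (simp add: null_def)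
qed

text \<open>\<open>\<Phi>\<close> carries the context of a recursive call: the cutoffs and monomial
  factors still to be applied, governed by ranks along a chain \<open>C\<close> above
  \<open>B\<close>. One unfolding of \<open>qhat\<close> puts \<open>F\<close>, \<open>X\<close>,
  \<open>B\<close> below \<open>C\<close> and absorbs a further factor and cutoff into the context.
  Additivity is preserved and lets the context move inside the sums.\<close>

lemma null_qhat:
  assumes "B \<subseteq> E" "C \<subseteq> Pow E" "\<And>X Y. X \<in> C \<Longrightarrow> Y \<in> C \<Longrightarrow> X \<subseteq> Y \<or> Y \<subseteq> X" "\<And>X. X \<in> C \<Longrightarrow> B \<subseteq> X"
    and "depends_on C \<Phi>" "\<And>\<rho> p q. \<Phi> \<rho> (p + q) = \<Phi> \<rho> p + \<Phi> \<rho> q"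
  shows "null (\<lambda>\<rho>. \<Phi> \<rho> (qhat \<rho> B))"
  using assms
proof (induction "card B" arbitrary: B C \<Phi> rule: less_induct)
  case less
  have finB: "finite B" using less.prems(1) fin_E finite_subset by blast
  show ?case
  proof (cases "B = {}")
    case True
    \<comment> \<open>At the bottom the polynomial is 1, and only the context remains.\<close>
    have "depends_on C (\<lambda>\<rho>. \<Phi> \<rho> 1)" using less.prems(5) unfolding depends_on_def by metis
    then show ?thesis using null_depends_on[OF less.prems(2,3)] True by simp
  next
    case False
    define T where "T \<rho> F X p = \<Phi> \<rho> (- poly_cutoff ((\<rho> B + 1) div 2) (p * monom ((-1) ^ card (X - F)) (\<rho> X - \<rho> F)))"
      for \<rho> F X p
    have T_add: "T \<rho> F X (p + q) = T \<rho> F X p + T \<rho> F X q" for \<rho> F X p q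
      by (simp add: T_def distrib_right poly_cutoff_add less.prems(6)[symmetric] add.commute)
    have hom: "\<Phi> \<rho> (- poly_cutoff k (\<Sum>x\<in>K. h x)) = (\<Sum>x\<in>K. \<Phi> \<rho> (- poly_cutoff k (h x)))"
      for \<rho> k and h :: "'z \<Rightarrow> real poly" and K
    proof -
      have 0: "\<Phi> \<rho> 0 = 0" using less.prems(6)[of \<rho> 0 0] by simp
      have add: "\<Phi> \<rho> (- p - q) = \<Phi> \<rho> (- p) + \<Phi> \<rho> (- q)" for p q
        using less.prems(6)[of \<rho> "- p" "- q"] by simp
      have "poly_cutoff k 0 = (0 :: real poly)" by (rule poly_eqI) (simp add: coeff_poly_cutoff)
      then show ?thesis
        by (induction K rule: infinite_finite_induct)
           (simp_all add: 0 poly_cutoff_add add)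
    qed
    have "\<Phi> \<rho> (qhat \<rho> B) = (\<Sum>F\<in>{F. F \<subset> B}. \<Sum>X\<in>{F..B}. T \<rho> F X (qhat \<rho> F))" for \<rho>
    proof -
      have "\<Phi> \<rho> (qhat \<rho> B) = \<Phi> \<rho> (- poly_cutoff ((\<rho> B + 1) div 2)
          (\<Sum>F\<in>{F. F \<subset> B}. \<Sum>X\<in>{F..B}. qhat \<rho> F * monom ((-1) ^ card (X - F)) (\<rho> X - \<rho> F)))"
        using finB False by (subst qhat.simps) (simp add: bkern_def sum_distrib_left)
      then show ?thesis by (simp only: hom T_def)
    qed
    moreover have "null (\<lambda>\<rho>. \<Sum>F\<in>{F. F \<subset> B}. \<Sum>X\<in>{F..B}. T \<rho> F X (qhat \<rho> F))"
    proof (intro null_sum)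
      fix F X assume "F \<in> {F. F \<subset> B}" and X: "X \<in> {F..B}"
      then have F: "F \<subset> B" by simp
      show "null (\<lambda>\<rho>. T \<rho> F X (qhat \<rho> F))"
      proof (rule less.hyps[where C = "insert F (insert X (insert B C))" and \<Phi> = "\<lambda>\<rho>. T \<rho> F X"])
        show "card F < card B" using F finB by (rule psubset_card_mono[rotated])
        show "F \<subseteq> E" "insert F (insert X (insert B C)) \<subseteq> Pow E" using F X less.prems(1,2) by auto
        fix Y assume "Y \<in> insert F (insert X (insert B C))"
        then show "F \<subseteq> Y" using F X less.prems(4) by auto
      next
        fix Y Z assume "Y \<in> insert F (insert X (insert B C))" "Z \<in> insert F (insert X (insert B C))"
        moreover have "F \<subseteq> B" "F \<subseteq> X" "X \<subseteq> B" using F X by auto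
        moreover have "F \<subseteq> Y \<and> X \<subseteq> Y \<and> B \<subseteq> Y" if "Y \<in> C" for Y
          using less.prems(4)[OF that] \<open>F \<subseteq> B\<close> \<open>X \<subseteq> B\<close> by auto
        ultimately show "Y \<subseteq> Z \<or> Z \<subseteq> Y" using less.prems(3) by (elim insertE) simp_all
      next
        show "depends_on (insert F (insert X (insert B C))) (\<lambda>\<rho>. T \<rho> F X)"
          unfolding depends_on_def
        proof (intro allI impI)
          fix \<rho> \<rho>' :: "'a set \<Rightarrow> nat"
          assume eq: "\<forall>X\<in>insert F (insert X (insert B C)). \<rho> X = \<rho>' X"
          then have "\<Phi> \<rho> = \<Phi> \<rho>'" using less.prems(5) unfolding depends_on_def by auto
          then show "T \<rho> F X = T \<rho>' F X" using eq by (simp add: T_def fun_eq_iff)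
        qed
      qed (rule T_add)
    qed
    ultimately show ?thesis by simp
  qed
qed

lemma null_ypoly:
  assumes B: "B \<subseteq> E"
  shows "null (\<lambda>\<rho>. ypoly \<rho> B)"
proof -
  define T where "T \<rho> F X p = (-1) ^ \<rho> B * (p * monom (of_bool (\<rho> X = \<rho> B) * (-1) ^ card (X - F)) (\<rho> B - \<rho> F))"
    for \<rho> :: "'a set \<Rightarrow> nat" and F X and p :: "real poly"
  have monom_sum: "monom (\<Sum>x\<in>K. h x) n = (\<Sum>x\<in>K. monom (h x) n)" for h :: "'z \<Rightarrow> real" and K n
    by (rule poly_eqI) (simp add: coeff_sum)
  have "ypoly \<rho> B = (\<Sum>F\<in>Pow B. \<Sum>X\<in>{F..B}. T \<rho> F X (qhat \<rho> F))" for \<rho>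
    by (simp add: ypoly_def T_def sum_distrib_left monom_sum)
  moreover have "null (\<lambda>\<rho>. \<Sum>F\<in>Pow B. \<Sum>X\<in>{F..B}. T \<rho> F X (qhat \<rho> F))"
  proof (intro null_sum)
    fix F X assume F: "F \<in> Pow B" and X: "X \<in> {F..B}"
    show "null (\<lambda>\<rho>. T \<rho> F X (qhat \<rho> F))"
    proof (rule null_qhat[where C = "{F, X, B}" and \<Phi> = "\<lambda>\<rho>. T \<rho> F X"])
      show "depends_on {F, X, B} (\<lambda>\<rho>. T \<rho> F X)" by (simp add: depends_on_def T_def fun_eq_iff)
      show "T \<rho> F X (p + q) = T \<rho> F X p + T \<rho> F X q" for \<rho> p q by (simp add: T_def algebra_simps)
    qed (use F X B in auto)
  qed
  ultimately show ?thesis by simp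
qed

end

section \<open>The inverse Kazhdan-Lusztig polynomial\<close>

context valid_matroid
begin

sublocale rank_function "rank_of M"
  by unfold_locales (simp_all add: rank_mono)

text \<open>\<open>e\<close> lies in the closure of \<open>F\<close>, so toggling it above
  \<open>F\<close> changes a sign but no rank. This annihilates both the kernel and the Moebius sum
  at nonflats.\<close>

lemma nonflat_toggle:
  assumes F: "F \<subseteq> ground M" "F \<notin> flats M"
  obtains e where "e \<in> ground M - F"
    "\<And>X. F \<subseteq> X \<Longrightarrow> X \<subseteq> ground M - {e} \<Longrightarrow>
      rank_of M (insert e X) = rank_of M X \<and> card (insert e X - F) = Suc (card (X - F))"
proof -
  obtain e where e: "e \<in> ground M" "e \<notin> F" "rank_of M (insert e F) = rank_of M F"
    using F unfolding flats_iff by blast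
  have "rank_of M (insert e X) = rank_of M X \<and> card (insert e X - F) = Suc (card (X - F))"
    if X: "F \<subseteq> X" "X \<subseteq> ground M - {e}" for X
  proof
    show "rank_of M (insert e X) = rank_of M X" by (rule rank_insert_absorb_mono[OF X(1) e(3)])
    have "insert e X - F = insert e (X - F)" using e by auto
    moreover have "finite X" using X finite_ground finite_subset by blast
    moreover have "e \<notin> X" using X by auto
    ultimately show "card (insert e X - F) = Suc (card (X - F))" by simp
  qed
  then show ?thesis using that e by blast
qed

lemma bkern_nonflat:
  assumes "F \<subseteq> ground M" "F \<notin> flats M"
  shows "bkern (rank_of M) F (ground M) = 0"
proof -
  obtain e where e: "e \<in> ground M - F" "\<And>X. F \<subseteq> X \<Longrightarrow> X \<subseteq> ground M - {e} \<Longrightarrow>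
      rank_of M (insert e X) = rank_of M X \<and> card (insert e X - F) = Suc (card (X - F))"
    using nonflat_toggle[OF assms] by blast
  show ?thesis unfolding bkern_def
    by (rule sum_toggle_zero[OF finite_ground e(1)]) (simp add: e(2) minus_monom)
qed

lemma moebius_sum_nonflat:
  assumes "F \<subseteq> ground M" "F \<notin> flats M"
  shows "(\<Sum>X\<in>{F..ground M}. of_bool (rank_of M X = rk M) * (-1) ^ card (X - F)) = (0::'b::comm_ring_1)"
proof -
  obtain e where e: "e \<in> ground M - F" "\<And>X. F \<subseteq> X \<Longrightarrow> X \<subseteq> ground M - {e} \<Longrightarrow>
      rank_of M (insert e X) = rank_of M X \<and> card (insert e X - F) = Suc (card (X - F))"
    using nonflat_toggle[OF assms] by blast
  show ?thesis by (rule sum_toggle_zero[OF finite_ground e(1)]) (simp add: e(2))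
qed

section \<open>Whitney's formulas\<close>

lemma sum_spanning_eq_sum_closure:
  assumes F: "F \<in> flats M" "F \<subseteq> A" "A \<subseteq> ground M"
  shows "(\<Sum>X\<in>Pow F. of_bool (rank_of M X = rank_of M F) * g X)
    = (\<Sum>X\<in>Pow A. of_bool (F = cl X) * (g X :: 'b::comm_ring_1))"
proof (rule sum.mono_neutral_cong_left)
  show "finite (Pow A)" using F finite_ground finite_subset by auto
  show "Pow F \<subseteq> Pow A" using F by auto
  show "\<forall>X\<in>Pow A - Pow F. of_bool (F = cl X) * g X = 0"
    using flat_eq_cl_iff[OF _ F(1)] F(3) by auto
  show "of_bool (rank_of M X = rank_of M F) * g X = of_bool (F = cl X) * g X" if "X \<in> Pow F" for X
    using flat_eq_cl_iff[OF _ F(1), of X] that F by auto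
qed

text \<open>Sort the subsets of \<open>F\<close> by closure: the spanning sums of all flats inside
  \<open>F\<close> add up to the alternating sum over all subsets, which is zero unless
  \<open>F\<close> is empty. That is the recursion of the Moebius function. With loops both sides
  vanish.\<close>

lemma moebius_flats:
  assumes "F \<in> flats M"
  shows "moebius (flats M) {} F = (\<Sum>X\<in>Pow F. of_bool (rank_of M X = rank_of M F) * (-1) ^ card X)"
  using assms
proof (induction "card F" arbitrary: F rule: less_induct)
  case less
  note F = less.prems
  define w :: "nat set \<Rightarrow> int" where
    "w F = (\<Sum>X\<in>Pow F. of_bool (rank_of M X = rank_of M F) * (-1) ^ card X)" for F
  have FE: "F \<subseteq> ground M" and finF: "finite F" using flat_subset[OF F] finite_ground finite_subset by auto
  show ?case
  proof (cases "F = {}")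
    case True
    then show ?thesis by (simp add: moebius.simps)
  next
    case False
    let ?L = "{Z \<in> flats M. Z \<subseteq> F}"
    have "sum w ?L = (\<Sum>Z\<in>?L. \<Sum>X\<in>Pow F. of_bool (Z = cl X) * (-1) ^ card X)"
      unfolding w_def by (intro sum.cong refl sum_spanning_eq_sum_closure) (use FE in auto)
    also have "\<dots> = (\<Sum>X\<in>Pow F. (-1) ^ card X * (\<Sum>Z\<in>?L. of_bool (Z = cl X)))"
      by (subst sum.swap) (simp add: sum_distrib_left mult.commute)
    also have "\<dots> = (\<Sum>X\<in>Pow F. (-1) ^ card X)"
    proof (rule sum.cong[OF refl])
      fix X assume X: "X \<in> Pow F"
      then have "cl X \<in> ?L" using cl_flat[of X] cl_least[OF _ F, of X] FE by auto
      then have "(\<Sum>Z\<in>?L. of_bool (Z = cl X)) = (1::int)"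
        using finite_flats by (simp add: of_bool_def sum.delta)
      then show "(-1) ^ card X * (\<Sum>Z\<in>?L. of_bool (Z = cl X)) = (-1 :: int) ^ card X" by simp
    qed
    also have "\<dots> = 0" using alternating_sum_above[OF finF, of "{}", where 'b = int] False
      by (simp add: atLeastAtMost_def Pow_def atMost_def)
    finally have "sum w ?L = 0" .
    moreover have "?L = insert F {Z \<in> flats M. {} \<subseteq> Z \<and> Z \<subset> F}" using F by auto
    ultimately have "w F + sum w {Z \<in> flats M. {} \<subseteq> Z \<and> Z \<subset> F} = 0"
      using finite_flats by simp
    moreover have "moebius (flats M) {} Z = w Z" if "Z \<in> {Z \<in> flats M. {} \<subseteq> Z \<and> Z \<subset> F}" for Z
      unfolding w_def using that finF by (intro less.hyps) (auto intro: psubset_card_mono)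
    ultimately show ?thesis
      using False finF by (subst moebius.simps) (simp add: w_def psubset_eq)
  qed
qed

lemma mu_eq: "mu M = (\<Sum>X\<in>Pow (ground M). of_bool (rank_of M X = rk M) * (-1) ^ card X)"
  unfolding mu_def by (rule moebius_flats[OF ground_flat])

lemma char_poly_eq: "char_poly M = (\<Sum>X\<in>Pow (ground M). monom ((-1) ^ card X) (rk M - rank_of M X))"
proof -
  have mono_sum: "monom (\<Sum>x\<in>K. h x) n = (\<Sum>x\<in>K. monom (h x) n)" for h :: "nat set \<Rightarrow> real" and K n
    by (rule poly_eqI) (simp add: coeff_sum)
  have "monom (of_int (mu (restriction M F))) (rk (contraction M F))
    = (\<Sum>X\<in>Pow (ground M). if F = cl X then monom ((-1) ^ card X) (rk M - rank_of M X) else (0::real poly))"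
    if F: "F \<in> flats M" for F
  proof -
    interpret R: valid_matroid "restriction M F" using is_matroid_restriction[OF flat_subset[OF F]] by unfold_locales
    have "mu (restriction M F) = (\<Sum>X\<in>Pow F. of_bool (rank_of M X = rank_of M F) * (-1) ^ card X)"
      unfolding R.mu_eq by (intro sum.cong) (auto simp: rank_restriction)
    also have "\<dots> = (\<Sum>X\<in>Pow (ground M). of_bool (F = cl X) * (-1) ^ card X)"
      by (rule sum_spanning_eq_sum_closure[OF F flat_subset[OF F] order_refl])
    finally have "monom (of_int (mu (restriction M F))) (rk (contraction M F))
      = (\<Sum>X\<in>Pow (ground M). monom (of_bool (F = cl X) * (-1) ^ card X) (rk M - rank_of M F) :: real poly)"
      using F by (simp add: mono_sum rk_contraction flat_subset)
    also have "\<dots> = (\<Sum>X\<in>Pow (ground M). if F = cl X then monom ((-1) ^ card X) (rk M - rank_of M X) else 0)"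
      by (intro sum.cong refl) (auto simp: rank_cl)
    finally show ?thesis .
  qed
  then have "char_poly M = (\<Sum>F\<in>flats M. \<Sum>X\<in>Pow (ground M).
      if F = cl X then monom ((-1) ^ card X) (rk M - rank_of M X) else 0)"
    unfolding char_poly_def by (rule sum.cong[OF refl])
  also have "\<dots> = (\<Sum>X\<in>Pow (ground M). \<Sum>F\<in>flats M.
      if F = cl X then monom ((-1) ^ card X) (rk M - rank_of M X) else 0)"
    by (rule sum.swap)
  also have "\<dots> = (\<Sum>X\<in>Pow (ground M). monom ((-1) ^ card X) (rk M - rank_of M X))"
    using finite_flats cl_flat by (intro sum.cong refl) (simp add: sum.delta)
  finally show ?thesis .
qed

text \<open>\<open>g\<close> receives the cardinality separately, since the sign counts elements
  outside \<open>F\<close> while the rank is taken with \<open>F\<close> included.\<close>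

lemma sum_contraction:
  assumes F: "F \<subseteq> ground M"
  shows "(\<Sum>X\<in>Pow (ground M - F). g (X \<union> F) (card X)) = (\<Sum>X\<in>{F..ground M}. g X (card (X - F)))"
  by (rule sum.reindex_bij_witness[of _ "\<lambda>X. X - F" "\<lambda>X. X \<union> F"])
     (use F in \<open>auto intro!: arg_cong[where f = "g _"] arg_cong[where f = card]\<close>)

lemma mu_contraction:
  assumes F: "F \<subseteq> ground M"
  shows "mu (contraction M F) = (\<Sum>X\<in>{F..ground M}. of_bool (rank_of M X = rk M) * (-1) ^ card (X - F))"
proof -
  interpret C: valid_matroid "contraction M F" using is_matroid_contraction by unfold_locales
  have "rank_of (contraction M F) X = rk (contraction M F) \<longleftrightarrow> rank_of M (X \<union> F) = rk M"
    if X: "X \<subseteq> ground M - F" for X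
  proof -
    have "rank_of (contraction M F) X = rank_of M (X \<union> F) - rank_of M F"
      using X by (intro rank_contraction) auto
    then show ?thesis
      using rk_contraction[OF F] rank_mono[OF F] rank_mono[of F "X \<union> F"] by auto
  qed
  then have "mu (contraction M F) = (\<Sum>X\<in>Pow (ground M - F). of_bool (rank_of M (X \<union> F) = rk M) * (-1) ^ card X)"
    unfolding C.mu_eq by (intro sum.cong) auto
  also have "\<dots> = (\<Sum>X\<in>{F..ground M}. of_bool (rank_of M X = rk M) * (-1) ^ card (X - F))"
    by (rule sum_contraction[OF F])
  finally show ?thesis .
qed

lemma char_poly_contraction:
  assumes F: "F \<subseteq> ground M" and t: "t \<noteq> 0"
  shows "t ^ rk (contraction M F) * poly (char_poly (contraction M F)) (1 / t)
    = poly (bkern (rank_of M) F (ground M)) t"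
proof -
  interpret C: valid_matroid "contraction M F" using is_matroid_contraction by unfold_locales
  let ?r = "rk (contraction M F)"
  have "t ^ ?r * poly (char_poly (contraction M F)) (1 / t)
    = (\<Sum>X\<in>Pow (ground M - F). (-1) ^ card X * t ^ (rank_of M (X \<union> F) - rank_of M F))"
    unfolding C.char_poly_eq poly_sum sum_distrib_left ground_contraction
  proof (rule sum.cong[OF refl])
    fix X assume X: "X \<in> Pow (ground M - F)"
    have le: "rank_of (contraction M F) X \<le> ?r" using X by (intro C.rank_mono) auto
    have r: "rank_of (contraction M F) X = rank_of M (X \<union> F) - rank_of M F"
      using X by (intro rank_contraction) auto
    have "t ^ ?r = t ^ (?r - rank_of (contraction M F) X) * t ^ rank_of (contraction M F) X"
      using le by (simp add: power_add[symmetric])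
    then show "t ^ rank_of (contraction M F) (ground M - F) * poly (monom ((- 1) ^ card X) (rank_of (contraction M F) (ground M - F) - rank_of (contraction M F) X)) (1 / t)
      = (-1) ^ card X * t ^ (rank_of M (X \<union> F) - rank_of M F)"
      using t unfolding r[symmetric] by (simp add: poly_monom power_divide)
  qed
  also have "\<dots> = poly (bkern (rank_of M) F (ground M)) t"
    unfolding poly_bkern
    by (rule sum_contraction[OF F, where g = "\<lambda>X n. (-1) ^ n * t ^ (rank_of M X - rank_of M F)"])
  finally show ?thesis .
qed

lemma rk_0_iff: "loopless M \<Longrightarrow> rk M = 0 \<longleftrightarrow> ground M = {}"
  using loopless_rank_pos[of "ground M"] by (cases "ground M = {}") auto

end

section \<open>Existence and uniqueness of the inverse polynomials\<close>

definition Q_poly :: "matroid \<Rightarrow> real poly" where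
  "Q_poly M = (if is_matroid M \<and> loopless M then (-1) ^ rk M * qhat (rank_of M) (ground M) else 0)"

lemma (in valid_matroid) Q_restriction:
  assumes "loopless M" "F \<subseteq> ground M"
  shows "Q_poly (restriction M F) = (-1) ^ rank_of M F * qhat (rank_of M) F"
  using loopless_restriction[OF assms] is_matroid_restriction[OF assms(2)]
  by (simp add: Q_poly_def rank_restriction qhat_cong[of F "rank_of (restriction M F)" "rank_of M"])

text \<open>The sign in \<open>Q_poly\<close> absorbs the signs of the defining identity, which
  becomes \<open>qhat_identity\<close>; the additional nonflats contribute zero. Looplessness makes
  rank zero mean an empty ground set, where \<open>qhat\<close> is 1.\<close>

lemma inverse_KL_assignment_Q: "inverse_KL_assignment Q_poly"
  unfolding inverse_KL_assignment_def
proof (intro conjI allI impI)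
  fix M assume hM: "is_matroid M \<and> loopless M"
  then interpret valid_matroid M by unfold_locales simp
  have Q: "Q_poly M = (-1) ^ rk M * qhat (rank_of M) (ground M)" using hM by (simp add: Q_poly_def)
  have poly_sign: "poly ((-1) ^ n * p) t = (-1) ^ n * poly p t" for n p and t :: real by simp
  show "Q_poly M = 1" if "rk M = 0" using that Q rk_0_iff hM by simp
  show "real (degree (Q_poly M)) < real (rk M) / 2" if "0 < rk M"
  proof -
    have "degree (Q_poly M) = degree (qhat (rank_of M) (ground M))"
      unfolding Q by (cases "even (rk M)") auto
    then show ?thesis using degree_qhat_less[OF finite_ground that] by simp
  qed
  fix t :: real assume t: "t \<noteq> 0"
  have "(- t) ^ rk M * poly (Q_poly M) (1 / t) = t ^ rk M * poly (qhat (rank_of M) (ground M)) (1 / t)"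
    unfolding Q poly_sign power_minus[of t] by (simp add: power_mult_distrib[symmetric] mult.assoc[symmetric])
  also have "\<dots> = (\<Sum>F\<in>Pow (ground M). poly (qhat (rank_of M) F) t * poly (bkern (rank_of M) F (ground M)) t)"
    by (rule qhat_identity[OF finite_ground t])
  also have "\<dots> = (\<Sum>F\<in>flats M. poly (qhat (rank_of M) F) t * poly (bkern (rank_of M) F (ground M)) t)"
    using finite_ground flat_subset bkern_nonflat by (intro sum.mono_neutral_right) auto
  also have "\<dots> = (\<Sum>F\<in>flats M. (-1) ^ rank_of M F * poly (Q_poly (restriction M F)) t *
      t ^ rk (contraction M F) * poly (char_poly (contraction M F)) (1 / t))"
  proof (rule sum.cong[OF refl])
    fix F assume F: "F \<in> flats M"
    have "poly (qhat (rank_of M) F) t = (-1) ^ rank_of M F * poly (Q_poly (restriction M F)) t"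
      unfolding Q_restriction[OF conjunct2[OF hM] flat_subset[OF F]] poly_sign
      by (simp add: power_mult_distrib[symmetric] mult.assoc[symmetric])
    then show "poly (qhat (rank_of M) F) t * poly (bkern (rank_of M) F (ground M)) t
      = (-1) ^ rank_of M F * poly (Q_poly (restriction M F)) t * t ^ rk (contraction M F) * poly (char_poly (contraction M F)) (1 / t)"
      unfolding char_poly_contraction[OF flat_subset[OF F] t, symmetric] by (simp add: mult.assoc)
  qed
  finally show "(- t) ^ rk M * poly (Q_poly M) (1 / t) = (\<Sum>F\<in>flats M. (-1) ^ rank_of M F * poly (Q_poly (restriction M F)) t *
      t ^ rk (contraction M F) * poly (char_poly (contraction M F)) (1 / t))" .
qed (auto simp: Q_poly_def)

text \<open>Coefficients at \<open>i\<close> and \<open>r - i\<close> agree, and one of the two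
  indices exceeds the degree.\<close>

lemma palindromic_low_degree_zero:
  fixes D :: "real poly"
  assumes "2 * degree D < r" "\<And>t. t \<noteq> 0 \<Longrightarrow> t ^ r * poly D (1 / t) = poly D t"
  shows "D = 0"
proof (rule poly_eqI)
  fix i
  have "rev_poly r D = D"
    by (rule poly_eq_if_eq_nonzero) (use assms in \<open>simp add: poly_rev_poly\<close>)
  then have "coeff D i = (if i \<le> r then coeff D (r - i) else 0)" by (metis coeff_rev_poly)
  moreover have "i > degree D \<or> r - i > degree D" using assms(1) by linarith
  ultimately show "coeff D i = coeff 0 i" using coeff_eq_0 by (metis coeff_0)
qed

text \<open>By induction two assignments agree below the whole ground set, so in the difference of
  the identities only its term survives. This makes \<open>Q M - Q' M\<close> palindromic, which the
  degree bound permits only for zero.\<close>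

lemma inverse_KL_assignment_unique:
  assumes Q: "inverse_KL_assignment Q" and Q': "inverse_KL_assignment Q'"
  shows "Q = Q'"
proof
  fix M
  show "Q M = Q' M"
  proof (induction "card (ground M)" arbitrary: M rule: less_induct)
    case less
    show ?case
    proof (cases "is_matroid M \<and> loopless M")
      case False
      then show ?thesis using Q Q' unfolding inverse_KL_assignment_def by metis
    next
      case hM: True
      then interpret valid_matroid M by unfold_locales simp
      note q = Q[unfolded inverse_KL_assignment_def, THEN conjunct1, rule_format, OF hM]
        and q' = Q'[unfolded inverse_KL_assignment_def, THEN conjunct1, rule_format, OF hM]
      show ?thesis
      proof (cases "rk M = 0")
        case True
        then show ?thesis using q q' by simp
      next
        case False
        define s where "s Q t F = (-1) ^ rank_of M F * poly (Q (restriction M F)) t *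
          t ^ rk (contraction M F) * poly (char_poly (contraction M F)) (1 / t)"
          for Q :: "matroid \<Rightarrow> real poly" and t F
        have restr: "restriction M (ground M) = M"
        proof -
          have "bases (restriction M (ground M)) = bases M"
          proof
            show "bases M \<subseteq> bases (restriction M (ground M))"
              unfolding bases_restriction using base_subset card_base indep_base by auto
            show "bases (restriction M (ground M)) \<subseteq> bases M"
              unfolding restriction_def using base_subset by (auto simp: Int_absorb1)
          qed
          then show ?thesis by (simp add: matroid.expand)
        qed
        have top: "s Q t (ground M) = (-1) ^ rk M * poly (Q M) t" if t: "t \<noteq> 0" for Q t
        proof -
          have "t ^ rk (contraction M (ground M)) * poly (char_poly (contraction M (ground M))) (1 / t) = 1"
            using char_poly_contraction[OF order_refl t] by simp
          then show ?thesis by (simp add: s_def restr mult.assoc)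
        qed
        have low: "s Q t F = s Q' t F" if F: "F \<in> flats M - {ground M}" for t F
        proof -
          have "F \<subset> ground M" using F flat_subset by blast
          then have "card (ground (restriction M F)) < card (ground M)"
            using finite_ground by (simp add: psubset_card_mono)
          then have "Q (restriction M F) = Q' (restriction M F)" by (rule less.hyps)
          then show ?thesis by (simp add: s_def)
        qed
        have split: "(\<Sum>F\<in>flats M. s Q t F) = s Q t (ground M) + (\<Sum>F\<in>flats M - {ground M}. s Q t F)" for Q t
          using finite_flats ground_flat by (rule sum.remove)
        define D where "D = Q M - Q' M"
        have "D = 0"
        proof (rule palindromic_low_degree_zero)
          have "2 * degree (Q M) < rk M" "2 * degree (Q' M) < rk M" using q q' False by auto
          then show "2 * degree D < rk M" unfolding D_def using degree_diff_le_max[of "Q M" "Q' M"] by linarith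
          fix t :: real assume t: "t \<noteq> 0"
          have "(- t) ^ rk M * poly (Q M) (1 / t) - (- t) ^ rk M * poly (Q' M) (1 / t)
            = (\<Sum>F\<in>flats M. s Q t F) - (\<Sum>F\<in>flats M. s Q' t F)"
            using q q' t by (simp add: s_def)
          also have "\<dots> = (-1) ^ rk M * poly D t"
            unfolding split top[OF t] using low by (simp add: D_def algebra_simps)
          finally have "(-1) ^ rk M * (t ^ rk M * poly D (1 / t)) = (-1) ^ rk M * poly D t"
            by (simp add: D_def power_minus[of t] algebra_simps)
          then show "t ^ rk M * poly D (1 / t) = poly D t" by simp
        qed
        then show ?thesis by (simp add: D_def)
      qed
    qed
  qed
qed

lemma inverse_KL_eq: "inverse_KL = Q_poly"
  unfolding inverse_KL_def
  using inverse_KL_assignment_Q inverse_KL_assignment_unique by (intro the_equality) auto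

section \<open>Y as a function of ranks\<close>

lemma (in valid_matroid) Y_loopless_eq:
  assumes ll: "loopless M"
  shows "Y_loopless M = ypoly (rank_of M) (ground M)"
proof -
  let ?h = "\<lambda>F. qhat (rank_of M) F * monom (\<Sum>X\<in>{F..ground M}. of_bool (rank_of M X = rk M) * (-1) ^ card (X - F)) (rk M - rank_of M F)"
  have "(\<Sum>F\<in>flats M. (-1) ^ rank_of M F * inverse_KL (restriction M F) *
        monom (of_int (mu (contraction M F))) (rk (contraction M F))) = (\<Sum>F\<in>flats M. ?h F)"
  proof (rule sum.cong[OF refl])
    fix F assume "F \<in> flats M"
    then have F: "F \<subseteq> ground M" by (rule flat_subset)
    have "(-1) ^ rank_of M F * inverse_KL (restriction M F) = qhat (rank_of M) F"
      unfolding inverse_KL_eq Q_restriction[OF ll F]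
      by (simp add: power_mult_distrib[symmetric] mult.assoc[symmetric])
    then show "(-1) ^ rank_of M F * inverse_KL (restriction M F) *
        monom (of_int (mu (contraction M F))) (rk (contraction M F)) = ?h F"
      by (simp add: mu_contraction[OF F] rk_contraction[OF F])
  qed
  also have "\<dots> = (\<Sum>F\<in>Pow (ground M). ?h F)"
    using finite_ground flat_subset moebius_sum_nonflat by (intro sum.mono_neutral_left) auto
  finally show ?thesis by (simp add: Y_loopless_def ypoly_def)
qed

text \<open>Keeping the rank function of \<open>M\<close> and shrinking only the set lets the
  polytope and its cells be compared on one set, without passing to deletions.\<close>

lemma (in valid_matroid) Y_poly_eq: "Y_poly M = ypoly (rank_of M) (ground M - loops M)"
proof (cases "loopless M")
  case True
  then show ?thesis by (simp add: Y_poly_def Y_loopless_eq loopless_def)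
next
  case False
  let ?B = "ground M - loops M"
  interpret R: valid_matroid "restriction M ?B" using is_matroid_restriction by unfold_locales auto
  have "loopless (restriction M ?B)"
    unfolding R.loopless_iff using rank_restriction loops_iff by auto
  then have "Y_loopless (deletion M (loops M)) = ypoly (rank_of (restriction M ?B)) ?B"
    using R.Y_loopless_eq by (simp add: deletion_def)
  also have "\<dots> = ypoly (rank_of M) ?B" by (rule ypoly_cong) (simp add: rank_restriction)
  finally show ?thesis using False by (simp add: Y_poly_def)
qed

lemma Y_poly_iso:
  assumes "is_matroid M" "is_matroid N" "matroid_iso M N"
  shows "Y_poly M = Y_poly N"
proof -
  interpret M: valid_matroid M using assms by unfold_locales
  interpret N: valid_matroid N using assms by unfold_locales
  obtain \<phi> where bij: "bij_betw \<phi> (ground M) (ground N)" and bases: "bases N = (\<lambda>B. \<phi> ` B) ` bases M"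
    using assms(3) unfolding matroid_iso_def by blast
  have inj: "inj_on \<phi> (ground M)" and img: "\<phi> ` ground M = ground N" using bij by (auto simp: bij_betw_def)
  have rank: "rank_of N (\<phi> ` X) = rank_of M X" if X: "X \<subseteq> ground M" for X
  proof -
    have "card (\<phi> ` X \<inter> \<phi> ` B) = card (X \<inter> B)" if B: "B \<in> bases M" for B
    proof -
      have "\<phi> ` X \<inter> \<phi> ` B = \<phi> ` (X \<inter> B)"
        using inj_on_image_Int[OF inj X M.base_subset[OF B]] by simp
      moreover have "inj_on \<phi> (X \<inter> B)" using inj X by (auto intro: inj_on_subset)
      ultimately show ?thesis by (simp add: card_image)
    qed
    then have "(\<lambda>B. card (\<phi> ` X \<inter> B)) ` bases N = (\<lambda>B. card (X \<inter> B)) ` bases M"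
      unfolding bases image_image by (intro image_cong) auto
    then show ?thesis by (simp add: rank_of_def)
  qed
  have iff: "\<phi> e \<in> loops N \<longleftrightarrow> e \<in> loops M" if "e \<in> ground M" for e
    using rank[of "{e}"] that img by (auto simp: M.loops_iff N.loops_iff)
  have LM: "loops M \<subseteq> ground M" and LN: "loops N \<subseteq> \<phi> ` ground M" by (auto simp: loops_def img)
  have "loops N = \<phi> ` loops M"
  proof
    show "loops N \<subseteq> \<phi> ` loops M"
    proof
      fix x assume x: "x \<in> loops N"
      then obtain e where "e \<in> ground M" "x = \<phi> e" using LN by blast
      then show "x \<in> \<phi> ` loops M" using x iff by simp
    qed
    show "\<phi> ` loops M \<subseteq> loops N" using iff LM by auto
  qed
  moreover note LM
  ultimately have "ground N - loops N = \<phi> ` (ground M - loops M)"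
    using img inj_on_image_set_diff[OF inj, of "ground M" "loops M"] by auto
  then show ?thesis
    using inj rank by (simp add: M.Y_poly_eq N.Y_poly_eq) (intro ypoly_image[symmetric], auto intro: inj_on_subset)
qed

section \<open>Base polytopes\<close>

lemma convex_hull_linear_le:
  fixes l :: "'a::real_vector \<Rightarrow> real"
  assumes l: "linear l" and V: "\<And>v. v \<in> V \<Longrightarrow> l v \<le> c" and x: "x \<in> convex hull V"
  shows "l x \<le> c"
proof -
  have "convex (l -` {..c})" by (intro convex_linear_vimage l) simp
  then have "convex hull V \<subseteq> l -` {..c}" using V by (intro hull_minimal) auto
  then show ?thesis using x by auto
qed

lemma linear_sum_lookup: "linear (\<lambda>x::vec. \<Sum>j\<in>X. Poly_Mapping.lookup x j)"
  by (intro linearI) (simp_all add: Poly_Mapping.lookup_add lookup_scaleR_vec sum.distrib sum_distrib_left)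

context valid_matroid
begin

abbreviation "polytope_of \<equiv> convex hull (indicator_vec ` bases M)"

lemma indicator_in_polytope: "B \<in> bases M \<Longrightarrow> indicator_vec B \<in> polytope_of"
  by (intro hull_inc) auto

lemma sum_lookup_indicator:
  assumes "B \<in> bases M" "finite X"
  shows "(\<Sum>j\<in>X. Poly_Mapping.lookup (indicator_vec B) j) = real (card (X \<inter> B))"
  using assms finite_base[OF assms(1)] by (simp add: lookup_indicator_vec sum.If_cases)

lemma polytope_sum_le_rank:
  assumes x: "x \<in> polytope_of" and X: "finite X"
  shows "(\<Sum>j\<in>X. Poly_Mapping.lookup x j) \<le> real (rank_of M X)"
  by (rule convex_hull_linear_le[OF linear_sum_lookup _ x])
     (use X card_Int_le_rank in \<open>auto simp: sum_lookup_indicator\<close>)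

lemma polytope_lookup_nonneg:
  assumes x: "x \<in> polytope_of"
  shows "Poly_Mapping.lookup x i \<ge> 0"
proof -
  have "linear (\<lambda>x::vec. - Poly_Mapping.lookup x i)"
    using linear_lookup by (rule linear_compose_neg)
  then have "- Poly_Mapping.lookup x i \<le> 0"
    by (rule convex_hull_linear_le[OF _ _ x]) (use finite_base in \<open>auto simp: lookup_indicator_vec\<close>)
  then show ?thesis by simp
qed

lemma polytope_lookup_le:
  assumes x: "x \<in> polytope_of"
  shows "Poly_Mapping.lookup x i \<le> real (rank_of M {i})"
  using polytope_sum_le_rank[OF x, of "{i}"] by simp

lemma rank_outside: "i \<notin> ground M \<Longrightarrow> rank_of M {i} = 0"
proof -
  assume i: "i \<notin> ground M"
  obtain B where B: "B \<in> bases M" "card ({i} \<inter> B) = rank_of M {i}" using rank_witness .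
  then have "{i} \<inter> B = {}" using i base_subset by blast
  then show ?thesis using B by simp
qed

lemma polytope_keys: "x \<in> polytope_of \<Longrightarrow> Poly_Mapping.keys x \<subseteq> ground M"
  using polytope_lookup_nonneg[of x] polytope_lookup_le[of x] rank_outside
  by (metis in_keys_iff of_nat_0 order_antisym subsetI)

text \<open>The slack \<open>1/2\<close> is harmless as ranks are integers; by the greedy algorithm a single vertex
  maximizes the functionals of all members of the chain.\<close>

lemma polytope_meets_iff:
  assumes C: "finite C" "\<And>X. X \<in> C \<Longrightarrow> finite X" "\<And>X Y. X \<in> C \<Longrightarrow> Y \<in> C \<Longrightarrow> X \<subseteq> Y \<or> Y \<subseteq> X"
  shows "polytope_of \<inter> (\<Inter>X\<in>C. {x. real (r X) - 1/2 < (\<Sum>j\<in>X. Poly_Mapping.lookup x j)}) \<noteq> {}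
    \<longleftrightarrow> (\<forall>X\<in>C. r X \<le> rank_of M X)"
proof
  assume "polytope_of \<inter> (\<Inter>X\<in>C. {x. real (r X) - 1/2 < (\<Sum>j\<in>X. Poly_Mapping.lookup x j)}) \<noteq> {}"
  then obtain x where x: "x \<in> polytope_of" "\<And>X. X \<in> C \<Longrightarrow> real (r X) - 1/2 < (\<Sum>j\<in>X. Poly_Mapping.lookup x j)"
    by blast
  show "\<forall>X\<in>C. r X \<le> rank_of M X"
  proof
    fix X assume X: "X \<in> C"
    have "real (r X) - 1/2 < real (rank_of M X)"
      using x(2)[OF X] polytope_sum_le_rank[OF x(1) C(2)[OF X]] by linarith
    then show "r X \<le> rank_of M X" by linarith
  qed
next
  assume le: "\<forall>X\<in>C. r X \<le> rank_of M X"
  obtain B where B: "B \<in> bases M" "\<And>X. X \<in> C \<Longrightarrow> card (X \<inter> B) = rank_of M X"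
    using chain_basis[OF C(1,3)] by blast
  have "real (r X) - 1/2 < (\<Sum>j\<in>X. Poly_Mapping.lookup (indicator_vec B) j)" if X: "X \<in> C" for X
  proof -
    have "r X \<le> rank_of M X" using le X by blast
    then show ?thesis using B(2)[OF X] by (simp add: sum_lookup_indicator[OF B(1) C(2)[OF X]])
  qed
  then show "polytope_of \<inter> (\<Inter>X\<in>C. {x. real (r X) - 1/2 < (\<Sum>j\<in>X. Poly_Mapping.lookup x j)}) \<noteq> {}"
    using indicator_in_polytope[OF B(1)] by blast
qed

lemma rel_core_polytope: "rel_core polytope_of \<noteq> {}"
  using finite_bases bases_nonempty by (intro rel_core_hull_finite) auto

lemma rel_interior_polytope: "rel_interior polytope_of = rel_core polytope_of"
  by (rule rel_interior_eq_rel_core[OF convex_convex_hull finite_ground polytope_keys rel_core_polytope])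

end

text \<open>An element is a loop iff its coordinate vanishes on the polytope. A coordinate that
  vanishes at a core point of the larger polytope vanishes on all of it: otherwise prolonging away
  from a base containing \<open>e\<close> makes it negative.\<close>

lemma loops_interior_cell:
  assumes "is_matroid M" "is_matroid N" "ground N = ground M"
    and sub: "convex hull (indicator_vec ` bases N) \<subseteq> convex hull (indicator_vec ` bases M)"
    and int: "convex hull (indicator_vec ` bases N) \<inter> rel_core (convex hull (indicator_vec ` bases M)) \<noteq> {}"
  shows "loops N = loops M"
proof -
  interpret M: valid_matroid M using assms by unfold_locales
  interpret N: valid_matroid N using assms by unfold_locales
  have "rank_of M {e} = 0 \<longleftrightarrow> rank_of N {e} = 0" for e
  proof
    assume 0: "rank_of M {e} = 0"
    obtain B where B: "B \<in> bases N" "card ({e} \<inter> B) = rank_of N {e}" using N.rank_witness .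
    have "Poly_Mapping.lookup (indicator_vec B) e \<le> 0"
      using M.polytope_lookup_le[of "indicator_vec B" e] N.indicator_in_polytope[OF B(1)] sub 0 by auto
    then have "e \<notin> B" using N.finite_base[OF B(1)] by (simp add: lookup_indicator_vec split: if_splits)
    then show "rank_of N {e} = 0" using B(2) by simp
  next
    assume 0: "rank_of N {e} = 0"
    obtain x where x: "x \<in> N.polytope_of" "x \<in> rel_core M.polytope_of" using int by blast
    have xe: "Poly_Mapping.lookup x e = 0"
      using N.polytope_lookup_le[OF x(1), of e] N.polytope_lookup_nonneg[OF x(1), of e] 0 by simp
    obtain B where B: "B \<in> bases M" "card ({e} \<inter> B) = rank_of M {e}" using M.rank_witness .
    obtain d where d: "d > 0" "x + d *\<^sub>R (x - indicator_vec B) \<in> M.polytope_of"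
      using x(2) M.indicator_in_polytope[OF B(1)] unfolding rel_core_def by blast
    have "0 \<le> Poly_Mapping.lookup (x + d *\<^sub>R (x - indicator_vec B)) e" by (rule M.polytope_lookup_nonneg[OF d(2)])
    then have "0 \<le> - d * Poly_Mapping.lookup (indicator_vec B) e"
      by (simp add: Poly_Mapping.lookup_add lookup_scaleR_vec lookup_minus xe)
    then have "e \<notin> B" using d(1) M.finite_base[OF B(1)] by (simp add: lookup_indicator_vec split: if_splits)
    then show "rank_of M {e} = 0" using B(2) by simp
  qed
  then show ?thesis using assms(3) by (auto simp: M.loops_iff N.loops_iff)
qed

section \<open>The valuation property\<close>

lemma polytope_dim_eq: "polytope_dim P = dim (dirs P)"
  by (simp add: polytope_dim_def dirs_def)

lemma valuation_Y: "valuation (on_base_polytopes Y_poly :: polytope \<Rightarrow> real poly)"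
  unfolding valuation_def
proof (intro allI impI)
  fix E P S
  assume "is_base_polytope (E, P) \<and> subdivision E P S"
  then obtain M where M: "is_matroid M" "(E, P) = base_polytope M" and S: "subdivision E P S"
    unfolding is_base_polytope_def by blast
  interpret M: valid_matroid M using M(1) by unfold_locales
  have E: "ground M = E" and P_eq: "P = M.polytope_of" using M(2) by (auto simp: base_polytope_def)
  have "\<exists>N. is_matroid N \<and> (E, R) = base_polytope N" if "R \<in> S" for R
    using S that unfolding subdivision_def is_base_polytope_def by simp
  then obtain N where N: "\<And>R. R \<in> S \<Longrightarrow> is_matroid (N R)" "\<And>R. R \<in> S \<Longrightarrow> (E, R) = base_polytope (N R)"
    by metis
  have NE: "ground (N R) = E" and NP: "R = convex hull (indicator_vec ` bases (N R))" if "R \<in> S" for R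
    using N(2)[OF that] by (auto simp: base_polytope_def)
  have validN: "valid_matroid (N R)" if "R \<in> S" for R using N(1)[OF that] by unfold_locales
  interpret convex_subdivision P S
  proof
    show "finite S" "P = \<Union>S" using S by (auto simp: subdivision_def)
    show "convex P" unfolding P_eq by simp
    show "convex R" if "R \<in> S" for R by (subst NP[OF that]) simp
  qed (use S in \<open>auto simp: subdivision_def\<close>)
  \<comment> \<open>A cell lies in the closure of \<open>P\<close>, so it fails to be inside the
    relative frontier exactly when it meets the relative interior.\<close>
  define K where "K = {R \<in> S. R \<inter> rel_core P \<noteq> {}}"
  have K: "interior_cells P S = K"
  proof -
    have ri: "rel_interior P = rel_core P" unfolding P_eq by (rule M.rel_interior_polytope)
    have "R \<subseteq> P" if "R \<in> S" for R using that Un by blast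
    then show ?thesis
      using closure_subset[of P] unfolding interior_cells_def K_def rel_frontier_def ri by blast
  qed
  have finK: "finite K" using fin by (simp add: K_def)
  define I where "I = insert None (Some ` K)"
  \<comment> \<open>The whole polytope enters with the opposite sign, which turns the Euler relation
    into a vanishing sum.\<close>
  define c :: "vec set option \<Rightarrow> real" where
    "c i = (case i of None \<Rightarrow> - ((-1) ^ polytope_dim P) | Some R \<Rightarrow> (-1) ^ polytope_dim R)" for i
  define \<rho> where "\<rho> i = rank_of (case i of None \<Rightarrow> M | Some R \<Rightarrow> N R)" for i
  have expand: "(\<Sum>i\<in>I. g i) = g None + (\<Sum>R\<in>K. g (Some R))" for g :: "vec set option \<Rightarrow> 'z::ab_group_add"
    unfolding I_def using finK by (subst sum.insert) (auto simp: sum.reindex)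
  interpret chain_relation I c \<rho> E
  proof
    show "finite I" using finK by (simp add: I_def)
    show "finite E" using M.finite_ground E by simp
    then show "\<rho> i X \<le> card X" if "i \<in> I" "X \<subseteq> E" for i X
      using that M.rank_le_card valid_matroid.rank_le_card[OF validN] finite_subset[of X E]
      by (auto simp: I_def \<rho>_def K_def)
    fix C r assume C: "C \<subseteq> Pow E" "\<And>X Y. X \<in> C \<Longrightarrow> Y \<in> C \<Longrightarrow> X \<subseteq> Y \<or> Y \<subseteq> X"
    define U where "U = (\<Inter>X\<in>C. {x::vec. real (r X) - 1/2 < (\<Sum>j\<in>X. Poly_Mapping.lookup x j)})"
    have finC: "finite C" using C(1) \<open>finite E\<close> by (simp add: finite_subset)
    have finX: "finite X" if "X \<in> C" for X using C(1) \<open>finite E\<close> that finite_subset by blast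
    have meets: "P \<inter> U \<noteq> {} \<longleftrightarrow> (\<forall>X\<in>C. r X \<le> \<rho> None X)"
      unfolding P_eq U_def \<rho>_def by (simp only: option.case) (rule M.polytope_meets_iff[OF finC finX C(2)])
    have meetsR: "R \<inter> U \<noteq> {} \<longleftrightarrow> (\<forall>X\<in>C. r X \<le> \<rho> (Some R) X)" if "R \<in> S" for R
      unfolding U_def \<rho>_def
      by (subst NP[OF that], simp only: option.case) (rule valid_matroid.polytope_meets_iff[OF validN[OF that] finC finX C(2)])
    have keysP: "Poly_Mapping.keys x \<subseteq> E" if "x \<in> P" for x using M.polytope_keys that E P_eq by auto
    have "(\<Sum>R\<in>K. (-1) ^ dim (dirs R) * of_bool (R \<inter> U \<noteq> {})) = ((-1) ^ dim (dirs P) * of_bool (P \<inter> U \<noteq> {}) :: real)"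
      unfolding K_def
    proof (rule euler_relation_cells[where J = E and l = "\<lambda>j x. Poly_Mapping.lookup x j"
          and W = "(\<lambda>i. Poly_Mapping.single i 1) ` E"])
      show "finite E" "finite ((\<lambda>i. Poly_Mapping.single i 1 :: vec) ` E)" using \<open>finite E\<close> by auto
      show "linear (\<lambda>x::vec. Poly_Mapping.lookup x j)" for j by (rule linear_lookup)
      show "P \<subseteq> span ((\<lambda>i. Poly_Mapping.single i 1) ` E)" using keys_subset_span[OF \<open>finite E\<close>] keysP by blast
      show "rel_core P \<noteq> {}" unfolding P_eq by (rule M.rel_core_polytope)
      show "rel_core R \<noteq> {}" if "R \<in> S" for R by (subst NP[OF that]) (rule valid_matroid.rel_core_polytope[OF validN[OF that]])
      show "bounded ((\<lambda>x. Poly_Mapping.lookup x j) ` P)" for j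
      proof (rule bounded_subset[OF bounded_closed_interval])
        show "(\<lambda>x. Poly_Mapping.lookup x j) ` P \<subseteq> {0..real (rank_of M {j})}"
          unfolding P_eq using M.polytope_lookup_nonneg M.polytope_lookup_le by auto
      qed
      show "x = y" if xy: "x \<in> P" "y \<in> P" "\<And>j. j \<in> E \<Longrightarrow> Poly_Mapping.lookup x j = Poly_Mapping.lookup y j" for x y
      proof (rule poly_mapping_eqI)
        fix k show "Poly_Mapping.lookup x k = Poly_Mapping.lookup y k"
          using xy(3) keysP[OF xy(1)] keysP[OF xy(2)] by (metis in_keys_iff subsetD)
      qed
      show "alg_open U" unfolding U_def by (intro alg_open_INT finC alg_open_halfspace linear_sum_lookup)
      show "convex U"
      proof -
        have "convex {x::vec. a < (\<Sum>j\<in>X. Poly_Mapping.lookup x j)}" for a X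
          using convex_linear_vimage[OF linear_sum_lookup[of X], of "{a<..}"] by (simp add: vimage_def)
        then show ?thesis unfolding U_def by (intro convex_INT)
      qed
    qed
    moreover have "(\<Sum>R\<in>K. c (Some R) * of_bool (\<forall>X\<in>C. r X \<le> \<rho> (Some R) X))
      = (\<Sum>R\<in>K. (-1) ^ dim (dirs R) * of_bool (R \<inter> U \<noteq> {}))"
      using meetsR by (intro sum.cong refl) (simp add: c_def polytope_dim_eq K_def)
    ultimately show "(\<Sum>i\<in>I. c i * of_bool (\<forall>X\<in>C. r X \<le> \<rho> i X)) = 0"
      unfolding expand by (simp add: c_def polytope_dim_eq meets)
  qed
  \<comment> \<open>Interior cells share the loops of \<open>M\<close>, so one set serves every
    index.\<close>
  let ?B = "E - loops M"
  let ?Y = "on_base_polytopes Y_poly :: polytope \<Rightarrow> real poly"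
  have YP: "?Y (E, P) = ypoly (\<rho> None) ?B"
    using M on_base_polytopes_base_polytope[OF M(1), of Y_poly] by (simp add: M.Y_poly_eq \<rho>_def E)
  have YR: "?Y (E, R) = ypoly (\<rho> (Some R)) ?B" if R: "R \<in> K" for R
  proof -
    have RS: "R \<in> S" "R \<inter> rel_core P \<noteq> {}" using R by (auto simp: K_def)
    have "R \<subseteq> P" using RS Un by blast
    then have "loops (N R) = loops M"
      using RS NP[OF RS(1)] P_eq by (intro loops_interior_cell M N) (simp_all add: NE E)
    then show ?thesis
      using N(2)[OF RS(1)] on_base_polytopes_base_polytope[OF N(1)[OF RS(1)], of Y_poly]
      by (simp add: valid_matroid.Y_poly_eq[OF validN[OF RS(1)]] \<rho>_def NE[OF RS(1)])
  qed
  have "(\<Sum>i\<in>I. smult (c i) (ypoly (\<rho> i) ?B)) = 0"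
    using null_ypoly[of ?B] by (simp add: null_def)
  then have "smult ((-1) ^ polytope_dim P) (?Y (E, P)) = (\<Sum>R\<in>K. smult ((-1) ^ polytope_dim R) (?Y (E, R)))"
    unfolding expand using YP YR by (simp add: c_def)
  \<comment> \<open>Multiplying by the sign of \<open>P\<close> isolates its term and turns the
    other signs into products, which depend only on the parity of the difference of
    dimensions.\<close>
  then have "smult ((-1) ^ polytope_dim P) (smult ((-1) ^ polytope_dim P) (?Y (E, P)))
    = (\<Sum>R\<in>K. smult ((-1) ^ polytope_dim P * (-1) ^ polytope_dim R) (?Y (E, R)))"
    by (simp add: smult_sum_right)
  then have "?Y (E, P) = (\<Sum>R\<in>K. smult ((-1) ^ polytope_dim P * (-1) ^ polytope_dim R) (?Y (E, R)))"
    by (simp add: power_mult_distrib[symmetric])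
  also have "\<dots> = (\<Sum>R\<in>K. if even (int (polytope_dim P) - int (polytope_dim R)) then ?Y (E, R) else - ?Y (E, R))"
    by (intro sum.cong refl) (auto simp: minus_one_power_iff)
  finally show "?Y (E, P) = (\<Sum>R\<in>interior_cells P S.
      if even (int (polytope_dim P) - int (polytope_dim R)) then ?Y (E, R) else - ?Y (E, R))"
    by (simp only: K)
qed

theorem theorem1p2:
  shows "valuative_invariant (on_base_polytopes Y_poly :: polytope \<Rightarrow> real poly)"
  unfolding valuative_invariant_def polytope_invariant_def
  using valuation_Y by (simp add: on_base_polytopes_base_polytope Y_poly_iso)

end
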